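(* For all integers $n$ for which the arguments are positive, $\overline{\mathrm{spt}}_\omega(3n)\equiv 0\pmod 3$, $\overline{\mathrm{spt}}_{\omega}(3n+2)\equiv 0\pmod 3$, $\overline{\mathrm{spt}}_{\omega}(10n+6)\equiv 0\pmod 5$, and $\overline{\mathrm{spt}}_{\omega}(6n+5)\equiv 0\pmod 6$.
   Context: An overpartition of $n$ is a partition of $n$ in which the first occurrence of each distinct part may be overlined. $\overline{\mathrm{spt}}_{\omega}(n)$ is the number of smallest parts in the overpartitions of $n$ in which the smallest part is always overlined and all odd parts are less than twice the smallest part; equivalently $\sum_{n\ge1}\overline{\mathrm{spt}}_{\omega}(n)q^n=\sum_{n\ge1}\frac{q^{n}(-q^{n+1};q)_{n}(-q^{2n+2};q^2)_{\infty}}{(1-q^n)^2(q^{n+1};q)_n(q^{2n+2};q^2)_{\infty}}$, with $(a;q)_n=\prod_{j=0}^{n-1}(1-aq^j)$, $(a;q)_\infty=\prod_{j\ge0}(1-aq^j)$. *)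

theory Defs
  imports Main "HOL-Library.Multiset"
begin

text \<open>An overpartition of n: a multiset M of positive parts summing to n, together with
  the set Ov of distinct parts whose first occurrence is overlined (Ov \<subseteq> set of parts).\<close>
definition overpartitions :: "nat \<Rightarrow> (nat multiset \<times> nat set) set" where
  "overpartitions n = {(M, Ov). (\<forall>k\<in>#M. 0 < k) \<and> sum_mset M = n \<and> Ov \<subseteq> set_mset M}"

definition spt_omega_overpartitions :: "nat \<Rightarrow> (nat multiset \<times> nat set) set" where
  "spt_omega_overpartitions n = {(M, Ov) \<in> overpartitions n. M \<noteq> {#} \<and>
      Min (set_mset M) \<in> Ov \<and> (\<forall>k\<in>#M. odd k \<longrightarrow> k < 2 * Min (set_mset M))}"

definition spt_omega_bar :: "nat \<Rightarrow> nat" where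
  "spt_omega_bar n = (\<Sum>(M, Ov) \<in> spt_omega_overpartitions n. count M (Min (set_mset M)))"

end

theory Submission
  imports Defs "HOL-Computational_Algebra.Computational_Algebra"
begin

text \<open>
  A Bailey pair and a telescoping sum turn the generating function \<open>F\<close> into
  \<open>\<phi>(q^2) F(q) = L(q) + S(q^2)\<close> with the theta function \<open>\<phi>(q) = \<Sum>j. (-1)^j q^(j^2)\<close>, the Lambert series
  \<open>L = \<Sum>n. \<sigma>(n) q^n\<close> and an Appell-type series \<open>S\<close>. Summing \<open>\<phi> S\<close> and its moments over lattice points in a
  sheared cone expresses them by theta moments and Lambert series, so that modulo 3 and 5 the quotient
  \<open>S/\<phi>\<close> satisfies a linear differential equation in \<open>q d/dq\<close> with quasimodular right-hand side. Ramanujan-type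
  relations, obtained from the same lattice sums, then give \<open>(D + 1) w \<equiv> 0\<close> modulo 3 and
  \<open>w \<equiv> (D - 3) G\<close> modulo 5 for the even part \<open>w\<close> of \<open>F\<close>. In odd degrees \<open>S\<close> does not contribute, and
  \<open>F\<close> is \<open>L(q)/\<phi>(q^2)\<close> there, for which \<open>(D - 1) F \<equiv> 0\<close> modulo 3. Finally \<open>F \<equiv> L\<close> modulo 2 in odd degrees.
\<close>

section \<open>Power series indexed by admissible exponents\<close>

text \<open>The shape of the argument is dictated by denominators. The lattice sums deliver the
  differential equations multiplied by 3 or by 15, so reducing them modulo 3 or 5 at once would say
  nothing. Every relation is therefore kept exact over the integers until its right-hand side has
  been written as 3 or 5 times an explicit quotient; only then may m^3 \<equiv> m and m^5 \<equiv> m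
  be applied. Producing these quotients is the task of the Ramanujan-type relations, taken at q and
  at q^2.

  The operators are read coefficientwise. (D + 1) w \<equiv> 0 leaves only degrees m \<equiv> 2
  modulo 3, which is N = 2m \<equiv> 1, and (D - 1) F \<equiv> 0 leaves only N \<equiv> 1, so in
  both parities the residues 0 and 2 vanish. D - 3 multiplies degree 5n + 3 by 5n, and that degree
  of w is degree 10n + 6 of F.

  Theta is matched with the truncated products of the generating function by comparing logarithmic
  derivatives.\<close>

text \<open>The series \<open>\<Sum>i\<in>I. c i q^(e i)\<close>. Coefficients with infinite index sets are the junk value 0, as are
  negative exponents; \<open>qok\<close> excludes both.\<close>

definition qseries :: "'i set \<Rightarrow> ('i \<Rightarrow> int) \<Rightarrow> ('i \<Rightarrow> int) \<Rightarrow> int fps" where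
  "qseries I c e = Abs_fps (\<lambda>N. \<Sum>i | i \<in> I \<and> e i = int N. c i)"

definition qok :: "'i set \<Rightarrow> ('i \<Rightarrow> int) \<Rightarrow> bool" where
  "qok I e \<longleftrightarrow> (\<forall>i\<in>I. 0 \<le> e i) \<and> (\<forall>N. finite {i \<in> I. e i \<le> N})"

lemma qseries_nth: "fps_nth (qseries I c e) N = (\<Sum>i | i \<in> I \<and> e i = int N. c i)"
  by (simp add: qseries_def)

lemma qokI:
  assumes "\<And>i. i \<in> I \<Longrightarrow> 0 \<le> e i"
    and "\<And>N. \<exists>B. finite B \<and> {i \<in> I. e i \<le> N} \<subseteq> B"
  shows "qok I e"
proof -
  have "finite {i \<in> I. e i \<le> N}" for N
    using assms(2)[of N] finite_subset by blast
  then show ?thesis using assms(1) by (simp add: qok_def)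
qed

lemma qok_bounded:
  assumes "\<And>i. i \<in> I \<Longrightarrow> 0 \<le> e i" "\<And>N. finite (B N)"
    and "\<And>N i. i \<in> I \<Longrightarrow> e i \<le> N \<Longrightarrow> i \<in> B N"
  shows "qok I e"
  by (rule qokI, rule assms(1), assumption, rule exI[of _ "B _"]) (use assms(2,3) in auto)

lemma qok_finite: "qok I e \<Longrightarrow> finite {i \<in> I. e i = N}"
  unfolding qok_def by (rule finite_subset[of _ "{i \<in> I. e i \<le> N}"]) auto

lemma qok_subset: "qok I e \<Longrightarrow> J \<subseteq> I \<Longrightarrow> qok J e"
proof -
  assume *: "qok I e" "J \<subseteq> I"
  have "finite {i \<in> J. e i \<le> N}" for N
    by (rule finite_subset[of _ "{i \<in> I. e i \<le> N}"]) (use * in \<open>auto simp: qok_def\<close>)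
  then show ?thesis using * by (auto simp: qok_def)
qed

lemma qok_Un: "qok I e \<Longrightarrow> qok J e \<Longrightarrow> qok (I \<union> J) e"
proof -
  assume *: "qok I e" "qok J e"
  have "{i \<in> I \<union> J. e i \<le> N} = {i \<in> I. e i \<le> N} \<union> {i \<in> J. e i \<le> N}" for N by auto
  then show ?thesis using * unfolding qok_def by auto
qed

lemma qok_bij:
  assumes "bij_betw h I J" "\<And>i. i \<in> I \<Longrightarrow> f (h i) = e i" "qok I e"
  shows "qok J f"
proof -
  have J: "J = h ` I" using assms(1) by (simp add: bij_betw_def)
  have "{j \<in> J. f j \<le> N} \<subseteq> h ` {i \<in> I. e i \<le> N}" for N using assms(2) J by auto
  then have "finite {j \<in> J. f j \<le> N}" for N
    using assms(3) finite_subset[of "{j \<in> J. f j \<le> N}" "h ` {i \<in> I. e i \<le> N}"] by (simp add: qok_def)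
  then show ?thesis using assms(2,3) J by (auto simp: qok_def)
qed

lemma qseries_add: "qseries I c e + qseries I d e = qseries I (\<lambda>i. c i + d i) e"
  by (rule fps_ext) (simp add: qseries_nth sum.distrib)

lemma qseries_diff: "qseries I c e - qseries I d e = qseries I (\<lambda>i. c i - d i) e"
  by (rule fps_ext) (simp add: qseries_nth sum_subtractf)

lemma qseries_uminus: "- qseries I c e = qseries I (\<lambda>i. - c i) e"
  by (rule fps_ext) (simp add: qseries_nth sum_negf)

lemma qseries_cmult: "of_int k * qseries I c e = qseries I (\<lambda>i. k * c i) e"
  by (rule fps_ext) (simp add: qseries_nth sum_distrib_left flip: fps_of_int)

lemma qseries_numeral_mult: "numeral k * qseries I c e = qseries I (\<lambda>i. numeral k * c i) e"
  using qseries_cmult[of "numeral k"] by simp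

lemma qseries_cong:
  "I = J \<Longrightarrow> (\<And>i. i \<in> J \<Longrightarrow> c i = d i) \<Longrightarrow> (\<And>i. i \<in> J \<Longrightarrow> e i = f i) \<Longrightarrow> qseries I c e = qseries J d f"
  unfolding qseries_def by (intro arg_cong[where f=Abs_fps] ext sum.cong) auto

lemma qseries_zero: "(\<And>i. i \<in> I \<Longrightarrow> c i = 0) \<Longrightarrow> qseries I c e = 0"
  by (rule fps_ext) (simp add: qseries_nth)

lemma qseries_Un:
  assumes "qok I e" "qok J e" "I \<inter> J = {}"
  shows "qseries (I \<union> J) c e = qseries I c e + qseries J c e"
proof (rule fps_ext)
  fix N
  have "{i \<in> I \<union> J. e i = int N} = {i \<in> I. e i = int N} \<union> {i \<in> J. e i = int N}" by auto
  then show "fps_nth (qseries (I \<union> J) c e) N = fps_nth (qseries I c e + qseries J c e) N"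
    using assms qok_finite[OF assms(1)] qok_finite[OF assms(2)]
    by (simp add: qseries_nth) (rule sum.union_disjoint, auto)
qed

lemma qseries_bij:
  assumes "bij_betw h I J" "\<And>i. i \<in> I \<Longrightarrow> d (h i) = c i" "\<And>i. i \<in> I \<Longrightarrow> f (h i) = e i"
  shows "qseries I c e = qseries J d f"
proof (rule fps_ext)
  fix N
  have "bij_betw h {i \<in> I. e i = int N} {j \<in> J. f j = int N}"
    using assms by (auto simp: bij_betw_def inj_on_def image_iff)
  then show "fps_nth (qseries I c e) N = fps_nth (qseries J d f) N"
    unfolding qseries_nth
    by (subst sum.reindex_bij_betw[symmetric, where h=h and S="{i \<in> I. e i = int N}"])
       (auto simp: assms intro!: sum.cong)
qed

text \<open>The involution makes the series equal to its own negative, and the coefficients are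
  torsion free. Fixed points need no exclusion: there \<open>c i = - c i\<close> forces weight
  0.\<close>

lemma qseries_invol:
  assumes "\<And>i. i \<in> I \<Longrightarrow> h i \<in> I" "\<And>i. i \<in> I \<Longrightarrow> h (h i) = i"
    "\<And>i. i \<in> I \<Longrightarrow> c (h i) = - c i" "\<And>i. i \<in> I \<Longrightarrow> e (h i) = e i"
  shows "qseries I c e = 0"
proof -
  have "bij_betw h I I"
    by (rule bij_betw_byWitness[where f'=h]) (use assms in auto)
  then have "qseries I c e = qseries I (\<lambda>i. - c i) e"
    by (rule qseries_bij) (use assms in auto)
  then have "qseries I c e = - qseries I c e" by (simp add: qseries_uminus)
  then have *: "fps_nth (qseries I c e) n = - fps_nth (qseries I c e) n" for n
    by (metis fps_neg_nth)
  show ?thesis by (rule fps_ext) (use * in \<open>simp add: equation_minus_iff\<close>)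
qed

lemma qok_times:
  assumes "qok I e" "qok J f"
  shows "qok (I \<times> J) (\<lambda>(i,j). e i + f j)"
proof (rule qokI)
  show "\<And>i. i \<in> I \<times> J \<Longrightarrow> 0 \<le> (case i of (i, j) \<Rightarrow> e i + f j)"
    using assms by (auto simp: qok_def)
  fix N
  have "{i \<in> I \<times> J. (case i of (i, j) \<Rightarrow> e i + f j) \<le> N} \<subseteq> {i\<in>I. e i \<le> N} \<times> {j\<in>J. f j \<le> N}"
    using assms by (fastforce simp: qok_def)
  then show "\<exists>B. finite B \<and> {i \<in> I \<times> J. (case i of (i, j) \<Rightarrow> e i + f j) \<le> N} \<subseteq> B"
    using assms unfolding qok_def by (intro exI[of _ "{i\<in>I. e i \<le> N} \<times> {j\<in>J. f j \<le> N}"]) auto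
qed

lemma qseries_mult:
  assumes "qok I e" "qok J f"
  shows "qseries I c e * qseries J d f = qseries (I \<times> J) (\<lambda>(i,j). c i * d j) (\<lambda>(i,j). e i + f j)"
proof (rule fps_ext)
  fix N
  let ?S = "\<lambda>k. {i \<in> I. e i = int k}" and ?T = "\<lambda>k. {j \<in> J. f j = int k}"
  have eq: "{x \<in> I \<times> J. (case x of (i, j) \<Rightarrow> e i + f j) = int N} = (\<Union>k\<in>{0..N}. ?S k \<times> ?T (N - k))"
  proof (intro set_eqI iffI)
    fix x assume x: "x \<in> {x \<in> I \<times> J. (case x of (i, j) \<Rightarrow> e i + f j) = int N}"
    then obtain i j where ij: "x = (i,j)" "i \<in> I" "j \<in> J" "e i + f j = int N" by auto
    then have "0 \<le> e i" "0 \<le> f j" using assms by (auto simp: qok_def)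
    then show "x \<in> (\<Union>k\<in>{0..N}. ?S k \<times> ?T (N - k))" using ij
      by (auto intro!: bexI[of _ "nat (e i)"])
  qed auto
  have "fps_nth (qseries I c e * qseries J d f) N = (\<Sum>k=0..N. (\<Sum>i\<in>?S k. c i) * (\<Sum>j\<in>?T (N-k). d j))"
    by (simp add: fps_mult_nth qseries_nth)
  also have "\<dots> = (\<Sum>k=0..N. \<Sum>x\<in>?S k \<times> ?T (N-k). case x of (i,j) \<Rightarrow> c i * d j)"
    by (simp add: sum_product sum.cartesian_product)
  also have "\<dots> = (\<Sum>x\<in>(\<Union>k\<in>{0..N}. ?S k \<times> ?T (N - k)). case x of (i,j) \<Rightarrow> c i * d j)"
    by (rule sum.UNION_disjoint[symmetric]) (auto intro!: qok_finite assms)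
  finally show "fps_nth (qseries I c e * qseries J d f) N =
      fps_nth (qseries (I \<times> J) (\<lambda>(i,j). c i * d j) (\<lambda>(i,j). e i + f j)) N"
    by (simp add: qseries_nth eq)
qed

section \<open>The derivation q d/dq\<close>

definition qD :: "int fps \<Rightarrow> int fps" where "qD f = fps_X * fps_deriv f"

lemma qD_nth: "fps_nth (qD f) n = int n * fps_nth f n"
  by (cases n) (simp_all add: qD_def)

lemma qD_add: "qD (f + g) = qD f + qD g"
  and qD_diff: "qD (f - g) = qD f - qD g"
  and qD_uminus: "qD (- f) = - qD f"
  and qD_mult: "qD (f * g) = qD f * g + f * qD g"
  by (simp_all add: qD_def algebra_simps)

lemma qD_of_int [simp]: "qD (of_int j) = 0"
  by (rule fps_ext) (auto simp: qD_nth simp flip: fps_of_int)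

lemma qD_0 [simp]: "qD 0 = 0" and qD_1 [simp]: "qD 1 = 0"
  and qD_numeral [simp]: "qD (numeral k) = 0"
  using qD_of_int[of 0] qD_of_int[of 1] qD_of_int[of "numeral k"] by simp_all

lemma qD_qseries: "qD (qseries I c e) = qseries I (\<lambda>i. e i * c i) e"
  by (rule fps_ext) (auto simp: qD_nth qseries_nth sum_distrib_left intro!: sum.cong)

lemma qseries_fst:
  assumes "qok I e" "\<And>i. i \<in> I \<Longrightarrow> finite (J i)"
  shows "qseries (SIGMA i:I. J i) c (\<lambda>x. e (fst x)) = qseries I (\<lambda>i. \<Sum>j\<in>J i. c (i,j)) e"
proof (rule fps_ext)
  fix N
  have "{x \<in> (SIGMA i:I. J i). e (fst x) = int N} = (SIGMA i:{i\<in>I. e i = int N}. J i)" by auto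
  then show "fps_nth (qseries (SIGMA i:I. J i) c (\<lambda>x. e (fst x))) N
     = fps_nth (qseries I (\<lambda>i. \<Sum>j\<in>J i. c (i,j)) e) N"
    using assms qok_finite[OF assms(1)] by (simp add: qseries_nth sum.Sigma)
qed

text \<open>Constant factors of series identities are divided out by this cancellation, so the
  quotients stay integral and can be reduced modulo 3 or 5 afterwards.\<close>

lemma int_fps_numeral_cancel:
  assumes "numeral k * x = numeral k * (y :: int fps)"
  shows "x = y"
proof (rule fps_ext)
  fix n
  have "fps_nth (numeral k * x) n = fps_nth (numeral k * y) n" by (simp only: assms)
  then show "fps_nth x n = fps_nth y n" by (simp only: fps_numeral_fps_const fps_mult_left_const_nth) simp
qed

section \<open>Theta moments and odd Lambert series\<close>

text \<open>This is (-1)^k for integer k; the summation indices run through negative values as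
  well.\<close>

definition sg :: "int \<Rightarrow> int" where "sg k = (if even k then 1 else -1)"

lemma sg_add: "sg (a + b) = sg a * sg b" and sg_minus [simp]: "sg (- a) = sg a"
  and sg_diff: "sg (a - b) = sg a * sg b" and sg_0 [simp]: "sg 0 = 1"
  and sg_mult_self [simp]: "sg a * sg a = 1" and sg_odd: "odd a \<Longrightarrow> sg a = -1"
  by (auto simp: sg_def)

lemma abs_le_square_int: "\<bar>k\<bar> \<le> (k::int)^2"
proof (cases "k = 0")
  case False
  then have "\<bar>k\<bar> * 1 \<le> \<bar>k\<bar> * \<bar>k\<bar>" by (intro mult_left_mono) auto
  then show ?thesis by (simp add: power2_eq_square)
qed simp

lemma qok_square: "qok UNIV (\<lambda>j::int. j^2)"
proof (rule qok_bounded[where B="\<lambda>N. {-N..N}"])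
  fix N j :: int assume "j^2 \<le> N"
  then show "j \<in> {-N..N}" using abs_le_square_int[of j] by (simp add: abs_le_iff)
qed auto

definition pos2 :: "(int \<times> int) set" where "pos2 = {(a,i). 1 \<le> a \<and> 1 \<le> i}"
definition podd :: "(int \<times> int) set" where "podd = {(a,i). 1 \<le> a \<and> 1 \<le> i \<and> odd i}"

lemma qok_prod: "qok pos2 (\<lambda>(a,i). a * i)"
proof (rule qok_bounded[where B="\<lambda>N. {0..N} \<times> {0..N}"])
  fix N and x :: "int \<times> int" assume x: "x \<in> pos2" "(case x of (a,i) \<Rightarrow> a * i) \<le> N"
  obtain a i where ai: "x = (a,i)" by (cases x)
  with x have *: "1 \<le> a" "1 \<le> i" "a * i \<le> N" by (simp_all add: pos2_def)
  have "a * 1 \<le> a * i" by (rule mult_left_mono) (use * in simp_all)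
  from order_trans[OF this *(3)] have "a \<le> N" by simp
  have "1 * i \<le> a * i" by (rule mult_right_mono) (use * in simp_all)
  from order_trans[OF this *(3)] have "i \<le> N" by simp
  with \<open>a \<le> N\<close> show "x \<in> {0..N} \<times> {0..N}" using *(1,2) by (simp add: ai)
qed (simp_all add: pos2_def case_prod_unfold)

lemma podd_subset: "podd \<subseteq> pos2" by (auto simp: podd_def pos2_def)

lemma qok_prod_odd: "qok podd (\<lambda>(a,i). a * i)"
  by (rule qok_subset[OF qok_prod podd_subset])

definition theta4 :: "nat \<Rightarrow> int fps" where
  "theta4 i = qseries UNIV (\<lambda>j. sg j * j^i) (\<lambda>j. j^2)"
text \<open>For r = 1, 3, 5 these are the nonconstant parts of Eisenstein series: E_2 = 1 - 24
  \<open>lam 1\<close>, E_4 = 1 + 240 \<open>lam 3\<close>, E_6 = 1 - 504 \<open>lam 5\<close>.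
  Restricting the cofactor to odd values, as in \<open>lam_odd\<close>, gives the level 2 variants
  that appear when theta is differentiated.\<close>

definition lam :: "nat \<Rightarrow> int fps" where
  "lam r = qseries pos2 (\<lambda>(a,i). a^r) (\<lambda>(a,i). a * i)"
definition lam_odd :: "nat \<Rightarrow> int fps" where
  "lam_odd r = qseries podd (\<lambda>(a,i). a^r) (\<lambda>(a,i). a * i)"

lemma theta4_odd: "odd i \<Longrightarrow> theta4 i = 0"
  unfolding theta4_def by (rule qseries_invol[where h=uminus]) auto

lemma qD_theta4: "qD (theta4 i) = theta4 (i + 2)"
  unfolding theta4_def qD_qseries by (rule qseries_cong) (auto simp: power_add power2_eq_square)

lemma qD_theta4_0: "qD (theta4 0) = theta4 2" and qD_theta4_2: "qD (theta4 2) = theta4 4"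
  and qD_theta4_4: "qD (theta4 4) = theta4 6"
  using qD_theta4[of 0] qD_theta4[of 2] qD_theta4[of 4] by (simp_all del: add_2_eq_Suc')

lemma card_odd_interval: "0 \<le> k \<Longrightarrow> card {h. odd h \<and> \<bar>h\<bar> < 2*k} = nat (2 * (k::int))"
proof -
  assume k: "0 \<le> k"
  have "{h. odd h \<and> \<bar>h\<bar> < 2*k} = (\<lambda>i. 2*i+1) ` {-k..k-1}"
    by (auto elim!: oddE simp: image_iff)
  then show ?thesis using k by (simp add: card_image inj_on_def)
qed

text \<open>Substituting \<open>j + a = \<plusminus>k\<close> turns the exponent into \<open>k^2 + x^2 + x h\<close>, on which
  \<open>x \<mapsto> - h - x\<close> is a sign-reversing involution; the terms with \<open>x = 0\<close> make up the left-hand side.\<close>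

lemma theta4_lam_odd:
  assumes r: "odd r"
  shows "theta4 (r+1) = - 2 * qseries (UNIV \<times> podd) (\<lambda>(j,a,i). sg j * (j + a)^r) (\<lambda>(j,a,i). j^2 + a * i)"
proof -
  let ?T = "UNIV \<times> podd :: (int \<times> int \<times> int) set"
  let ?c = "\<lambda>(j,a,i). sg j * (j + a)^r" and ?e = "\<lambda>(j,a,i::int). j^2 + a * i"
  let ?T1 = "{(j,a,i). (a,i) \<in> podd \<and> 1 \<le> j + a}" and ?T2 = "{(j,a,i). (a,i) \<in> podd \<and> j + a \<le> -1}"
    and ?T3 = "{(j,a,i). (a,i) \<in> podd \<and> j + a = 0}"
  let ?d = "\<lambda>(k,h::int,x). sg (k+x) * k^r" and ?f = "\<lambda>(k,h,x). k^2 + x^2 + x * h"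
  \<comment> \<open>\<open>P1\<close> and \<open>P2\<close> are the images of \<open>T1\<close> and
    \<open>T2\<close> under \<open>k = \<bar>j + a\<bar>\<close>, \<open>x = a\<close>,
    \<open>h = i - 2 (j + a)\<close>. As \<open>r\<close> is odd, the second enters with a minus
    sign, and only the strip \<open>\<bar>h\<bar> < 2k\<close> between them survives.\<close>
  let ?P1 = "{(k,h,x). 1 \<le> k \<and> odd h \<and> 1 \<le> x \<and> 1 - 2*k \<le> h} :: (int \<times> int \<times> int) set"
  let ?P2 = "{(k,h,x). 1 \<le> k \<and> odd h \<and> 1 \<le> x \<and> 1 + 2*k \<le> h} :: (int \<times> int \<times> int) set"
  let ?B = "\<lambda>X. {(k,h,x). 1 \<le> k \<and> odd h \<and> \<bar>h\<bar> < 2*k \<and> x \<in> X} :: (int \<times> int \<times> int) set"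
  have okT: "qok ?T ?e"
    using qok_times[OF qok_square qok_prod_odd] by (simp add: case_prod_unfold)
  have ok1: "qok ?T1 ?e" "qok ?T2 ?e" "qok ?T3 ?e" by (rule qok_subset[OF okT]; auto)+
  have b1: "bij_betw (\<lambda>(j,a,i). (j+a, i - 2*(j+a), a)) ?T1 ?P1"
    by (rule bij_betw_byWitness[where f'="\<lambda>(k,h,x). (k-x,x,h+2*k)"]) (auto simp: podd_def)
  have b2: "bij_betw (\<lambda>(j,a,i). (-(j+a), i - 2*(j+a), a)) ?T2 ?P2"
    by (rule bij_betw_byWitness[where f'="\<lambda>(k,h,x). (-k-x,x,h-2*k)"]) (auto simp: podd_def)
  have f1: "?f ((\<lambda>(j,a,i). (j+a, i - 2*(j+a), a)) y) = ?e y" for y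
    by (auto simp: case_prod_unfold power2_eq_square algebra_simps)
  have f2: "?f ((\<lambda>(j,a,i). (-(j+a), i - 2*(j+a), a)) y) = ?e y" for y
    by (auto simp: case_prod_unfold power2_eq_square algebra_simps)
  have s1: "qseries ?T1 ?c ?e = qseries ?P1 ?d ?f"
    by (rule qseries_bij[OF b1]) (auto simp: sg_add power2_eq_square algebra_simps)
  have s2: "qseries ?T2 ?c ?e = qseries ?P2 (\<lambda>x. - ?d x) ?f"
  proof (rule qseries_bij[OF b2])
    show "?f ((\<lambda>(j,a,i). (-(j+a), i - 2*(j+a), a)) y) = ?e y" for y by (rule f2)
    fix y :: "int \<times> int \<times> int"
    have "(-(j+a))^r = - ((j+a)^r)" for j a :: int by (rule power_minus_odd[OF r])
    moreover have "sg (-(j+a) + a) = sg j" for j a using sg_minus[of j] by simp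
    ultimately show "- ?d ((\<lambda>(j,a,i). (-(j+a), i - 2*(j+a), a)) y) = ?c y"
      by (simp add: case_prod_unfold)
  qed
  have okP1: "qok ?P1 ?f" by (rule qok_bij[OF b1 f1 ok1(1)])
  have okP2: "qok ?P2 ?f" by (rule qok_bij[OF b2 f2 ok1(2)])
  have okBp: "qok (?B {1..}) ?f" by (rule qok_subset[OF okP1]) auto
  have bm: "bij_betw (\<lambda>(k,h,x). (k,-h,-x)) (?B {1..}) (?B {..-1})"
    by (rule bij_betw_byWitness[where f'="\<lambda>(k,h,x). (k,-h,-x)"]) auto
  have okBm: "qok (?B {..-1}) ?f" by (rule qok_bij[OF bm _ okBp]) auto
  have sm: "qseries (?B {..-1}) ?d ?f = qseries (?B {1..}) ?d ?f"
    by (rule qseries_bij[OF bm, symmetric]) (auto simp: sg_add)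
  have b0: "bij_betw (\<lambda>(k,h). (k,h,0)) (SIGMA k:{1..}. {h. odd h \<and> \<bar>h\<bar> < 2*k}) (?B {0})"
    by (rule bij_betw_byWitness[where f'="\<lambda>(k,h,x). (k,h)"]) auto
  have fin: "finite {h. odd h \<and> \<bar>h\<bar> < 2*(k::int)}" for k
    by (rule finite_subset[of _ "{-(2*k)..2*k}"]) auto
  have ok0: "qok {1::int..} (\<lambda>k. k^2)" by (rule qok_subset[OF qok_square]) auto
  have okS: "qok (SIGMA k:{1::int..}. {h. odd h \<and> \<bar>h\<bar> < 2*k}) (\<lambda>x. (fst x)^2)"
  proof (rule qokI)
    fix N :: int
    have "{x \<in> (SIGMA k:{1::int..}. {h. odd h \<and> \<bar>h\<bar> < 2*k}). (fst x)^2 \<le> N}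
        = (SIGMA k:{k\<in>{1..}. k^2 \<le> N}. {h. odd h \<and> \<bar>h\<bar> < 2*k})" by auto
    moreover have "finite \<dots>" using ok0 fin by (intro finite_SigmaI) (auto simp: qok_def)
    ultimately show "\<exists>B. finite B \<and> {x \<in> (SIGMA k:{1::int..}. {h. odd h \<and> \<bar>h\<bar> < 2*k}). (fst x)^2 \<le> N} \<subseteq> B"
      by blast
  qed auto
  have okB0: "qok (?B {0}) ?f" by (rule qok_bij[OF b0 _ okS]) auto
  have "qseries (?B {0}) ?d ?f = qseries (SIGMA k:{1..}. {h. odd h \<and> \<bar>h\<bar> < 2*k}) (\<lambda>x. sg (fst x) * (fst x)^r) (\<lambda>x. (fst x)^2)"
    by (rule qseries_bij[OF b0, symmetric]) auto
  also have "\<dots> = qseries {1..} (\<lambda>k. \<Sum>h\<in>{h. odd h \<and> \<bar>h\<bar> < 2*k}. sg k * k^r) (\<lambda>k. k^2)"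
    using qseries_fst[OF ok0, of "\<lambda>k. {h. odd h \<and> \<bar>h\<bar> < 2*k}" "\<lambda>x. sg (fst x) * (fst x)^r"] fin by simp
  also have "\<dots> = qseries {1..} (\<lambda>k. 2 * (sg k * k^(r+1))) (\<lambda>k. k^2)"
    by (rule qseries_cong) (auto simp: card_odd_interval)
  finally have s0: "qseries (?B {0}) ?d ?f = 2 * qseries {1..} (\<lambda>k. sg k * k^(r+1)) (\<lambda>k. k^2)"
    by (simp add: qseries_numeral_mult)
  have "theta4 (r+1) = qseries ({..-1} \<union> ({0} \<union> {1..})) (\<lambda>k. sg k * k^(r+1)) (\<lambda>k. k^2)"
    unfolding theta4_def by (rule qseries_cong) auto
  also have "\<dots> = qseries {..-1} (\<lambda>k. sg k * k^(r+1)) (\<lambda>k. k^2) + (qseries {0} (\<lambda>k. sg k * k^(r+1)) (\<lambda>k. k^2)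
     + qseries {1..} (\<lambda>k. sg k * k^(r+1)) (\<lambda>k. k^2))"
    by (subst qseries_Un, (rule qok_subset[OF qok_square]; simp)+, force, subst qseries_Un,
        (rule qok_subset[OF qok_square]; simp)+, auto)
  also have "qseries {0} (\<lambda>k. sg k * k^(r+1)) (\<lambda>k. k^2) = 0" by (rule qseries_zero) auto
  also have "qseries {..-1} (\<lambda>k. sg k * k^(r+1)) (\<lambda>k. k^2) = qseries {1..} (\<lambda>k. sg k * k^(r+1)) (\<lambda>k. k^2)"
  proof (rule qseries_bij[where h=uminus])
    show "bij_betw uminus {..- 1::int} {1..}" by (rule bij_betw_byWitness[where f'=uminus]) auto
  qed (use r in auto)
  finally have phi: "theta4 (r+1) = qseries (?B {0}) ?d ?f" using s0 by simp
  \<comment> \<open>Together with \<open>sm\<close>, which identifies the halves x > 0 and x < 0,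
    this makes each half minus one half of the row x = 0. That row has 2k values of
    \<open>h\<close>, whence the exponent \<open>r + 1\<close>.\<close>
  have zero: "qseries (?B UNIV) ?d ?f = 0"
    by (rule qseries_invol[where h="\<lambda>(k,h,x). (k,h,-h-x)"])
       (auto simp: sg_add sg_diff sg_odd power2_eq_square algebra_simps)
  have "?B UNIV = ?B {..-1} \<union> (?B {0} \<union> ?B {1..})" by auto
  then have "0 = qseries (?B {..-1} \<union> (?B {0} \<union> ?B {1..})) ?d ?f" using zero by simp
  also have "\<dots> = qseries (?B {..-1}) ?d ?f + (qseries (?B {0}) ?d ?f + qseries (?B {1..}) ?d ?f)"
    by (subst qseries_Un, rule okBm, rule qok_Un[OF okB0 okBp], force, subst qseries_Un, rule okB0, rule okBp, auto)
  also have "\<dots> = theta4 (r+1) + 2 * qseries (?B {1..}) ?d ?f"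
    unfolding sm phi by (simp only: mult_2 ac_simps)
  finally have phi2: "theta4 (r+1) = - (2 * qseries (?B {1..}) ?d ?f)" by (simp only: eq_neg_iff_add_eq_0)
  have "?P1 = ?B {1..} \<union> ?P2"
  proof (intro set_eqI iffI; clarsimp)
    fix k h :: int assume "odd h" "1 - 2*k \<le> h" "\<not> 1 + 2*k \<le> h"
    moreover have "h \<noteq> 2*k" using \<open>odd h\<close> by auto
    ultimately show "\<bar>h\<bar> < 2*k" by auto
  qed auto
  then have "qseries ?P1 ?d ?f = qseries (?B {1..} \<union> ?P2) ?d ?f" by simp
  also have "\<dots> = qseries (?B {1..}) ?d ?f + qseries ?P2 ?d ?f"
    by (rule qseries_Un[OF okBp okP2]) auto
  finally have s12: "qseries ?T1 ?c ?e + qseries ?T2 ?c ?e = qseries (?B {1..}) ?d ?f"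
    unfolding s1 s2 qseries_uminus[symmetric] by simp
  have "?T = ?T1 \<union> (?T2 \<union> ?T3)" by auto
  then have "qseries ?T ?c ?e = qseries (?T1 \<union> (?T2 \<union> ?T3)) ?c ?e" by simp
  also have "\<dots> = qseries ?T1 ?c ?e + (qseries ?T2 ?c ?e + qseries ?T3 ?c ?e)"
    by (subst qseries_Un, rule ok1, rule qok_Un[OF ok1(2,3)], force, subst qseries_Un, rule ok1, rule ok1, auto)
  also have "qseries ?T3 ?c ?e = 0" by (rule qseries_zero) (use r in \<open>auto simp: odd_pos zero_power\<close>)
  finally show ?thesis unfolding phi2 s12[symmetric] by simp
qed


section \<open>Logarithmic derivatives of theta\<close>

lemma theta4_times_lam_odd:
  "theta4 i * lam_odd r = qseries (UNIV \<times> podd) (\<lambda>(j,a,k). sg j * j^i * a^r) (\<lambda>(j,a,k). j^2 + a * k)"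
  unfolding theta4_def lam_odd_def
  by (subst qseries_mult[OF qok_square qok_prod_odd]) (simp add: case_prod_unfold)

text \<open>Case \<open>r = 1\<close> of \<open>theta4_lam_odd\<close> after binomial expansion, the
  odd theta moments being 0. Since \<open>theta4 2 = qD (theta4 0)\<close>, the logarithmic
  derivative of theta is \<open>- 2 * lam_odd 1\<close>.\<close>

lemma theta4_2: "theta4 2 = - 2 * (theta4 0 * lam_odd 1)"
proof -
  have "qseries (UNIV \<times> podd) (\<lambda>(j,a,i). sg j * (j + a)^1) (\<lambda>(j,a,i). j^2 + a * i)
      = theta4 1 * lam_odd 0 + theta4 0 * lam_odd 1"
    unfolding theta4_times_lam_odd qseries_add
    by (rule qseries_cong) (auto simp: algebra_simps)
  then show ?thesis using theta4_lam_odd[of 1] by (simp add: theta4_odd numeral_2_eq_2)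
qed

lemma theta4_4: "theta4 4 = - 2 * (3 * (theta4 2 * lam_odd 1) + theta4 0 * lam_odd 3)"
proof -
  have "qseries (UNIV \<times> podd) (\<lambda>(j,a,i). sg j * (j + a)^3) (\<lambda>(j,a,i). j^2 + a * i)
      = theta4 3 * lam_odd 0 + 3 * (theta4 2 * lam_odd 1) + 3 * (theta4 1 * lam_odd 2) + theta4 0 * lam_odd 3"
    unfolding theta4_times_lam_odd qseries_add qseries_numeral_mult
    by (rule qseries_cong) (auto simp: algebra_simps eval_nat_numeral)
  then show ?thesis using theta4_lam_odd[of 3] by (simp add: theta4_odd)
qed

lemma theta4_6: "theta4 6 = - 2 * (5 * (theta4 4 * lam_odd 1) + 10 * (theta4 2 * lam_odd 3) + theta4 0 * lam_odd 5)"
proof -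
  have "qseries (UNIV \<times> podd) (\<lambda>(j,a,i). sg j * (j + a)^5) (\<lambda>(j,a,i). j^2 + a * i)
      = theta4 5 * lam_odd 0 + 5 * (theta4 4 * lam_odd 1) + 10 * (theta4 3 * lam_odd 2)
        + 10 * (theta4 2 * lam_odd 3) + 5 * (theta4 1 * lam_odd 4) + theta4 0 * lam_odd 5"
    unfolding theta4_times_lam_odd qseries_add qseries_numeral_mult
    by (rule qseries_cong) (auto simp: algebra_simps eval_nat_numeral)
  then show ?thesis using theta4_lam_odd[of 5] by (simp add: theta4_odd)
qed

lemma theta4_0_nth_0: "fps_nth (theta4 0) 0 = 1"
proof -
  have "{j :: int. j^2 = 0} = {0}" by auto
  then show ?thesis by (simp add: theta4_def qseries_nth)
qed

lemma theta4_0_nonzero: "theta4 0 \<noteq> 0"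
  using theta4_0_nth_0 by auto

text \<open>Obtained by differentiating \<open>theta4_2\<close> again and again: every even moment
  is \<open>theta4 0\<close> times a differential polynomial in \<open>lam_odd 1\<close>.\<close>

lemma theta4_4_closed: "theta4 4 = theta4 0 * (4 * (lam_odd 1)^2 - 2 * qD (lam_odd 1))"
  and theta4_6_closed: "theta4 6 = theta4 0 * (12 * (lam_odd 1 * qD (lam_odd 1)) - 8 * (lam_odd 1)^3 - 2 * qD (qD (lam_odd 1)))"
proof -
  define a f where "a = lam_odd 1" and "f = theta4 0"
  have f2: "theta4 2 = - 2 * (f * a)" using theta4_2 by (simp add: a_def f_def)
  have qf: "qD f = - 2 * (f * a)" using f2 qD_theta4_0 by (simp add: f_def)
  have "theta4 4 = - 2 * (qD f * a + f * qD a)"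
    using arg_cong[OF f2, of qD] by (simp add: qD_theta4_2 qD_mult qD_uminus)
  also have "\<dots> = f * (4 * a^2 - 2 * qD a)"
    unfolding qf by (simp add: algebra_simps power2_eq_square)
  finally have f4: "theta4 4 = f * (4 * a^2 - 2 * qD a)" .
  then show "theta4 4 = theta4 0 * (4 * (lam_odd 1)^2 - 2 * qD (lam_odd 1))" by (simp add: a_def f_def)
  have "theta4 6 = qD f * (4 * a^2 - 2 * qD a) + f * (8 * (a * qD a) - 2 * qD (qD a))"
    using arg_cong[OF f4, of qD] by (simp add: qD_theta4_4 qD_mult qD_diff power2_eq_square)
  also have "\<dots> = f * (12 * (a * qD a) - 8 * a^3 - 2 * qD (qD a))"
    unfolding qf by (simp add: algebra_simps power2_eq_square power3_eq_cube)
  finally show "theta4 6 = theta4 0 * (12 * (lam_odd 1 * qD (lam_odd 1)) - 8 * (lam_odd 1)^3 - 2 * qD (qD (lam_odd 1)))"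
    by (simp add: a_def f_def)
qed

text \<open>The fourth theta moment is now known twice, by differentiation and by the lattice sum
  \<open>theta4_4\<close>; comparing the two isolates \<open>lam_odd 3\<close>. The sixth moment
  yields \<open>lam_odd 5\<close> in the same way.\<close>

lemma lam_odd_3: "lam_odd 3 = qD (lam_odd 1) + 4 * (lam_odd 1)^2"
proof -
  define a f where "a = lam_odd 1" and "f = theta4 0"
  have f2: "theta4 2 = - 2 * (f * a)" using theta4_2 by (simp add: a_def f_def)
  have "2 * (f * lam_odd 3) = - theta4 4 - 6 * (theta4 2 * a)"
    unfolding theta4_4 by (simp add: a_def f_def algebra_simps)
  also have "\<dots> = 2 * (f * (qD a + 4 * a^2))"
    unfolding theta4_4_closed[folded f_def a_def] f2 by (simp add: algebra_simps power2_eq_square)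
  finally have "f * lam_odd 3 = f * (qD a + 4 * a^2)" by (rule int_fps_numeral_cancel)
  then show ?thesis using theta4_0_nonzero by (simp add: a_def f_def)
qed

lemma lam_odd_5: "lam_odd 5 = qD (qD (lam_odd 1)) + 24 * (lam_odd 1 * qD (lam_odd 1)) + 64 * (lam_odd 1)^3"
proof -
  define a f where "a = lam_odd 1" and "f = theta4 0"
  have f2: "theta4 2 = - 2 * (f * a)" using theta4_2 by (simp add: a_def f_def)
  have "2 * (f * lam_odd 5) = - theta4 6 - 10 * (theta4 4 * a) - 20 * (theta4 2 * lam_odd 3)"
    unfolding theta4_6 by (simp add: a_def f_def algebra_simps)
  also have "\<dots> = 2 * (f * (qD (qD a) + 24 * (a * qD a) + 64 * a^3))"
    unfolding theta4_4_closed[folded f_def a_def] theta4_6_closed[folded f_def a_def] f2 lam_odd_3 a_def[symmetric]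
    by (simp add: algebra_simps power2_eq_square power3_eq_cube)
  finally have "f * lam_odd 5 = f * (qD (qD a) + 24 * (a * qD a) + 64 * a^3)" by (rule int_fps_numeral_cancel)
  then show ?thesis using theta4_0_nonzero by (simp add: f_def a_def)
qed

section \<open>Lambert series and the cube of the eta function\<close>

text \<open>With this shift the symmetry is \<open>n \<mapsto> 1 - n\<close> and
  \<open>8 * tri n + 1 = (2n - 1)^2\<close>, which is why the odd numbers \<open>2n - 1\<close>
  serve as weights below.\<close>

definition tri :: "int \<Rightarrow> int" where "tri n = n * (n - 1) div 2"

lemma two_tri: "2 * tri n = n * (n - 1)"
  unfolding tri_def by simp

lemma tri_nonneg: "0 \<le> tri n"
proof -
  have "0 \<le> n * (n - 1)" by (cases "n \<le> 0") (auto simp: mult_nonneg_nonneg mult_nonpos_nonpos)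
  then show ?thesis by (simp add: tri_def)
qed

lemma tri_reflect: "tri (1 - n) = tri n"
  using two_tri[of n] two_tri[of "1 - n"] by (simp add: algebra_simps)

lemma tri_diff: "tri (n - x) = tri n + tri (x + 1) - x * n"
  using two_tri[of n] two_tri[of "n - x"] two_tri[of "x + 1"] by (simp add: algebra_simps)

lemma tri_add: "tri (n + x) = tri n + tri (x + 1) + x * (n - 1)"
  using two_tri[of n] two_tri[of "n + x"] two_tri[of "x + 1"] by (simp add: algebra_simps)

lemma qok_tri: "qok UNIV tri"
proof (rule qokI)
  fix N
  have "{n \<in> UNIV. tri n \<le> N} \<subseteq> {- (2*N+1)..2*N+1}"
  proof (intro subsetI)
    fix n assume "n \<in> {n \<in> UNIV. tri n \<le> N}"
    then have "n * (n - 1) \<le> 2 * N" using two_tri[of n] by simp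
    moreover have "n \<le> n * (n - 1) \<or> n \<le> 1"
      using mult_left_mono[of 1 "n - 1" n] by auto
    moreover have "- n \<le> n * (n - 1) \<or> 0 \<le> n"
      using mult_left_mono[of 1 "1 - n" "- n"] by (auto simp: algebra_simps)
    moreover have "0 \<le> N" using \<open>n * (n - 1) \<le> 2 * N\<close> two_tri[of n] tri_nonneg[of n] by linarith
    ultimately have "n \<le> 2 * N + 1" "- (2 * N + 1) \<le> n" by linarith+
    then show "n \<in> {- (2*N+1)..2*N+1}" by simp
  qed
  then show "\<exists>B. finite B \<and> {n \<in> UNIV. tri n \<le> N} \<subseteq> B" by blast
qed (simp add: tri_nonneg)

text \<open>Same device as for \<open>theta4_lam_odd\<close>, now with triangular exponents \<open>tri n + tri (x + 1) + x h\<close>.\<close>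

lemma theta_lambert:
  fixes p :: "int \<Rightarrow> int"
  assumes p: "\<And>n. p (1 - n) = p n"
  shows "qseries (UNIV \<times> pos2) (\<lambda>(j,a,i). sg j * p (j + a)) (\<lambda>(j,a,i). tri j + a * i)
    = qseries {1..} (\<lambda>n. sg n * ((\<Sum>l\<in>{1..n-1}. p l) - (n - 1) * p n)) tri"
proof -
  let ?T = "UNIV \<times> pos2 :: (int \<times> int \<times> int) set"
  let ?c = "\<lambda>(j,a,i). sg j * p (j + a)" and ?e = "\<lambda>(j,a,i::int). tri j + a * i"
  let ?T1 = "{(j,a,i). (a,i) \<in> pos2 \<and> 1 \<le> j + a}" and ?T2 = "{(j,a,i). (a,i) \<in> pos2 \<and> j + a \<le> 0}"
  let ?d = "\<lambda>(n,h::int,x). sg (n+x) * p n" and ?f = "\<lambda>(n,h,x). tri n + tri (x+1) + x * h"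
  let ?P1 = "{(n,h,x). 1 \<le> n \<and> 1 \<le> x \<and> 1 - n \<le> h} :: (int \<times> int \<times> int) set"
  let ?P2 = "{(n,h,x). 1 \<le> n \<and> 1 \<le> x \<and> n \<le> h} :: (int \<times> int \<times> int) set"
  \<comment> \<open>The symmetry of \<open>h\<close> is now \<open>h \<mapsto> -1 - h\<close>, so
    the strip stops at \<open>n - 2\<close> and the line \<open>h = n - 1\<close> is left over as
    \<open>L\<close>. With \<open>l = n + x\<close> its exponent is \<open>tri l\<close>, and it
    produces the partial sums of \<open>p\<close>.\<close>
  let ?B = "\<lambda>X. {(n,h,x). 1 \<le> n \<and> 1 - n \<le> h \<and> h \<le> n - 2 \<and> x \<in> X} :: (int \<times> int \<times> int) set"
  let ?L = "{(n,h,x). 1 \<le> n \<and> h = n - 1 \<and> 1 \<le> x} :: (int \<times> int \<times> int) set"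
  have okT: "qok ?T ?e"
    using qok_times[OF qok_tri qok_prod] by (simp add: case_prod_unfold)
  have ok1: "qok ?T1 ?e" "qok ?T2 ?e" by (rule qok_subset[OF okT]; auto)+
  have b1: "bij_betw (\<lambda>(j,a,i). (j+a, i - (j+a), a)) ?T1 ?P1"
    by (rule bij_betw_byWitness[where f'="\<lambda>(n,h,x). (n-x,x,h+n)"]) (auto simp: pos2_def)
  have b2: "bij_betw (\<lambda>(j,a,i). (1-(j+a), i - (j+a), a)) ?T2 ?P2"
    by (rule bij_betw_byWitness[where f'="\<lambda>(n,h,x). (1-n-x,x,h-n+1)"]) (auto simp: pos2_def)
  have f1: "?f ((\<lambda>(j,a,i). (j+a, i - (j+a), a)) y) = ?e y" for y
    using tri_diff[of "fst y + fst (snd y)" "fst (snd y)"]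
    by (simp add: case_prod_unfold algebra_simps)
  have f2: "?f ((\<lambda>(j,a,i). (1-(j+a), i - (j+a), a)) y) = ?e y" for y
    using tri_add[of "1 - (fst y + fst (snd y))" "fst (snd y)"] tri_reflect[of "fst y"]
    by (simp add: case_prod_unfold algebra_simps)
  have s1: "qseries ?T1 ?c ?e = qseries ?P1 ?d ?f"
  proof (rule qseries_bij[OF b1])
    show "?f ((\<lambda>(j,a,i). (j+a, i - (j+a), a)) y) = ?e y" for y by (rule f1)
  qed (auto simp: sg_add)
  have s2: "qseries ?T2 ?c ?e = qseries ?P2 (\<lambda>x. - ?d x) ?f"
  proof (rule qseries_bij[OF b2])
    show "?f ((\<lambda>(j,a,i). (1-(j+a), i - (j+a), a)) y) = ?e y" for y by (rule f2)
    fix y :: "int \<times> int \<times> int"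
    have "sg (1 - j) = - sg j" for j by (simp add: sg_def)
    then show "- ?d ((\<lambda>(j,a,i). (1-(j+a), i - (j+a), a)) y) = ?c y"
      using p[of "fst y + fst (snd y)"] by (simp add: case_prod_unfold algebra_simps)
  qed
  have okP1: "qok ?P1 ?f" by (rule qok_bij[OF b1 f1 ok1(1)])
  have okP2: "qok ?P2 ?f" by (rule qok_bij[OF b2 f2 ok1(2)])
  have okBp: "qok (?B {1..}) ?f" by (rule qok_subset[OF okP1]) auto
  have okL: "qok ?L ?f" by (rule qok_subset[OF okP1]) auto
  have refl: "?f ((\<lambda>(n,h,x). (n,-1-h,-x)) y) = ?f y" for y
    using tri_reflect[of "snd (snd y)"] tri_add[of "snd (snd y)" 1] two_tri[of 2]
    by (simp add: case_prod_unfold algebra_simps)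
  have bm: "bij_betw (\<lambda>(n,h,x). (n,-1-h,-x)) (?B {1..}) (?B {..-1})"
    by (rule bij_betw_byWitness[where f'="\<lambda>(n,h,x). (n,-1-h,-x)"]) auto
  have okBm: "qok (?B {..-1}) ?f" by (rule qok_bij[OF bm refl okBp])
  have sm: "qseries (?B {..-1}) ?d ?f = qseries (?B {1..}) ?d ?f"
  proof (rule qseries_bij[OF bm, symmetric])
    show "?f ((\<lambda>(n,h,x). (n,-1-h,-x)) y) = ?f y" for y by (rule refl)
  qed (auto simp: sg_add sg_diff)
  have b0: "bij_betw (\<lambda>(n,h). (n,h,0)) (SIGMA n:{1..}. {1-n..n-2}) (?B {0})"
    by (rule bij_betw_byWitness[where f'="\<lambda>(n,h,x). (n,h)"]) auto
  have ok0: "qok {1::int..} tri" by (rule qok_subset[OF qok_tri]) auto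
  have tri1: "tri 1 = 0" by (simp add: tri_def)
  have "qok (SIGMA n:{1::int..}. {1-n..n-2}) (\<lambda>x. tri (fst x))"
  proof (rule qokI)
    fix N :: int
    have "{x \<in> (SIGMA n:{1::int..}. {1-n..n-2}). tri (fst x) \<le> N} = (SIGMA n:{n\<in>{1..}. tri n \<le> N}. {1-n..n-2})" by auto
    moreover have "finite \<dots>" using ok0 by (intro finite_SigmaI) (auto simp: qok_def)
    ultimately show "\<exists>B. finite B \<and> {x \<in> (SIGMA n:{1::int..}. {1-n..n-2}). tri (fst x) \<le> N} \<subseteq> B" by blast
  qed (auto simp: tri_nonneg)
  then have okB0: "qok (?B {0}) ?f" by (rule qok_bij[OF b0, rotated]) (auto simp: tri1)
  have "qseries (?B {0}) ?d ?f = qseries (SIGMA n:{1..}. {1-n..n-2}) (\<lambda>x. sg (fst x) * p (fst x)) (\<lambda>x. tri (fst x))"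
    by (rule qseries_bij[OF b0, symmetric]) (auto simp: tri1)
  also have "\<dots> = qseries {1..} (\<lambda>n. \<Sum>h\<in>{1-n..n-2}. sg n * p n) tri"
    using qseries_fst[OF ok0, of "\<lambda>n. {1-n..n-2}" "\<lambda>x. sg (fst x) * p (fst x)"] by simp
  also have "\<dots> = qseries {1..} (\<lambda>n. 2 * ((n - 1) * (sg n * p n))) tri"
    by (rule qseries_cong) auto
  finally have s0: "qseries (?B {0}) ?d ?f = 2 * qseries {1..} (\<lambda>n. (n - 1) * (sg n * p n)) tri"
    by (simp add: qseries_numeral_mult)
  \<comment> \<open>Reflection of the quadratic x (x + 1) / 2 + x h in its axis. The number
    \<open>x\<close> and its image have odd sum, so the sign changes.\<close>
  have zero: "qseries (?B UNIV) ?d ?f = 0"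
  proof (rule qseries_invol[where h="\<lambda>(n,h,x). (n,h,-2*h-1-x)"])
    fix y :: "int \<times> int \<times> int"
    have "tri (- 2*h - 1 - x + 1) + (- 2*h - 1 - x) * h = tri (x + 1) + x * h" for h x :: int
      using two_tri[of "x+1"] two_tri[of "- 2*h - 1 - x + 1"] by (simp add: algebra_simps)
    then show "?f ((\<lambda>(n,h,x). (n,h,-2*h-1-x)) y) = ?f y"
      by (simp add: case_prod_unfold)
    have "sg (n + (- 2*h - 1 - x)) = - sg (n + x)" for n h x by (simp add: sg_def)
    then show "?d ((\<lambda>(n,h,x). (n,h,-2*h-1-x)) y) = - ?d y"
      by (simp add: case_prod_unfold)
  qed auto
  have "?B UNIV = ?B {..-1} \<union> (?B {0} \<union> ?B {1..})" by auto
  then have "0 = qseries (?B {..-1} \<union> (?B {0} \<union> ?B {1..})) ?d ?f" using zero by simp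
  also have "\<dots> = qseries (?B {..-1}) ?d ?f + (qseries (?B {0}) ?d ?f + qseries (?B {1..}) ?d ?f)"
    by (subst qseries_Un, rule okBm, rule qok_Un[OF okB0 okBp], force, subst qseries_Un, rule okB0, rule okBp, auto)
  also have "\<dots> = 2 * (qseries {1..} (\<lambda>n. (n - 1) * (sg n * p n)) tri + qseries (?B {1..}) ?d ?f)"
    using sm s0 by (simp add: algebra_simps)
  finally have "2 * (qseries (?B {1..}) ?d ?f + qseries {1..} (\<lambda>n. (n - 1) * (sg n * p n)) tri) = 2 * 0"
    by (simp only: add.commute mult_zero_right)
  then have Bp: "qseries (?B {1..}) ?d ?f = - qseries {1..} (\<lambda>n. (n - 1) * (sg n * p n)) tri"
    unfolding eq_neg_iff_add_eq_0 by (rule int_fps_numeral_cancel)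
  have bL: "bij_betw (\<lambda>(l,n). (n,n-1,l-n)) (SIGMA l:{1..}. {1..l-1}) ?L"
    by (rule bij_betw_byWitness[where f'="\<lambda>(n,h,x). (n+x,n)"]) auto
  have "qseries ?L ?d ?f = qseries (SIGMA l:{1..}. {1..l-1}) (\<lambda>x. sg (fst x) * p (snd x)) (\<lambda>x. tri (fst x))"
  proof (rule qseries_bij[OF bL, symmetric])
    fix y :: "int \<times> int"
    show "?f ((\<lambda>(l,n). (n,n-1,l-n)) y) = tri (fst y)"
      using tri_add[of "snd y" "fst y - snd y"] by (simp add: case_prod_unfold)
  qed auto
  also have "\<dots> = qseries {1..} (\<lambda>l. \<Sum>n\<in>{1..l-1}. sg l * p n) tri"
    using qseries_fst[OF ok0, of "\<lambda>l. {1..l-1}" "\<lambda>x. sg (fst x) * p (snd x)"] by simp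
  finally have L: "qseries ?L ?d ?f = qseries {1..} (\<lambda>l. \<Sum>n\<in>{1..l-1}. sg l * p n) tri" .
  have "?P1 = ?B {1..} \<union> (?L \<union> ?P2)" by auto
  then have "qseries ?P1 ?d ?f = qseries (?B {1..} \<union> (?L \<union> ?P2)) ?d ?f" by simp
  also have "\<dots> = qseries (?B {1..}) ?d ?f + (qseries ?L ?d ?f + qseries ?P2 ?d ?f)"
    by (subst qseries_Un, rule okBp, rule qok_Un[OF okL okP2], force, subst qseries_Un, rule okL, rule okP2, auto)
  finally have s12: "qseries ?T1 ?c ?e + qseries ?T2 ?c ?e = qseries ?L ?d ?f + qseries (?B {1..}) ?d ?f"
    using s1 s2 by (simp add: qseries_uminus[symmetric])
  have "?T = ?T1 \<union> ?T2" by auto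
  then have "qseries ?T ?c ?e = qseries (?T1 \<union> ?T2) ?c ?e" by simp
  also have "\<dots> = qseries ?T1 ?c ?e + qseries ?T2 ?c ?e"
    by (rule qseries_Un[OF ok1]) auto
  also have "\<dots> = qseries {1..} (\<lambda>n. (\<Sum>l\<in>{1..n-1}. sg n * p l) - (n - 1) * (sg n * p n)) tri"
    unfolding s12 L Bp by (simp add: qseries_diff)
  also have "\<dots> = qseries {1..} (\<lambda>n. sg n * ((\<Sum>l\<in>{1..n-1}. p l) - (n - 1) * p n)) tri"
    by (rule qseries_cong) (auto simp: algebra_simps sum_distrib_left)
  finally show ?thesis .
qed

text \<open>By Jacobi's identity \<open>jacobi 1\<close> is -2 times the cube of the product of all
  1 - q^n; the other values of \<open>i\<close> are its moments.\<close>

definition jacobi :: "nat \<Rightarrow> int fps" where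
  "jacobi i = qseries UNIV (\<lambda>j. sg j * (2*j-1)^i) tri"

lemma sg_one_minus: "sg (1 - j) = - sg j" by (simp add: sg_def)

lemma jacobi_even: "even i \<Longrightarrow> jacobi i = 0"
  unfolding jacobi_def
proof (rule qseries_invol[where h="\<lambda>j. 1 - j"])
  fix j :: int assume "even i"
  then have "(2*(1-j)-1)^i = (2*j-1)^i"
    using power_minus_even[of i "2*j-1"] by (simp add: algebra_simps)
  then show "sg (1-j) * (2*(1-j)-1)^i = - (sg j * (2*j-1)^i)" by (simp add: sg_one_minus)
qed (auto simp: tri_reflect)

text \<open>\<open>theta_lambert\<close> ends in a one-sided sum; for odd \<open>i\<close> this half
  determines \<open>jacobi i\<close>.\<close>

definition jacobi_pos :: "nat \<Rightarrow> int fps" where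
  "jacobi_pos i = qseries {1..} (\<lambda>j. sg j * (2*j-1)^i) tri"

lemma jacobi_half: "odd i \<Longrightarrow> jacobi i = 2 * jacobi_pos i"
proof -
  assume i: "odd i"
  have "jacobi i = qseries ({..0} \<union> {1..}) (\<lambda>j. sg j * (2*j-1)^i) tri"
    unfolding jacobi_def by (rule qseries_cong) auto
  also have "\<dots> = qseries {..0} (\<lambda>j. sg j * (2*j-1)^i) tri + jacobi_pos i"
    unfolding jacobi_pos_def by (rule qseries_Un; (rule qok_subset[OF qok_tri])?) auto
  also have "qseries {..0} (\<lambda>j. sg j * (2*j-1)^i) tri = jacobi_pos i"
    unfolding jacobi_pos_def
  proof (rule qseries_bij[where h="\<lambda>j. 1 - j"])
    show "bij_betw (\<lambda>j. 1 - j) {..0::int} {1..}" by (rule bij_betw_byWitness[where f'="\<lambda>j. 1 - j"]) auto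
    fix j :: int
    have "(2*(1-j)-1)^i = - ((2*j-1)^i)"
      using power_minus_odd[OF i, of "2*j-1"] by (simp add: algebra_simps)
    then show "sg (1-j) * (2*(1-j)-1)^i = sg j * (2*j-1)^i" by (simp add: sg_one_minus)
  qed (auto simp: tri_reflect)
  finally show ?thesis by simp
qed

lemma qD_jacobi: "8 * qD (jacobi i) = jacobi (i+2) - jacobi i"
proof -
  have "8 * tri j = (2*j-1)^2 - 1" for j
    using two_tri[of j] by (simp add: power2_eq_square algebra_simps)
  then have "8 * (tri j * x) = ((2*j-1)^2 - 1) * x" for j x by (metis mult.assoc)
  then have "8 * (tri j * (sg j * (2*j-1)^i)) = sg j * (2*j-1)^(i+2) - sg j * (2*j-1)^i" for j
    by (simp only: power_add) (simp add: algebra_simps)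
  then show ?thesis unfolding jacobi_def qD_qseries qseries_numeral_mult qseries_diff
    by (intro qseries_cong) auto
qed

lemma jacobi_times_lam:
  "jacobi i * lam r = qseries (UNIV \<times> pos2) (\<lambda>(j,a,k). sg j * (2*j-1)^i * a^r) (\<lambda>(j,a,k). tri j + a * k)"
  unfolding jacobi_def lam_def
  by (subst qseries_mult[OF qok_tri qok_prod]) (simp add: case_prod_unfold)

lemma sum_odd_powers:
  fixes m :: nat
  shows "3 * (\<Sum>l\<in>{1..int m}. (2*l-1)^2) = int m * (2*int m - 1) * (2*int m + 1)"
    "15 * (\<Sum>l\<in>{1..int m}. (2*l-1)^4) = int m * (2*int m - 1) * (2*int m + 1) * (12 * (int m)^2 - 7)"
    "21 * (\<Sum>l\<in>{1..int m}. (2*l-1)^6) = int m * (2*int m - 1) * (2*int m + 1) * (48 * (int m)^4 - 72 * (int m)^2 + 31)"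
proof -
  have [simp]: "{1..1 + int m} = insert (1 + int m) {1..int m}" for m by auto
  show "3 * (\<Sum>l\<in>{1..int m}. (2*l-1)^2) = int m * (2*int m - 1) * (2*int m + 1)"
    by (induction m) (simp_all add: algebra_simps eval_nat_numeral)
  show "15 * (\<Sum>l\<in>{1..int m}. (2*l-1)^4) = int m * (2*int m - 1) * (2*int m + 1) * (12 * (int m)^2 - 7)"
    by (induction m) (simp_all add: algebra_simps eval_nat_numeral)
  show "21 * (\<Sum>l\<in>{1..int m}. (2*l-1)^6) = int m * (2*int m - 1) * (2*int m + 1) * (48 * (int m)^4 - 72 * (int m)^2 + 31)"
    by (induction m) (simp_all add: algebra_simps eval_nat_numeral)
qed

text \<open>The upper limit \<open>n - 1\<close> is written \<open>int (nat (n-1))\<close> so that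
  the closed forms in \<open>sum_odd_powers\<close>, proved by induction on a natural number, can be
  substituted.\<close>

lemma theta_moment:
  assumes "even r"
  shows "qseries (UNIV \<times> pos2) (\<lambda>(j,a,i). sg j * (2*j - 1 + 2*a)^r) (\<lambda>(j,a,i). tri j + a * i)
    = qseries {1..} (\<lambda>n. sg n * ((\<Sum>l\<in>{1..int (nat (n-1))}. (2*l-1)^r) - (n - 1) * (2*n-1)^r)) tri"
proof -
  have "(2*(1-n)-1)^r = (2*n-1)^r" for n :: int
    using power_minus_even[OF assms, of "2*n-1"] by (simp add: algebra_simps)
  from theta_lambert[of "\<lambda>n. (2*n-1)^r", OF this]
  have "qseries (UNIV \<times> pos2) (\<lambda>(j,a,i). sg j * (2*(j+a) - 1)^r) (\<lambda>(j,a,i). tri j + a * i)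
    = qseries {1..} (\<lambda>n. sg n * ((\<Sum>l\<in>{1..n-1}. (2*l-1)^r) - (n - 1) * (2*n-1)^r)) tri" .
  moreover have "qseries {1..} (\<lambda>n. sg n * ((\<Sum>l\<in>{1..n-1}. (2*l-1)^r) - (n - 1) * (2*n-1)^r)) tri
    = qseries {1..} (\<lambda>n. sg n * ((\<Sum>l\<in>{1..int (nat (n-1))}. (2*l-1)^r) - (n - 1) * (2*n-1)^r)) tri"
    by (rule qseries_cong) auto
  ultimately show ?thesis by (simp add: algebra_simps)
qed

text \<open>Second moment; with \<open>qD_jacobi\<close> it says that \<open>jacobi 1\<close> has
  logarithmic derivative \<open>- 3 * lam 1\<close>. In 24 = 3 * 4 * 2 the 3 clears the power sum,
  the 4 is the binomial coefficient of the surviving term, the 2 restores the two-sided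
  series.\<close>

lemma jacobi_3: "24 * (jacobi 1 * lam 1) = jacobi 1 - jacobi 3"
proof -
  have "qseries (UNIV \<times> pos2) (\<lambda>(j,a,i). sg j * (2*j - 1 + 2*a)^2) (\<lambda>(j,a,i). tri j + a * i)
     = jacobi 2 * lam 0 + 4 * (jacobi 1 * lam 1) + 4 * (jacobi 0 * lam 2)"
    unfolding jacobi_times_lam qseries_add qseries_numeral_mult
    by (rule qseries_cong) (auto simp: algebra_simps eval_nat_numeral)
  then have "4 * (jacobi 1 * lam 1) = qseries {1..} (\<lambda>n. sg n * ((\<Sum>l\<in>{1..int (nat (n-1))}. (2*l-1)^2) - (n - 1) * (2*n-1)^2)) tri"
    using theta_moment[of 2] by (simp add: jacobi_even)
  then have "3 * (4 * (jacobi 1 * lam 1)) = qseries {1..} (\<lambda>n. sg n * (3 * (\<Sum>l\<in>{1..int (nat (n-1))}. (2*l-1)^2) - 3 * (n - 1) * (2*n-1)^2)) tri"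
    by (simp add: qseries_numeral_mult algebra_simps)
  also have "\<dots> = jacobi_pos 1 - jacobi_pos 3"
    unfolding sum_odd_powers jacobi_pos_def qseries_diff by (rule qseries_cong) (auto simp: algebra_simps eval_nat_numeral)
  finally have e: "3 * (4 * (jacobi 1 * lam 1)) = jacobi_pos 1 - jacobi_pos 3" .
  have "24 * (jacobi 1 * lam 1) = 2 * (3 * (4 * (jacobi 1 * lam 1)))" by simp
  also have "\<dots> = jacobi 1 - jacobi 3" unfolding e by (simp add: jacobi_half)
  finally show ?thesis .
qed

lemma jacobi_5: "120 * (jacobi 3 * lam 1) + 480 * (jacobi 1 * lam 3) = - 3 * jacobi 5 + 5 * jacobi 3 - 2 * jacobi 1"
proof -
  have "qseries (UNIV \<times> pos2) (\<lambda>(j,a,i). sg j * (2*j - 1 + 2*a)^4) (\<lambda>(j,a,i). tri j + a * i)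
     = jacobi 4 * lam 0 + 8 * (jacobi 3 * lam 1) + 24 * (jacobi 2 * lam 2) + 32 * (jacobi 1 * lam 3) + 16 * (jacobi 0 * lam 4)"
    unfolding jacobi_times_lam qseries_add qseries_numeral_mult
    by (rule qseries_cong) (auto simp: algebra_simps eval_nat_numeral)
  then have "8 * (jacobi 3 * lam 1) + 32 * (jacobi 1 * lam 3) = qseries {1..} (\<lambda>n. sg n * ((\<Sum>l\<in>{1..int (nat (n-1))}. (2*l-1)^4) - (n - 1) * (2*n-1)^4)) tri"
    using theta_moment[of 4] by (simp add: jacobi_even)
  then have "15 * (8 * (jacobi 3 * lam 1) + 32 * (jacobi 1 * lam 3)) = qseries {1..} (\<lambda>n. sg n * (15 * (\<Sum>l\<in>{1..int (nat (n-1))}. (2*l-1)^4) - 15 * (n - 1) * (2*n-1)^4)) tri"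
    by (simp add: qseries_numeral_mult algebra_simps)
  also have "\<dots> = 10 * jacobi_pos 3 - 6 * jacobi_pos 5 - 4 * jacobi_pos 1"
    unfolding sum_odd_powers jacobi_pos_def qseries_numeral_mult qseries_diff
    by (rule qseries_cong) (auto simp: algebra_simps eval_nat_numeral)
  finally have e: "15 * (8 * (jacobi 3 * lam 1) + 32 * (jacobi 1 * lam 3)) = 10 * jacobi_pos 3 - 6 * jacobi_pos 5 - 4 * jacobi_pos 1" .
  have "120 * (jacobi 3 * lam 1) + 480 * (jacobi 1 * lam 3) = 15 * (8 * (jacobi 3 * lam 1) + 32 * (jacobi 1 * lam 3))"
    by (simp add: algebra_simps)
  also have "\<dots> = - 3 * jacobi 5 + 5 * jacobi 3 - 2 * jacobi 1" unfolding e by (simp add: jacobi_half)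
  finally show ?thesis .
qed

lemma jacobi_7: "42 * (12 * (jacobi 5 * lam 1) + 160 * (jacobi 3 * lam 3) + 192 * (jacobi 1 * lam 5))
   = - 9 * jacobi 7 + 21 * jacobi 5 - 28 * jacobi 3 + 16 * jacobi 1"
proof -
  have "qseries (UNIV \<times> pos2) (\<lambda>(j,a,i). sg j * (2*j - 1 + 2*a)^6) (\<lambda>(j,a,i). tri j + a * i)
     = jacobi 6 * lam 0 + 12 * (jacobi 5 * lam 1) + 60 * (jacobi 4 * lam 2) + 160 * (jacobi 3 * lam 3) + 240 * (jacobi 2 * lam 4)
       + 192 * (jacobi 1 * lam 5) + 64 * (jacobi 0 * lam 6)"
    unfolding jacobi_times_lam qseries_add qseries_numeral_mult
    by (rule qseries_cong) (auto simp: algebra_simps eval_nat_numeral)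
  then have "12 * (jacobi 5 * lam 1) + 160 * (jacobi 3 * lam 3) + 192 * (jacobi 1 * lam 5) = qseries {1..} (\<lambda>n. sg n * ((\<Sum>l\<in>{1..int (nat (n-1))}. (2*l-1)^6) - (n - 1) * (2*n-1)^6)) tri"
    using theta_moment[of 6] by (simp add: jacobi_even)
  then have "21 * (12 * (jacobi 5 * lam 1) + 160 * (jacobi 3 * lam 3) + 192 * (jacobi 1 * lam 5)) = qseries {1..} (\<lambda>n. sg n * (21 * (\<Sum>l\<in>{1..int (nat (n-1))}. (2*l-1)^6) - 21 * (n - 1) * (2*n-1)^6)) tri"
    by (simp add: qseries_numeral_mult algebra_simps)
  also have "\<dots> = 21 * jacobi_pos 5 - 9 * jacobi_pos 7 - 28 * jacobi_pos 3 + 16 * jacobi_pos 1"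
    unfolding sum_odd_powers jacobi_pos_def qseries_numeral_mult qseries_diff qseries_add
    by (rule qseries_cong) (auto simp: algebra_simps eval_nat_numeral)
  finally have e: "21 * (12 * (jacobi 5 * lam 1) + 160 * (jacobi 3 * lam 3) + 192 * (jacobi 1 * lam 5))
    = 21 * jacobi_pos 5 - 9 * jacobi_pos 7 - 28 * jacobi_pos 3 + 16 * jacobi_pos 1" .
  have "42 * (12 * (jacobi 5 * lam 1) + 160 * (jacobi 3 * lam 3) + 192 * (jacobi 1 * lam 5))
     = 2 * (21 * (12 * (jacobi 5 * lam 1) + 160 * (jacobi 3 * lam 3) + 192 * (jacobi 1 * lam 5)))" by simp
  also have "\<dots> = - 9 * jacobi 7 + 21 * jacobi 5 - 28 * jacobi 3 + 16 * jacobi 1"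
    unfolding e by (simp add: jacobi_half)
  finally show ?thesis .
qed

lemma jacobi_1_nonzero: "jacobi 1 \<noteq> 0"
proof -
  have "tri n = 0 \<longleftrightarrow> n = 0 \<or> n = 1" for n
  proof
    assume "tri n = 0"
    with two_tri[of n] have "n * (n - 1) = 0" by simp
    then show "n = 0 \<or> n = 1" by auto
  qed (auto simp: tri_def)
  then have "{n. tri n = 0} = {0, 1}" by auto
  then have "fps_nth (jacobi 1) 0 = - 2" by (simp add: jacobi_def qseries_nth sg_def)
  then show ?thesis by auto
qed

text \<open>Ramanujan's D E_2 = (E_2^2 - E_4) / 12 and D E_4 = (E_2 E_4 - E_6) / 3, written for
  divisor sums. Iterating the logarithmic derivative turns \<open>jacobi 3\<close>,
  \<open>jacobi 5\<close>, \<open>jacobi 7\<close> into \<open>jacobi 1\<close> times differential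
  polynomials in \<open>lam 1\<close>; the fourth and sixth moments then become the two
  identities.\<close>

lemma lam_squared: "12 * (lam 1)^2 = 5 * lam 3 + lam 1 - 6 * qD (lam 1)"
  and lam_1_lam_3: "21 * lam 5 = 30 * qD (lam 3) - 10 * lam 3 + lam 1 + 240 * (lam 1 * lam 3)"
proof -
  define t A where "t = jacobi 1" and "A = lam 1"
  have "jacobi 3 = t - 24 * (t * A)" unfolding t_def A_def jacobi_3 by simp
  then have t3: "jacobi 3 = t * (1 - 24 * A)" by (simp add: algebra_simps)
  have "8 * qD t = jacobi 3 - t" using qD_jacobi[of 1] by (simp add: t_def eval_nat_numeral)
  also have "\<dots> = 8 * (- 3 * (t * A))" unfolding t3 by (simp add: algebra_simps)
  finally have qt: "qD t = - 3 * (t * A)" by (rule int_fps_numeral_cancel)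
  have "qD (jacobi 3) = qD t * (1 - 24 * A) - 24 * (t * qD A)"
    unfolding t3 by (simp add: qD_mult qD_diff)
  also have "\<dots> = t * (- 3 * A + 72 * A^2 - 24 * qD A)"
    unfolding qt by (simp add: algebra_simps power2_eq_square)
  finally have q3: "qD (jacobi 3) = t * (- 3 * A + 72 * A^2 - 24 * qD A)" .
  have "jacobi 5 = 8 * qD (jacobi 3) + jacobi 3" using qD_jacobi[of 3] by (simp add: eval_nat_numeral)
  also have "\<dots> = t * (1 - 48 * A + 576 * A^2 - 192 * qD A)"
    unfolding q3 unfolding t3 by (simp add: algebra_simps power2_eq_square)
  finally have t5: "jacobi 5 = t * (1 - 48 * A + 576 * A^2 - 192 * qD A)" .
  have "qD (jacobi 5) = qD t * (1 - 48 * A + 576 * A^2 - 192 * qD A) + t * (1152 * (A * qD A) - 48 * qD A - 192 * qD (qD A))"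
    unfolding t5 by (simp add: qD_mult qD_diff qD_add power2_eq_square)
  also have "\<dots> = t * (- 3 * A + 144 * A^2 - 1728 * A^3 + 1728 * (A * qD A) - 48 * qD A - 192 * qD (qD A))"
    unfolding qt by (simp add: algebra_simps power2_eq_square power3_eq_cube)
  finally have q5: "qD (jacobi 5) = t * (- 3 * A + 144 * A^2 - 1728 * A^3 + 1728 * (A * qD A) - 48 * qD A - 192 * qD (qD A))" .
  have "jacobi 7 = 8 * qD (jacobi 5) + jacobi 5" using qD_jacobi[of 5] by (simp add: eval_nat_numeral)
  also have "\<dots> = t * (1 - 72 * A + 1728 * A^2 - 13824 * A^3 + 13824 * (A * qD A) - 576 * qD A - 1536 * qD (qD A))"
    unfolding q5 unfolding t5 by (simp add: algebra_simps power2_eq_square power3_eq_cube)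
  finally have t7: "jacobi 7 = t * (1 - 72 * A + 1728 * A^2 - 13824 * A^3 + 13824 * (A * qD A) - 576 * qD A - 1536 * qD (qD A))" .
  have t0: "t \<noteq> 0" using jacobi_1_nonzero by (simp add: t_def)
  have "480 * (t * lam 3) = - 3 * jacobi 5 + 5 * jacobi 3 - 2 * t - 120 * (jacobi 3 * A)"
    using jacobi_5 by (simp add: t_def A_def eq_diff_eq add.commute)
  also have "\<dots> = t * (1152 * A^2 + 576 * qD A - 96 * A)"
    unfolding t5 t3 by (simp add: algebra_simps power2_eq_square)
  finally have "t * (480 * lam 3) = t * (1152 * A^2 + 576 * qD A - 96 * A)" by (simp add: mult.left_commute)
  then have "480 * lam 3 = 1152 * A^2 + 576 * qD A - 96 * A" using t0 by (simp only: mult_cancel_left simp_thms)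
  then have "96 * (5 * lam 3) = 96 * (12 * A^2 + 6 * qD A - A)" by (simp add: algebra_simps)
  then have "5 * lam 3 = 12 * A^2 + 6 * qD A - A" by (rule int_fps_numeral_cancel)
  then have b: "12 * A^2 = 5 * lam 3 + A - 6 * qD A" by simp
  then show "12 * (lam 1)^2 = 5 * lam 3 + lam 1 - 6 * qD (lam 1)" by (simp add: A_def)
  have qb: "24 * (A * qD A) = 5 * qD (lam 3) + qD A - 6 * qD (qD A)"
    using arg_cong[OF b, of qD] by (simp add: qD_mult qD_diff qD_add power2_eq_square)
  define Z where "Z = 1 - 48 * A + 576 * A^2 - 192 * qD A"
  define Y where "Y = 1 - 72 * A + 1728 * A^2 - 13824 * A^3 + 13824 * (A * qD A) - 576 * qD A - 1536 * qD (qD A)"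
  have "t * (42 * (12 * (Z * A) + 160 * ((1 - 24 * A) * lam 3) + 192 * lam 5))
    = 42 * (12 * (jacobi 5 * A) + 160 * (jacobi 3 * lam 3) + 192 * (t * lam 5))"
    unfolding t5 t3 Z_def[symmetric] by (simp add: algebra_simps)
  also have "\<dots> = - 9 * jacobi 7 + 21 * jacobi 5 - 28 * jacobi 3 + 16 * t"
    using jacobi_7 by (simp add: t_def A_def)
  also have "\<dots> = t * (- 9 * Y + 21 * Z - 28 * (1 - 24 * A) + 16)"
    unfolding t7 t5 t3 Z_def[symmetric] Y_def[symmetric] by (simp add: algebra_simps)
  finally have e: "42 * (12 * (Z * A) + 160 * ((1 - 24 * A) * lam 3) + 192 * lam 5)
     = - 9 * Y + 21 * Z - 28 * (1 - 24 * A) + 16" using t0 by (simp only: mult_cancel_left simp_thms)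
  have b2: "12 * A^3 = 5 * (A * lam 3) + A^2 - 6 * (A * qD A)"
    using arg_cong[OF b, of "\<lambda>x. A * x"] by (simp add: algebra_simps power2_eq_square power3_eq_cube)
  have "8064 * lam 5 = 42 * (12 * (Z * A) + 160 * ((1 - 24 * A) * lam 3) + 192 * lam 5)
      - 42 * (12 * (Z * A) + 160 * ((1 - 24 * A) * lam 3))"
    by (simp add: algebra_simps)
  also have "\<dots> = - 9 * Y + 21 * Z - 28 * (1 - 24 * A) + 16 - 42 * (12 * (Z * A) + 160 * ((1 - 24 * A) * lam 3))"
    by (simp only: e)
  \<comment> \<open>The added bracket consists of three differences that vanish by \<open>b2\<close>
    (which is \<open>A\<close> times \<open>b\<close>), \<open>b\<close> and \<open>qb\<close>
    (which is \<open>qD\<close> of \<open>b\<close>); they remove \<open>A^3\<close>,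
    \<open>A^2\<close> and \<open>A * qD A\<close>.\<close>
  also have "\<dots> = 384 * (30 * qD (lam 3) - 10 * lam 3 + A + 240 * (A * lam 3))
      + (- 13824 * (12 * A^3 - (5 * (A * lam 3) + A^2 - 6 * (A * qD A)))
         + 576 * (12 * A^2 - (5 * lam 3 + A - 6 * qD A))
         + 2304 * (24 * (A * qD A) - (5 * qD (lam 3) + qD A - 6 * qD (qD A))))"
    unfolding Y_def Z_def by (simp add: algebra_simps power2_eq_square power3_eq_cube)
  also have "\<dots> = 384 * (30 * qD (lam 3) - 10 * lam 3 + A + 240 * (A * lam 3))"
    unfolding b b2 qb by simp
  finally have "384 * (21 * lam 5) = 384 * (30 * qD (lam 3) - 10 * lam 3 + A + 240 * (A * lam 3))" by simp
  then have "21 * lam 5 = 30 * qD (lam 3) - 10 * lam 3 + A + 240 * (A * lam 3)"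
    by (rule int_fps_numeral_cancel)
  then show "21 * lam 5 = 30 * qD (lam 3) - 10 * lam 3 + lam 1 + 240 * (lam 1 * lam 3)"
    by (simp add: A_def)
qed

section \<open>The Appell-type series\<close>

lemma pos2_le: "(a,i) \<in> pos2 \<Longrightarrow> a \<le> a * i" "(a,i) \<in> pos2 \<Longrightarrow> i \<le> a * i"
proof -
  assume "(a,i) \<in> pos2"
  then have *: "1 \<le> a" "1 \<le> i" by (simp_all add: pos2_def)
  have "a * 1 \<le> a * i" by (rule mult_left_mono) (use * in simp_all)
  then show "a \<le> a * i" by (simp only: mult_1_right)
  have "1 * i \<le> a * i" by (rule mult_right_mono) (use * in simp_all)
  then show "i \<le> a * i" by (simp only: mult_1_left)
qed

text \<open>For \<open>r = 1\<close>, after \<open>q \<mapsto> q^2\<close>, this is the second term of the generating function of the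
  smallest parts, \<open>2 \<Sum>n\<ge>1. (-1)^n q^(2n^2+2n) / (1 - q^(2n))^2\<close>.\<close>

definition appell :: "nat \<Rightarrow> int fps" where
  "appell r = qseries pos2 (\<lambda>(m,n). 2 * sg n * m^r) (\<lambda>(m,n). n^2 + m * n)"

lemma qok_appell: "qok pos2 (\<lambda>(m,n). n^2 + m * n)"
proof (rule qok_bounded[where B="\<lambda>N. {0..N} \<times> {0..N}"])
  fix N and x :: "int \<times> int" assume x: "x \<in> pos2" "(case x of (m,n) \<Rightarrow> n^2 + m * n) \<le> N"
  obtain m n where [simp]: "x = (m,n)" by (cases x)
  have *: "m \<le> m * n" "n \<le> m * n" "1 \<le> m" "1 \<le> n"
    using pos2_le[of m n] x by (auto simp: pos2_def)
  have "0 \<le> n^2" by simp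
  with x(2) have "m * n \<le> N" by (simp only: \<open>x = (m,n)\<close> prod.case)
  with * have "m \<le> N" "n \<le> N" by linarith+
  with * show "x \<in> {0..N} \<times> {0..N}" by simp
qed (auto simp: pos2_def)

definition theta4_pos :: "nat \<Rightarrow> int fps" where
  "theta4_pos i = qseries {1..} (\<lambda>j. sg j * j^i) (\<lambda>j. j^2)"

lemma qok_theta4_pos: "qok {1::int..} (\<lambda>j. j^2)"
  by (rule qok_subset[OF qok_square]) auto

lemma theta_fold:
  assumes w: "\<And>b. w (- b) = w b"
  shows "qseries UNIV (\<lambda>j. sg j * w j) (\<lambda>j. j^2)
     = qseries {0} (\<lambda>j. sg j * w j) (\<lambda>j. j^2) + 2 * qseries {1..} (\<lambda>j. sg j * w j) (\<lambda>j. j^2)"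
proof -
  have "qseries UNIV (\<lambda>j. sg j * w j) (\<lambda>j. j^2) = qseries ({..-1} \<union> ({0} \<union> {1..})) (\<lambda>j. sg j * w j) (\<lambda>j. j^2)"
    by (rule qseries_cong) auto
  also have "\<dots> = qseries {..-1} (\<lambda>j. sg j * w j) (\<lambda>j. j^2) + (qseries {0} (\<lambda>j. sg j * w j) (\<lambda>j. j^2)
     + qseries {1..} (\<lambda>j. sg j * w j) (\<lambda>j. j^2))"
    by (subst qseries_Un, (rule qok_subset[OF qok_square]; simp)+, force, subst qseries_Un,
        (rule qok_subset[OF qok_square]; simp)+, auto)
  also have "qseries {..-1} (\<lambda>j. sg j * w j) (\<lambda>j. j^2) = qseries {1..} (\<lambda>j. sg j * w j) (\<lambda>j. j^2)"
  proof (rule qseries_bij[where h=uminus])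
    show "bij_betw uminus {..- 1::int} {1..}" by (rule bij_betw_byWitness[where f'=uminus]) auto
  qed (use w in auto)
  finally show ?thesis by simp
qed

text \<open>The shear \<open>(j,m,n) \<mapsto> (n - j, m + 2j, n)\<close> maps the exponent of theta times Appell to that of
  theta times Lambert; what is left is a boundary contribution.\<close>

lemma appell_times_theta:
  fixes w :: "int \<Rightarrow> int"
  assumes r: "odd r" and w: "\<And>b. w (- b) = w b"
  shows "qseries (UNIV \<times> pos2) (\<lambda>(j,m,n). sg (n + j) * w (m + 2*n) * (m + 2*j)^r) (\<lambda>(j,m,n). j^2 + (n^2 + m * n))
    = qseries (UNIV \<times> pos2) (\<lambda>(s,a,n). sg s * a^r * w (a + 2*s)) (\<lambda>(s,a,n). s^2 + a * n)
    + qseries {1..} (\<lambda>j. sg j * (\<Sum>a\<in>{1..2*j-1}. a^r * w (2*j-a))) (\<lambda>j. j^2)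
    - qseries UNIV (\<lambda>b. sg b * w (2*b)) (\<lambda>b. b^2) * qseries pos2 (\<lambda>(a,h). sg a * (2*a)^r) (\<lambda>(a,h). a^2 + 2 * (a * h))
    - qseries {1..} (\<lambda>b. sg b * w (2*b)) (\<lambda>b. b^2) * (2^r * theta4_pos r)"
  (is "?X = ?U1 + ?U2 - ?Th * ?V - ?Tp * _")
proof -
  let ?I = "UNIV \<times> pos2 :: (int \<times> int \<times> int) set"
  let ?c = "\<lambda>(j,m,n). sg (n + j) * w (m + 2*n) * (m + 2*j)^r" and ?e = "\<lambda>(j,m,n). j^2 + (n^2 + m * n) :: int"
  let ?I1 = "{(j,m,n). (m,n) \<in> pos2 \<and> 1 \<le> m + 2*j}" and ?I2 = "{(j,m,n). (m,n) \<in> pos2 \<and> m + 2*j \<le> -1}"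
    and ?I3 = "{(j,m,n). (m,n) \<in> pos2 \<and> m + 2*j = 0}"
  let ?d = "\<lambda>(s,a,n::int). sg s * a^r * w (a + 2*s)" and ?f = "\<lambda>(s,a,n). s^2 + a * n :: int"
  let ?L1 = "{(s,a,n). 1 \<le> a \<and> 1 \<le> n \<and> 2*n < a + 2*s} :: (int \<times> int \<times> int) set"
  let ?L2 = "{(s,a,n). 1 \<le> a \<and> n \<le> -1 \<and> a + 2*s < 2*n} :: (int \<times> int \<times> int) set"
  let ?U2s = "{(s,a,n). 1 \<le> a \<and> n = 0 \<and> a + 2*s < 0} :: (int \<times> int \<times> int) set"
  \<comment> \<open>\<open>T\<close> balances the regions: \<open>L1\<close> and \<open>T\<close>
    together are \<open>I\<close>, \<open>U2s\<close> and \<open>L2\<close> together, all unions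
    disjoint. Hence \<open>L1\<close> minus \<open>L2\<close>, the wanted sum, is \<open>I\<close>
    plus \<open>U2s\<close> minus \<open>T\<close>.\<close>
  let ?T = "{(s,a,n). 1 \<le> a \<and> (if 0 < a + 2*s then a + 2*s \<le> 2*n else a + 2*s < 2*n)} :: (int \<times> int \<times> int) set"
  have okI: "qok ?I ?e"
    using qok_times[OF qok_square qok_appell] by (simp add: case_prod_unfold)
  have okJ: "qok ?I ?f"
    using qok_times[OF qok_square qok_prod] by (simp add: case_prod_unfold)
  have ok123: "qok ?I1 ?e" "qok ?I2 ?e" "qok ?I3 ?e" by (rule qok_subset[OF okI]; auto)+
  let ?h1 = "\<lambda>(j,m,n). (n - j, m + 2*j, n) :: int \<times> int \<times> int"
  let ?h2 = "\<lambda>(j,m,n). (j - n, - m - 2*j, - n) :: int \<times> int \<times> int"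
  have b1: "bij_betw ?h1 ?I1 ?L1"
    by (rule bij_betw_byWitness[where f'="\<lambda>(s,a,n). (n - s, a - 2*n + 2*s, n)"]) (auto simp: pos2_def)
  have b2: "bij_betw ?h2 ?I2 ?L2"
    by (rule bij_betw_byWitness[where f'="\<lambda>(s,a,n). (s - n, - a - 2*s + 2*n, - n)"]) (auto simp: pos2_def)
  have f1: "?f (?h1 y) = ?e y" for y
    by (simp add: case_prod_unfold power2_eq_square algebra_simps)
  have f2: "?f (?h2 y) = ?e y" for y
    by (simp add: case_prod_unfold power2_eq_square algebra_simps)
  have okL1: "qok ?L1 ?f" by (rule qok_bij[OF b1 f1 ok123(1)])
  have okL2: "qok ?L2 ?f" by (rule qok_bij[OF b2 f2 ok123(2)])
  have s1: "qseries ?I1 ?c ?e = qseries ?L1 ?d ?f"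
  proof (rule qseries_bij[OF b1])
    show "?f (?h1 y) = ?e y" for y by (rule f1)
    show "?d (?h1 y) = ?c y" for y by (simp add: case_prod_unfold sg_add sg_diff ac_simps)
  qed
  have s2: "qseries ?I2 ?c ?e = qseries ?L2 (\<lambda>x. - ?d x) ?f"
  proof (rule qseries_bij[OF b2])
    show "?f (?h2 y) = ?e y" for y by (rule f2)
    fix y :: "int \<times> int \<times> int"
    obtain j m n where y: "y = (j,m,n)" by (metis prod_cases3)
    have e1: "(- m - 2*j)^r = - ((m + 2*j)^r)"
      using power_minus_odd[OF r, of "m + 2*j"] by simp
    have e2: "w (- m - 2*j + 2*(j-n)) = w (m + 2*n)"
      using w[of "m + 2*n"] by simp
    have e3: "sg (j - n) = sg (n + j)" by (simp add: sg_add sg_diff)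
    show "- ?d (?h2 y) = ?c y"
      unfolding y prod.case e1 e2 e3 by simp
  qed
  have "?I = ?I1 \<union> (?I2 \<union> ?I3)" by auto
  then have "?X = qseries (?I1 \<union> (?I2 \<union> ?I3)) ?c ?e" by simp
  also have "\<dots> = qseries ?I1 ?c ?e + (qseries ?I2 ?c ?e + qseries ?I3 ?c ?e)"
    by (subst qseries_Un, rule ok123, rule qok_Un[OF ok123(2,3)], force, subst qseries_Un, rule ok123, rule ok123, auto)
  also have "qseries ?I3 ?c ?e = 0" by (rule qseries_zero) (use r in \<open>auto simp: odd_pos zero_power\<close>)
  finally have X: "?X = qseries ?L1 ?d ?f - qseries ?L2 ?d ?f"
    unfolding s1 s2 qseries_uminus[symmetric] by simp
  have bU: "bij_betw (\<lambda>(j,a). (-j,a,0)) (SIGMA j:{1..}. {1..2*j-1}) ?U2s"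
    by (rule bij_betw_byWitness[where f'="\<lambda>(s,a,n). (-s,a)"]) auto
  have "qok (SIGMA j:{1::int..}. {1..2*j-1}) (\<lambda>x. (fst x)^2)"
  proof (rule qok_bounded[where B="\<lambda>N. (SIGMA j:{j\<in>{1..}. j^2 \<le> N}. {1..2*j-1})"])
    show "finite (SIGMA j:{j\<in>{1::int..}. j^2 \<le> N}. {1..2*j-1})" for N
      using qok_theta4_pos by (intro finite_SigmaI) (auto simp: qok_def)
  qed auto
  then have okU2: "qok ?U2s ?f" by (rule qok_bij[OF bU, rotated]) auto
  have "qseries ?U2s ?d ?f = qseries (SIGMA j:{1..}. {1..2*j-1}) (\<lambda>x. sg (fst x) * (snd x)^r * w (2 * fst x - snd x)) (\<lambda>x. (fst x)^2)"
  proof (rule qseries_bij[OF bU, symmetric])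
    fix x :: "int \<times> int"
    show "?d ((\<lambda>(j,a). (-j,a,0)) x) = sg (fst x) * (snd x)^r * w (2 * fst x - snd x)"
      using w[of "2 * fst x - snd x"] by (simp add: case_prod_unfold)
  qed auto
  also have "\<dots> = qseries {1..} (\<lambda>j. \<Sum>a\<in>{1..2*j-1}. sg j * a^r * w (2*j-a)) (\<lambda>j. j^2)"
    using qseries_fst[OF qok_theta4_pos, of "\<lambda>j. {1..2*j-1}" "\<lambda>x. sg (fst x) * (snd x)^r * w (2 * fst x - snd x)"] by simp
  also have "\<dots> = ?U2" by (simp add: sum_distrib_left mult.assoc)
  finally have U2: "qseries ?U2s ?d ?f = ?U2" .
  have sets: "?L1 \<union> ?T = ?I \<union> (?U2s \<union> ?L2)" by (auto simp: pos2_def split: if_splits)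
  have okT: "qok ?T ?f"
    by (rule qok_subset[OF qok_Un[OF okJ qok_Un[OF okU2 okL2]]]) (use sets in blast)
  have "qseries ?L1 ?d ?f + qseries ?T ?d ?f = qseries (?L1 \<union> ?T) ?d ?f"
    by (rule qseries_Un[OF okL1 okT, symmetric]) auto
  also have "\<dots> = ?U1 + (?U2 + qseries ?L2 ?d ?f)"
    unfolding sets
    by (subst qseries_Un, rule okJ, rule qok_Un[OF okU2 okL2], force simp: pos2_def, subst qseries_Un,
        rule okU2, rule okL2, force, subst U2, simp)
  finally have XT: "?X = ?U1 + ?U2 - qseries ?T ?d ?f" unfolding X by (simp add: algebra_simps)
  let ?To = "{x \<in> ?T. odd (fst (snd x))}" and ?Te = "{x \<in> ?T. even (fst (snd x))}"
  have "qseries ?T ?d ?f = qseries (?To \<union> ?Te) ?d ?f"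
    by (rule arg_cong[where f="\<lambda>X. qseries X ?d ?f"]) auto
  also have "\<dots> = qseries ?To ?d ?f + qseries ?Te ?d ?f"
    by (rule qseries_Un; (rule qok_subset[OF okT])?) auto
  also have "qseries ?To ?d ?f = 0"
  \<comment> \<open>\<open>a + 2s\<close> changes sign and the exponent stays. For odd
    \<open>a\<close> the sign \<open>sg s\<close> flips, and parity makes the bound
    \<open>a + 2s \<le> 2n\<close> strict, so the two branches of \<open>T\<close> are
    exchanged.\<close>
  proof (rule qseries_invol[where h="\<lambda>(s,a,n). (-s-a,a,n-a-2*s)"])
    fix x assume x: "x \<in> ?To"
    obtain s a n where [simp]: "x = (s,a,n)" by (metis prod_cases3)
    from x have a: "1 \<le> a" "odd a" "if 0 < a + 2*s then a + 2*s \<le> 2*n else a + 2*s < 2*n" by auto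
    have "a + 2*s \<noteq> 0" "a + 2*s \<noteq> 2*n" using a(2) by presburger+
    then show "(\<lambda>(s,a,n). (-s-a,a,n-a-2*s)) x \<in> ?To" using a by (auto split: if_splits)
    have "w (a + 2*(-s-a)) = w (a + 2*s)" using w[of "a + 2*s"] by (simp add: algebra_simps)
    then show "?d ((\<lambda>(s,a,n). (-s-a,a,n-a-2*s)) x) = - ?d x"
      using a by (simp add: sg_diff sg_odd)
    show "?f ((\<lambda>(s,a,n). (-s-a,a,n-a-2*s)) x) = ?f x"
      by (simp add: power2_eq_square algebra_simps)
    show "(\<lambda>(s,a,n). (-s-a,a,n-a-2*s)) ((\<lambda>(s,a,n). (-s-a,a,n-a-2*s)) x) = x" by simp
  qed
  finally have TTe: "qseries ?T ?d ?f = qseries ?Te ?d ?f" by simp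
  \<comment> \<open>Writing the even value as \<open>2a\<close> and putting
    \<open>b = s + a\<close>, \<open>h = n - b\<close>, the exponent becomes b^2 + a^2 + 2 a h, so
    the variable \<open>b\<close> separates. The condition of \<open>T\<close> reads h \<ge> 0 for b
    > 0 and h \<ge> 1 otherwise: \<open>A1\<close> collects h \<ge> 1, \<open>A0\<close> the row h =
    0.\<close>
  let ?g = "\<lambda>(b,a,h). (b - a, 2*a, b + h) :: int \<times> int \<times> int"
  let ?A1 = "UNIV \<times> pos2 :: (int \<times> int \<times> int) set"
  let ?A0 = "{(b,a,h). 1 \<le> b \<and> 1 \<le> a \<and> h = 0} :: (int \<times> int \<times> int) set"
  let ?dd = "\<lambda>(b,a,h::int). (sg b * w (2*b)) * (sg a * (2*a)^r)" and ?ff = "\<lambda>(b,a,h). b^2 + (a^2 + 2 * (a * h)) :: int"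
  have bg: "bij_betw ?g (?A1 \<union> ?A0) ?Te"
    by (rule bij_betw_byWitness[where f'="\<lambda>(s,a,n). (s + a div 2, a div 2, n - (s + a div 2))"])
       (auto simp: pos2_def elim!: evenE split: if_splits)
  have "qok pos2 (\<lambda>(a,h). a^2 + 2 * (a * h))"
  proof (rule qok_bounded[where B="\<lambda>N. {0..N} \<times> {0..N}"])
    fix N and x :: "int \<times> int" assume x: "x \<in> pos2" "(case x of (a,h) \<Rightarrow> a^2 + 2 * (a * h)) \<le> N"
    obtain a h where [simp]: "x = (a,h)" by (cases x)
    have *: "a \<le> a * h" "h \<le> a * h" "1 \<le> a" "1 \<le> h"
      using pos2_le[of a h] x by (auto simp: pos2_def)
    have "0 \<le> a^2" by simp
    with x(2) have "2 * (a * h) \<le> N" by (simp only: \<open>x = (a,h)\<close> prod.case)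
    with * have "a \<le> N" "h \<le> N" by linarith+
    with * show "x \<in> {0..N} \<times> {0..N}" by simp
  qed (auto simp: pos2_def)
  note okV = this
  have okA1: "qok ?A1 ?ff"
    using qok_times[OF qok_square okV] by (simp add: case_prod_unfold)
  have okA0': "qok ({1..} \<times> {1..}) (\<lambda>(b,a). b^2 + a^2 :: int)"
    using qok_times[OF qok_theta4_pos qok_theta4_pos] .
  have bA0: "bij_betw (\<lambda>(b,a). (b,a,0)) ({1..} \<times> {1..}) ?A0"
    by (rule bij_betw_byWitness[where f'="\<lambda>(b,a,h). (b,a)"]) auto
  have okA0: "qok ?A0 ?ff" by (rule qok_bij[OF bA0 _ okA0']) auto
  have "qseries ?Te ?d ?f = qseries (?A1 \<union> ?A0) ?dd ?ff"
    by (rule qseries_bij[OF bg, symmetric])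
       (auto simp: sg_diff power2_eq_square algebra_simps)
  also have "\<dots> = qseries ?A1 ?dd ?ff + qseries ?A0 ?dd ?ff"
    by (rule qseries_Un[OF okA1 okA0]) (auto simp: pos2_def)
  also have "qseries ?A1 ?dd ?ff = ?Th * ?V"
    by (subst qseries_mult[OF qok_square okV]) (simp add: case_prod_unfold)
  also have "qseries ?A0 ?dd ?ff = qseries ({1..} \<times> {1..}) (\<lambda>(b,a). (sg b * w (2*b)) * (sg a * (2*a)^r)) (\<lambda>(b,a). b^2 + a^2)"
    by (rule qseries_bij[OF bA0, symmetric]) auto
  also have "\<dots> = ?Tp * qseries {1..} (\<lambda>a. sg a * (2*a)^r) (\<lambda>a. a^2)"
    by (subst qseries_mult[OF qok_theta4_pos qok_theta4_pos]) simp
  also have "qseries {1..} (\<lambda>a. sg a * (2*a)^r) (\<lambda>a. a^2) = 2^r * theta4_pos r"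
    unfolding theta4_pos_def using qseries_cmult[of "2^r" "{1..}" "\<lambda>j. sg j * j^r" "\<lambda>j. j^2"]
    by (simp add: power_mult_distrib mult.left_commute)
  finally have "qseries ?T ?d ?f = ?Th * ?V + ?Tp * (2^r * theta4_pos r)" unfolding TTe .
  then show ?thesis unfolding XT by (simp add: algebra_simps)
qed


text \<open>Completing the square, m^2 + 4 (n^2 + m n) = (m + 2n)^2: the weight
  \<open>w b = b^2\<close> in \<open>appell_times_theta\<close> thereby turns into a
  derivative.\<close>

lemma qD_appell: "appell (r + 2) + 4 * qD (appell r) = qseries pos2 (\<lambda>(m,n). 2 * sg n * (m + 2*n)^2 * m^r) (\<lambda>(m,n). n^2 + m * n)"
  unfolding appell_def qD_qseries qseries_numeral_mult qseries_add
  by (rule qseries_cong) (auto simp: algebra_simps power_add power2_eq_square)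

lemma theta4_times_qseries_pos2:
  "theta4 i * qseries pos2 g (\<lambda>(m,n). n^2 + m * n) = qseries (UNIV \<times> pos2) (\<lambda>(j,x). sg j * j^i * g x) (\<lambda>(j,m,n). j^2 + (n^2 + m * n))"
  unfolding theta4_def by (subst qseries_mult[OF qok_square qok_appell]) (simp add: case_prod_unfold)

text \<open>The choices \<open>w = 1\<close> and \<open>w b = b^2\<close> for \<open>r = 1\<close>.
  Expanding the power of \<open>m + 2*j\<close> leaves only even theta moments, here and for
  \<open>r = 3\<close>.\<close>

lemma appell_moment_1:
  "2 * qseries (UNIV \<times> pos2) (\<lambda>(j,m,n). sg (n + j) * 1 * (m + 2*j)^1) (\<lambda>(j,m,n). j^2 + (n^2 + m * n)) = theta4 0 * appell 1"
  "2 * qseries (UNIV \<times> pos2) (\<lambda>(j,m,n). sg (n + j) * (m + 2*n)^2 * (m + 2*j)^1) (\<lambda>(j,m,n). j^2 + (n^2 + m * n))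
     = theta4 0 * (appell 3 + 4 * qD (appell 1))"
proof -
  have "2 * qseries (UNIV \<times> pos2) (\<lambda>(j,m,n). sg (n + j) * 1 * (m + 2*j)^1) (\<lambda>(j,m,n). j^2 + (n^2 + m * n))
     = theta4 0 * appell 1 + 2 * (theta4 1 * appell 0)"
    unfolding appell_def theta4_times_qseries_pos2 qseries_numeral_mult qseries_add
    by (rule qseries_cong) (auto simp: sg_add algebra_simps)
  then show "2 * qseries (UNIV \<times> pos2) (\<lambda>(j,m,n). sg (n + j) * 1 * (m + 2*j)^1) (\<lambda>(j,m,n). j^2 + (n^2 + m * n)) = theta4 0 * appell 1"
    by (simp add: theta4_odd)
  have "2 * qseries (UNIV \<times> pos2) (\<lambda>(j,m,n). sg (n + j) * (m + 2*n)^2 * (m + 2*j)^1) (\<lambda>(j,m,n). j^2 + (n^2 + m * n))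
     = theta4 0 * (appell (1 + 2) + 4 * qD (appell 1)) + 2 * (theta4 1 * (appell (0 + 2) + 4 * qD (appell 0)))"
    unfolding qD_appell theta4_times_qseries_pos2 qseries_numeral_mult qseries_add
    by (rule qseries_cong) (auto simp: sg_add algebra_simps)
  then show "2 * qseries (UNIV \<times> pos2) (\<lambda>(j,m,n). sg (n + j) * (m + 2*n)^2 * (m + 2*j)^1) (\<lambda>(j,m,n). j^2 + (n^2 + m * n))
     = theta4 0 * (appell 3 + 4 * qD (appell 1))"
    by (simp add: theta4_odd del: add_2_eq_Suc')
qed

lemma appell_moment_3:
  "2 * qseries (UNIV \<times> pos2) (\<lambda>(j,m,n). sg (n + j) * 1 * (m + 2*j)^3) (\<lambda>(j,m,n). j^2 + (n^2 + m * n))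
     = theta4 0 * appell 3 + 12 * (theta4 2 * appell 1)"
  "2 * qseries (UNIV \<times> pos2) (\<lambda>(j,m,n). sg (n + j) * (m + 2*n)^2 * (m + 2*j)^3) (\<lambda>(j,m,n). j^2 + (n^2 + m * n))
     = theta4 0 * (appell 5 + 4 * qD (appell 3)) + 12 * (theta4 2 * (appell 3 + 4 * qD (appell 1)))"
proof -
  have "2 * qseries (UNIV \<times> pos2) (\<lambda>(j,m,n). sg (n + j) * 1 * (m + 2*j)^3) (\<lambda>(j,m,n). j^2 + (n^2 + m * n))
     = theta4 0 * appell 3 + 6 * (theta4 1 * appell 2) + 12 * (theta4 2 * appell 1) + 8 * (theta4 3 * appell 0)"
    unfolding appell_def theta4_times_qseries_pos2 qseries_numeral_mult qseries_add
    by (rule qseries_cong) (auto simp: sg_add algebra_simps power2_eq_square power3_eq_cube)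
  then show "2 * qseries (UNIV \<times> pos2) (\<lambda>(j,m,n). sg (n + j) * 1 * (m + 2*j)^3) (\<lambda>(j,m,n). j^2 + (n^2 + m * n))
     = theta4 0 * appell 3 + 12 * (theta4 2 * appell 1)"
    by (simp add: theta4_odd)
  have "2 * qseries (UNIV \<times> pos2) (\<lambda>(j,m,n). sg (n + j) * (m + 2*n)^2 * (m + 2*j)^3) (\<lambda>(j,m,n). j^2 + (n^2 + m * n))
     = theta4 0 * (appell (3 + 2) + 4 * qD (appell 3)) + 6 * (theta4 1 * (appell (2 + 2) + 4 * qD (appell 2)))
      + 12 * (theta4 2 * (appell (1 + 2) + 4 * qD (appell 1))) + 8 * (theta4 3 * (appell (0 + 2) + 4 * qD (appell 0)))"
    unfolding qD_appell theta4_times_qseries_pos2 qseries_numeral_mult qseries_add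
    by (rule qseries_cong) (auto simp: sg_add algebra_simps power2_eq_square power3_eq_cube)
  then show "2 * qseries (UNIV \<times> pos2) (\<lambda>(j,m,n). sg (n + j) * (m + 2*n)^2 * (m + 2*j)^3) (\<lambda>(j,m,n). j^2 + (n^2 + m * n))
     = theta4 0 * (appell 5 + 4 * qD (appell 3)) + 12 * (theta4 2 * (appell 3 + 4 * qD (appell 1)))"
    by (simp add: theta4_odd del: add_2_eq_Suc')
qed

lemma theta4_times_lam:
  "theta4 i * lam r = qseries (UNIV \<times> pos2) (\<lambda>(s,a,n). sg s * s^i * a^r) (\<lambda>(s,a,n). s^2 + a * n)"
  unfolding theta4_def lam_def
  by (subst qseries_mult[OF qok_square qok_prod]) (simp add: case_prod_unfold)

lemma lambert_part:
  "qseries (UNIV \<times> pos2) (\<lambda>(s,a,n). sg s * a^r * 1) (\<lambda>(s,a,n). s^2 + a * n) = theta4 0 * lam r"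
  "qseries (UNIV \<times> pos2) (\<lambda>(s,a,n). sg s * a^r * (a + 2*s)^2) (\<lambda>(s,a,n). s^2 + a * n)
    = theta4 0 * lam (r + 2) + 4 * (theta4 2 * lam r)"
proof -
  show "qseries (UNIV \<times> pos2) (\<lambda>(s,a,n). sg s * a^r * 1) (\<lambda>(s,a,n). s^2 + a * n) = theta4 0 * lam r"
    unfolding theta4_times_lam by (rule qseries_cong) auto
  have "qseries (UNIV \<times> pos2) (\<lambda>(s,a,n). sg s * a^r * (a + 2*s)^2) (\<lambda>(s,a,n). s^2 + a * n)
    = theta4 0 * lam (r + 2) + 4 * (theta4 1 * lam (r + 1)) + 4 * (theta4 2 * lam r)"
    unfolding theta4_times_lam qseries_numeral_mult qseries_add
    by (rule qseries_cong) (auto simp: algebra_simps power_add power2_eq_square)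
  then show "qseries (UNIV \<times> pos2) (\<lambda>(s,a,n). sg s * a^r * (a + 2*s)^2) (\<lambda>(s,a,n). s^2 + a * n)
    = theta4 0 * lam (r + 2) + 4 * (theta4 2 * lam r)" by (simp add: theta4_odd)
qed

lemma theta4_theta4_pos: "theta4 0 = 1 + 2 * theta4_pos 0" "0 < i \<Longrightarrow> even i \<Longrightarrow> theta4 i = 2 * theta4_pos i"
proof -
  have "qseries {0::int} (\<lambda>j. sg j * 1) (\<lambda>j. j^2) = 1"
    by (rule fps_ext) (auto simp: qseries_nth intro!: sum.neutral)
  then show "theta4 0 = 1 + 2 * theta4_pos 0"
    using theta_fold[of "\<lambda>j. 1"] by (simp add: theta4_def theta4_pos_def)
  assume i: "0 < i" "even i"
  have "qseries {0::int} (\<lambda>j. sg j * j^i) (\<lambda>j. j^2) = 0"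
    by (rule qseries_zero) (use i in auto)
  then show "theta4 i = 2 * theta4_pos i"
    using theta_fold[of "\<lambda>j. j^i"] i by (simp add: theta4_def theta4_pos_def)
qed

section \<open>Closed forms of the boundary terms\<close>

lemma sum_convolution_powers:
  fixes m :: nat
  shows "(\<Sum>a\<in>{1..int m}. a) * 2 = int m * (int m + 1)"
    "(\<Sum>a\<in>{1..int m}. a^2) * 6 = int m * (int m + 1) * (2 * int m + 1)"
    "(\<Sum>a\<in>{1..int m}. a^3) * 4 = (int m)^2 * (int m + 1)^2"
    "(\<Sum>a\<in>{1..int m}. a^4) * 30 = int m * (int m + 1) * (2 * int m + 1) * (3 * (int m)^2 + 3 * int m - 1)"
    "(\<Sum>a\<in>{1..int m}. a^5) * 12 = (int m)^2 * (int m + 1)^2 * (2 * (int m)^2 + 2 * int m - 1)"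
proof -
  have [simp]: "{1..1 + int m} = insert (1 + int m) {1..int m}" for m by auto
  show "(\<Sum>a\<in>{1..int m}. a) * 2 = int m * (int m + 1)"
    by (induction m) (simp_all add: algebra_simps eval_nat_numeral)
  show "(\<Sum>a\<in>{1..int m}. a^2) * 6 = int m * (int m + 1) * (2 * int m + 1)"
    by (induction m) (simp_all add: algebra_simps eval_nat_numeral)
  show "(\<Sum>a\<in>{1..int m}. a^3) * 4 = (int m)^2 * (int m + 1)^2"
    by (induction m) (simp_all add: algebra_simps eval_nat_numeral)
  show "(\<Sum>a\<in>{1..int m}. a^4) * 30 = int m * (int m + 1) * (2 * int m + 1) * (3 * (int m)^2 + 3 * int m - 1)"
    by (induction m) (simp_all add: algebra_simps eval_nat_numeral)
  show "(\<Sum>a\<in>{1..int m}. a^5) * 12 = (int m)^2 * (int m + 1)^2 * (2 * (int m)^2 + 2 * int m - 1)"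
    by (induction m) (simp_all add: algebra_simps eval_nat_numeral)
qed

lemma sum_upto:
  fixes j :: int
  assumes "1 \<le> j"
  shows "(\<Sum>a\<in>{1..2*j-1}. a^1 * 1) = 2*j^2 - j"
    "3 * (\<Sum>a\<in>{1..2*j-1}. a^1 * (2*j-a)^2) = 4*j^4 - j^2"
    "(\<Sum>a\<in>{1..2*j-1}. a^3 * 1) = 4*j^4 - 4*j^3 + j^2"
    "15 * (\<Sum>a\<in>{1..2*j-1}. a^3 * (2*j-a)^2) = 16*j^6 - j^2"
proof -
  have c12: "12 * X = 4 * Y \<Longrightarrow> 3 * X = Y" and c60: "60 * X = 4 * Y \<Longrightarrow> 15 * X = Y" for X Y :: int
    by linarith+
  define m where "m = nat (2*j - 1)"
  have m': "int m = 2*j - 1" using assms by (simp add: m_def)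
  define s1 s2 s3 s4 s5 where "s1 = (\<Sum>a\<in>{1..2*j-1}. a)" and "s2 = (\<Sum>a\<in>{1..2*j-1}. a^2)"
    and "s3 = (\<Sum>a\<in>{1..2*j-1}. a^3)" and "s4 = (\<Sum>a\<in>{1..2*j-1}. a^4)" and "s5 = (\<Sum>a\<in>{1..2*j-1}. a^5)"
  note S = sum_convolution_powers[of m, unfolded m', folded s1_def s2_def s3_def s4_def s5_def]
  have "s1 * 2 = (2*j^2 - j) * 2"
    unfolding S by (simp add: algebra_simps power2_eq_square)
  then show "(\<Sum>a\<in>{1..2*j-1}. a^1 * 1) = 2*j^2 - j" by (simp add: s1_def)
  have "(\<Sum>a\<in>{1..2*j-1}. a^1 * (2*j-a)^2) = (\<Sum>a\<in>{1..2*j-1}. 4*j^2 * a - 4*j * a^2 + a^3)"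
    by (rule sum.cong) (auto simp: algebra_simps power2_eq_square power3_eq_cube)
  also have "\<dots> = 4*j^2 * s1 - 4*j * s2 + s3"
    unfolding s1_def s2_def s3_def by (simp only: sum.distrib sum_subtractf sum_distrib_left)
  finally have e: "(\<Sum>a\<in>{1..2*j-1}. a^1 * (2*j-a)^2) = 4*j^2 * s1 - 4*j * s2 + s3" .
  have "12 * (4*j^2 * s1 - 4*j * s2 + s3) = 24*j^2 * (s1 * 2) - 8*j * (s2 * 6) + 3 * (s3 * 4)" by simp
  also have "\<dots> = 4 * (4*j^4 - j^2)"
    unfolding S by (simp add: algebra_simps eval_nat_numeral)
  finally have "12 * (\<Sum>a\<in>{1..2*j-1}. a^1 * (2*j-a)^2) = 4 * (4*j^4 - j^2)" unfolding e .
  then show "3 * (\<Sum>a\<in>{1..2*j-1}. a^1 * (2*j-a)^2) = 4*j^4 - j^2" by (rule c12)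
  have "s3 * 4 = (4*j^4 - 4*j^3 + j^2) * 4"
    unfolding S by (simp add: algebra_simps eval_nat_numeral)
  then show "(\<Sum>a\<in>{1..2*j-1}. a^3 * 1) = 4*j^4 - 4*j^3 + j^2" by (simp add: s3_def)
  have "(\<Sum>a\<in>{1..2*j-1}. a^3 * (2*j-a)^2) = (\<Sum>a\<in>{1..2*j-1}. 4*j^2 * a^3 - 4*j * a^4 + a^5)"
    by (rule sum.cong) (auto simp: algebra_simps eval_nat_numeral)
  also have "\<dots> = 4*j^2 * s3 - 4*j * s4 + s5"
    unfolding s3_def s4_def s5_def by (simp only: sum.distrib sum_subtractf sum_distrib_left)
  finally have e: "(\<Sum>a\<in>{1..2*j-1}. a^3 * (2*j-a)^2) = 4*j^2 * s3 - 4*j * s4 + s5" .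
  have "60 * (4*j^2 * s3 - 4*j * s4 + s5) = 60*j^2 * (s3 * 4) - 8*j * (s4 * 30) + 5 * (s5 * 12)" by simp
  also have "\<dots> = 4 * (16*j^6 - j^2)"
    unfolding S by (simp add: algebra_simps eval_nat_numeral)
  finally have "60 * (\<Sum>a\<in>{1..2*j-1}. a^3 * (2*j-a)^2) = 4 * (16*j^6 - j^2)" unfolding e .
  then show "15 * (\<Sum>a\<in>{1..2*j-1}. a^3 * (2*j-a)^2) = 16*j^6 - j^2" by (rule c60)
qed

text \<open>The weight 1 leaves odd powers of \<open>j\<close>, hence \<open>theta4_pos 1\<close>
  and \<open>theta4_pos 3\<close>, which are not halves of theta moments and have to cancel in the
  final relations. The weight \<open>b^2\<close> gives even powers only.\<close>

lemma polar_part: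
  "qseries {1..} (\<lambda>j. sg j * (\<Sum>a\<in>{1..2*j-1}. a^1 * 1)) (\<lambda>j. j^2) = 2 * theta4_pos 2 - theta4_pos 1"
  "3 * qseries {1..} (\<lambda>j. sg j * (\<Sum>a\<in>{1..2*j-1}. a^1 * (2*j-a)^2)) (\<lambda>j. j^2) = 4 * theta4_pos 4 - theta4_pos 2"
  "qseries {1..} (\<lambda>j. sg j * (\<Sum>a\<in>{1..2*j-1}. a^3 * 1)) (\<lambda>j. j^2) = 4 * theta4_pos 4 - 4 * theta4_pos 3 + theta4_pos 2"
  "15 * qseries {1..} (\<lambda>j. sg j * (\<Sum>a\<in>{1..2*j-1}. a^3 * (2*j-a)^2)) (\<lambda>j. j^2) = 16 * theta4_pos 6 - theta4_pos 2"
proof -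
  have l: "k * (sg j * x) = sg j * (k * x)" for k j x :: int by simp
  show "qseries {1..} (\<lambda>j. sg j * (\<Sum>a\<in>{1..2*j-1}. a^1 * 1)) (\<lambda>j. j^2) = 2 * theta4_pos 2 - theta4_pos 1"
    unfolding theta4_pos_def qseries_numeral_mult qseries_diff
    by (rule qseries_cong) (simp_all only: sum_upto atLeast_iff, simp_all add: algebra_simps)
  show "3 * qseries {1..} (\<lambda>j. sg j * (\<Sum>a\<in>{1..2*j-1}. a^1 * (2*j-a)^2)) (\<lambda>j. j^2) = 4 * theta4_pos 4 - theta4_pos 2"
    unfolding theta4_pos_def qseries_numeral_mult qseries_diff
    by (rule qseries_cong) (simp_all only: l sum_upto atLeast_iff, simp_all add: algebra_simps)
  show "qseries {1..} (\<lambda>j. sg j * (\<Sum>a\<in>{1..2*j-1}. a^3 * 1)) (\<lambda>j. j^2) = 4 * theta4_pos 4 - 4 * theta4_pos 3 + theta4_pos 2"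
    unfolding theta4_pos_def qseries_numeral_mult qseries_diff qseries_add
    by (rule qseries_cong) (simp_all only: sum_upto atLeast_iff, simp_all add: algebra_simps)
  show "15 * qseries {1..} (\<lambda>j. sg j * (\<Sum>a\<in>{1..2*j-1}. a^3 * (2*j-a)^2)) (\<lambda>j. j^2) = 16 * theta4_pos 6 - theta4_pos 2"
    unfolding theta4_pos_def qseries_numeral_mult qseries_diff
    by (rule qseries_cong) (simp_all only: l sum_upto atLeast_iff, simp_all add: algebra_simps)
qed

lemma theta_part:
  "qseries UNIV (\<lambda>b. sg b * 1) (\<lambda>b. b^2) = theta4 0"
  "qseries {1..} (\<lambda>b. sg b * 1) (\<lambda>b. b^2) = theta4_pos 0"
  "qseries UNIV (\<lambda>b. sg b * (2*b)^2) (\<lambda>b. b^2) = 4 * theta4 2"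
  "qseries {1..} (\<lambda>b. sg b * (2*b)^2) (\<lambda>b. b^2) = 4 * theta4_pos 2"
  unfolding theta4_def theta4_pos_def qseries_numeral_mult
  by (rule qseries_cong; simp add: power_mult_distrib)+

text \<open>\<open>theta4 0\<close> times the case \<open>w b = b^2\<close> minus
  \<open>4 * theta4 2\<close> times the case \<open>w = 1\<close> eliminates the unknown series
  \<open>V\<close>. The same combination removes \<open>lam 1\<close>, and
  \<open>theta4_pos 1\<close> cancels because
  \<open>theta4 0 = 1 + 2 * theta4_pos 0\<close>.\<close>

lemma appell_relation_1:
  "3 * (theta4 0 * (theta4 0 * (appell 3 + 4 * qD (appell 1)) - 4 * (theta4 2 * appell 1)))
    = 6 * ((theta4 0)^2 * lam 3) + theta4 0 * (4 * theta4 4 - theta4 2) - 24 * (theta4 2)^2"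
proof -
  define V where "V = qseries pos2 (\<lambda>(a,h). sg a * (2*a)^1) (\<lambda>(a,h). a^2 + 2 * (a * h))"
  define U where "U = qseries {1..} (\<lambda>j. sg j * (\<Sum>a\<in>{1..2*j-1}. a^1 * (2*j-a)^2)) (\<lambda>j. j^2)"
  have U: "3 * U = 4 * theta4_pos 4 - theta4_pos 2" unfolding U_def by (rule polar_part)
  have e1: "theta4 0 * appell 1 = 2 * (theta4 0 * lam 1 + (2 * theta4_pos 2 - theta4_pos 1) - theta4 0 * V - theta4_pos 0 * (2 * theta4_pos 1))"
    using appell_times_theta[of 1 "\<lambda>_. 1"] 
    unfolding appell_moment_1(1)[symmetric] lambert_part polar_part theta_part V_def[symmetric] by simp
  have e2: "theta4 0 * (appell 3 + 4 * qD (appell 1)) = 2 * (theta4 0 * lam 3 + 4 * (theta4 2 * lam 1) + U - 4 * theta4 2 * V - 4 * theta4_pos 2 * (2 * theta4_pos 1))"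
    using appell_times_theta[of 1 "\<lambda>b. b^2"] 
    unfolding appell_moment_1(2)[symmetric] lambert_part theta_part V_def[symmetric] U_def[symmetric]
    by (simp del: add_2_eq_Suc')
  have "3 * (theta4 0 * (theta4 0 * (appell 3 + 4 * qD (appell 1)) - 4 * (theta4 2 * appell 1)))
    = 3 * (theta4 0 * (theta4 0 * (appell 3 + 4 * qD (appell 1)))) - 12 * (theta4 2 * (theta4 0 * appell 1))"
    by (simp add: algebra_simps)
  also have "\<dots> = 6 * ((theta4 0)^2 * lam 3) + 2 * (theta4 0 * (3 * U)) - 48 * (theta4 0 * (theta4_pos 2 * theta4_pos 1))
      - 24 * (theta4 2 * ((2 * theta4_pos 2 - theta4_pos 1) - theta4_pos 0 * (2 * theta4_pos 1)))"
    unfolding e1 e2 by (simp add: algebra_simps power2_eq_square)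
  also have "\<dots> = 6 * ((theta4 0)^2 * lam 3) + theta4 0 * (4 * theta4 4 - theta4 2) - 24 * (theta4 2)^2"
    unfolding U theta4_theta4_pos(1) by (simp add: theta4_theta4_pos(2) algebra_simps power2_eq_square)
  finally show ?thesis .
qed

text \<open>The same elimination for \<open>r = 3\<close>; it brings in \<open>appell 5\<close>,
  which closes the system modulo 5.\<close>

lemma appell_relation_3:
  "15 * (theta4 0 * (theta4 0 * (appell 5 + 4 * qD (appell 3)) + 12 * (theta4 2 * (appell 3 + 4 * qD (appell 1)))) 
     - 4 * (theta4 2 * (theta4 0 * appell 3 + 12 * (theta4 2 * appell 1))))
    = 30 * ((theta4 0)^2 * lam 5) + theta4 0 * (16 * theta4 6 - theta4 2) - 240 * (theta4 2 * theta4 4) - 60 * (theta4 2)^2"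
proof -
  define V where "V = qseries pos2 (\<lambda>(a,h). sg a * (2*a)^3) (\<lambda>(a,h). a^2 + 2 * (a * h))"
  define U where "U = qseries {1..} (\<lambda>j. sg j * (\<Sum>a\<in>{1..2*j-1}. a^3 * (2*j-a)^2)) (\<lambda>j. j^2)"
  have U: "15 * U = 16 * theta4_pos 6 - theta4_pos 2" unfolding U_def by (rule polar_part)
  have e1: "theta4 0 * appell 3 + 12 * (theta4 2 * appell 1) = 2 * (theta4 0 * lam 3 + (4 * theta4_pos 4 - 4 * theta4_pos 3 + theta4_pos 2) - theta4 0 * V - theta4_pos 0 * (8 * theta4_pos 3))"
    using appell_times_theta[of 3 "\<lambda>_. 1"] 
    unfolding appell_moment_3(1)[symmetric] lambert_part polar_part theta_part V_def[symmetric] by simp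
  have e2: "theta4 0 * (appell 5 + 4 * qD (appell 3)) + 12 * (theta4 2 * (appell 3 + 4 * qD (appell 1)))
     = 2 * (theta4 0 * lam 5 + 4 * (theta4 2 * lam 3) + U - 4 * theta4 2 * V - 4 * theta4_pos 2 * (8 * theta4_pos 3))"
    using appell_times_theta[of 3 "\<lambda>b. b^2"] 
    unfolding appell_moment_3(2)[symmetric] lambert_part theta_part V_def[symmetric] U_def[symmetric]
    by (simp del: add_2_eq_Suc')
  show ?thesis
    unfolding e1 e2
  proof -
    have "15 * (theta4 0 * (2 * (theta4 0 * lam 5 + 4 * (theta4 2 * lam 3) + U - 4 * theta4 2 * V - 4 * theta4_pos 2 * (8 * theta4_pos 3)))
      - 4 * (theta4 2 * (2 * (theta4 0 * lam 3 + (4 * theta4_pos 4 - 4 * theta4_pos 3 + theta4_pos 2) - theta4 0 * V - theta4_pos 0 * (8 * theta4_pos 3)))))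
     = 30 * ((theta4 0)^2 * lam 5) + 2 * (theta4 0 * (15 * U)) - 960 * (theta4 0 * (theta4_pos 2 * theta4_pos 3))
      - 120 * (theta4 2 * ((4 * theta4_pos 4 - 4 * theta4_pos 3 + theta4_pos 2) - theta4_pos 0 * (8 * theta4_pos 3)))"
      by (simp add: algebra_simps power2_eq_square)
    also have "\<dots> = 30 * ((theta4 0)^2 * lam 5) + theta4 0 * (16 * theta4 6 - theta4 2) - 240 * (theta4 2 * theta4 4) - 60 * (theta4 2)^2"
      unfolding U theta4_theta4_pos(1) by (simp add: theta4_theta4_pos(2) algebra_simps power2_eq_square)
    finally show "15 * (theta4 0 * (2 * (theta4 0 * lam 5 + 4 * (theta4 2 * lam 3) + U - 4 * theta4 2 * V - 4 * theta4_pos 2 * (8 * theta4_pos 3)))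
      - 4 * (theta4 2 * (2 * (theta4 0 * lam 3 + (4 * theta4_pos 4 - 4 * theta4_pos 3 + theta4_pos 2) - theta4 0 * V - theta4_pos 0 * (8 * theta4_pos 3)))))
     = 30 * ((theta4 0)^2 * lam 5) + theta4 0 * (16 * theta4 6 - theta4 2) - 240 * (theta4 2 * theta4 4) - 60 * (theta4 2)^2" .
  qed
qed

section \<open>Dilation and differential relations\<close>

definition dilate :: "int fps \<Rightarrow> int fps" where "dilate f = f oo fps_X^2"

lemma dilate_nth: "fps_nth (dilate f) n = (if even n then fps_nth f (n div 2) else 0)"
  by (simp add: dilate_def fps_nth_compose_X_power)

lemma dilate_add: "dilate (f + g) = dilate f + dilate g" and dilate_diff: "dilate (f - g) = dilate f - dilate g"
  by (rule fps_ext; simp add: dilate_nth)+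

lemma dilate_mult: "dilate (f * g) = dilate f * dilate g"
  unfolding dilate_def by (rule fps_compose_mult_distrib) (simp add: power2_eq_square)

lemma dilate_of_int: "dilate (of_int k) = of_int k"
  by (rule fps_ext) (auto simp: dilate_nth simp flip: fps_of_int)

lemma dilate_numeral: "dilate (numeral k) = numeral k"
  using dilate_of_int[of "numeral k"] by simp

lemma qD_dilate: "qD (dilate f) = 2 * dilate (qD f)"
proof (rule fps_ext)
  fix n
  have "fps_nth (2 * dilate (qD f)) n = 2 * fps_nth (dilate (qD f)) n"
    by (simp only: fps_numeral_fps_const fps_mult_left_const_nth)
  then show "fps_nth (qD (dilate f)) n = fps_nth (2 * dilate (qD f)) n"
    by (auto simp: dilate_nth qD_nth elim!: evenE)
qed

lemma dilate_qseries: "dilate (qseries I c e) = qseries I c (\<lambda>i. 2 * e i)"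
proof (rule fps_ext)
  fix n
  have "{i \<in> I. 2 * e i = int n} = (if even n then {i \<in> I. e i = int (n div 2)} else {})"
    by (auto elim!: evenE) presburger
  then show "fps_nth (dilate (qseries I c e)) n = fps_nth (qseries I c (\<lambda>i. 2 * e i)) n"
    by (simp add: dilate_nth qseries_nth)
qed

text \<open>Pairs with even cofactor \<open>2*i\<close> have exponent twice \<open>a * i\<close>, so
  they form the dilated series.\<close>

lemma lam_odd_dilate: "lam_odd r = lam r - dilate (lam r)"
proof -
  let ?E = "{(a,i). (a,i) \<in> pos2 \<and> even i}"
  have okE: "qok ?E (\<lambda>(a,i). a * i)" by (rule qok_subset[OF qok_prod]) auto
  have "bij_betw (\<lambda>(a,i). (a,2*i)) pos2 ?E"
    by (rule bij_betw_byWitness[where f'="\<lambda>(a,i). (a,i div 2)"]) (auto simp: pos2_def)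
  then have "qseries pos2 (\<lambda>(a,i). a^r) (\<lambda>x. 2 * (case x of (a,i) \<Rightarrow> a * i)) = qseries ?E (\<lambda>(a,i). a^r) (\<lambda>(a,i). a * i)"
    by (rule qseries_bij) auto
  then have E: "dilate (lam r) = qseries ?E (\<lambda>(a,i). a^r) (\<lambda>(a,i). a * i)"
    unfolding lam_def dilate_qseries .
  have "lam r = qseries (podd \<union> ?E) (\<lambda>(a,i). a^r) (\<lambda>(a,i). a * i)"
    unfolding lam_def by (rule qseries_cong) (auto simp: podd_def pos2_def)
  also have "\<dots> = lam_odd r + dilate (lam r)"
    unfolding E lam_odd_def by (rule qseries_Un[OF qok_prod_odd okE]) (auto simp: podd_def)
  finally show ?thesis unfolding eq_diff_eq by (rule sym)
qed

text \<open>Compare \<open>lam_squared\<close> with its image under q \<mapsto> q^2: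
  \<open>lam 3\<close> drops out through \<open>lam_odd_3\<close>. The relation exposes the factor 3
  in the first equation of \<open>appell_ode\<close>.\<close>

lemma lam_odd_relation: "2 * qD (lam_odd 1) = 3 * qD (lam 1) - lam_odd 1 - 32 * (lam_odd 1)^2 + 24 * (lam_odd 1 * lam 1)"
proof -
  define A a where "A = lam 1" and "a = lam_odd 1"
  have B: "dilate A = A - a" and B3: "dilate (lam 3) = lam 3 - (qD a + 4 * a^2)"
    using lam_odd_dilate[of 1] lam_odd_dilate[of 3] lam_odd_3 by (simp_all add: A_def a_def)
  have "2 * dilate (qD A) = qD (A - a)" by (simp only: qD_dilate[symmetric] B)
  then have BD: "2 * dilate (qD A) = qD A - qD a" by (simp add: qD_diff)
  have "dilate (12 * A^2) = dilate (5 * lam 3 + A - 6 * qD A)" using lam_squared by (simp add: A_def)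
  then have "12 * (dilate A)^2 = 5 * dilate (lam 3) + dilate A - 3 * (2 * dilate (qD A))"
    by (simp add: dilate_mult dilate_add dilate_diff dilate_numeral power2_eq_square)
  then have e: "12 * (A - a)^2 = 5 * (lam 3 - (qD a + 4 * a^2)) + (A - a) - 3 * (qD A - qD a)"
    unfolding BD B B3 .
  have "2 * qD a - (3 * qD A - a - 32 * a^2 + 24 * (a * A)) =
    (12 * (A - a)^2 - (5 * (lam 3 - (qD a + 4 * a^2)) + (A - a) - 3 * (qD A - qD a)))
    - (12 * A^2 - (5 * lam 3 + A - 6 * qD A))"
    by (simp add: algebra_simps power2_eq_square)
  also have "\<dots> = 0" using e lam_squared by (simp add: A_def)
  finally show ?thesis by (simp add: A_def a_def)
qed

text \<open>The difference of \<open>lam_1_lam_3\<close> at q and at q^2. Divisibility of the left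
  side by 5 is Fermat; what matters is the explicit quotient, which is itself reduced modulo 5
  later.\<close>

lemma lam_odd_5_relation:
  "21 * lam_odd 5 - lam_odd 1 = 5 * (6 * qD (lam 3) - 3 * qD (lam 3 - lam_odd 3) - 2 * lam_odd 3
     + 48 * (lam 1 * lam 3 - (lam 1 - lam_odd 1) * (lam 3 - lam_odd 3)))"
proof -
  have B: "dilate (lam r) = lam r - lam_odd r" for r using lam_odd_dilate[of r] by simp
  have "2 * dilate (qD (lam 3)) = qD (lam 3 - lam_odd 3)" by (simp only: qD_dilate[symmetric] B)
  then have BD: "2 * dilate (qD (lam 3)) = qD (lam 3 - lam_odd 3)" .
  have "dilate (21 * lam 5) = dilate (30 * qD (lam 3) - 10 * lam 3 + lam 1 + 240 * (lam 1 * lam 3))"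
    using lam_1_lam_3 by simp
  then have "21 * dilate (lam 5) = 15 * (2 * dilate (qD (lam 3))) - 10 * dilate (lam 3) + dilate (lam 1) + 240 * (dilate (lam 1) * dilate (lam 3))"
    by (simp add: dilate_mult dilate_add dilate_diff dilate_numeral)
  then have "21 * (lam 5 - lam_odd 5) = 15 * qD (lam 3 - lam_odd 3) - 10 * (lam 3 - lam_odd 3) + (lam 1 - lam_odd 1)
      + 240 * ((lam 1 - lam_odd 1) * (lam 3 - lam_odd 3))"
    unfolding BD B .
  then have "21 * lam_odd 5 = 21 * lam 5 - (15 * qD (lam 3 - lam_odd 3) - 10 * (lam 3 - lam_odd 3) + (lam 1 - lam_odd 1)
      + 240 * ((lam 1 - lam_odd 1) * (lam 3 - lam_odd 3)))" by (simp add: algebra_simps)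
  then show ?thesis unfolding lam_1_lam_3 by (simp add: algebra_simps)
qed

section \<open>Divisibility of integer series and Fermat congruences\<close>

lemma dvd_int_fpsI:
  assumes "\<And>n. k dvd fps_nth f n"
  shows "of_int k dvd (f :: int fps)"
proof
  show "f = of_int k * Abs_fps (\<lambda>n. fps_nth f n div k)"
    by (rule fps_ext) (use assms in \<open>simp flip: fps_of_int\<close>)
qed

lemma dvd_int_fpsD: "of_int k dvd (f :: int fps) \<Longrightarrow> k dvd fps_nth f n"
  by (auto simp flip: fps_of_int elim!: dvdE)

lemma qseries_dvd:
  assumes "\<And>i. i \<in> I \<Longrightarrow> k dvd c i - d i"
  shows "of_int k dvd qseries I c e - qseries I d e"
  unfolding qseries_diff by (rule dvd_int_fpsI) (auto simp: qseries_nth intro!: dvd_sum assms)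

text \<open>Stated with \<open>x^1\<close> because \<open>lam 1\<close>, \<open>lam_odd 1\<close>
  and \<open>appell 1\<close> unfold to that form.\<close>

lemma three_dvd_cube: "(3::int) dvd x^3 - x^1"
proof -
  have "x^3 - x^1 = (x - 1) * (x * (x + 1))"
    by (simp add: algebra_simps eval_nat_numeral)
  moreover have "3 dvd x \<or> 3 dvd x - 1 \<or> 3 dvd x + 1" by presburger
  ultimately show ?thesis by auto
qed

lemma five_dvd_fifth: "(5::int) dvd x^5 - x^1"
proof -
  have *: "x^5 - x^1 = (x^2 + 1) * ((x - 1) * (x * (x + 1)))"
    by (simp add: algebra_simps eval_nat_numeral)
  have "5 dvd x \<or> 5 dvd x - 1 \<or> 5 dvd x + 1 \<or> 5 dvd x - 2 \<or> 5 dvd x + 2" by presburger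
  moreover have "x^2 + 1 = (x - 2) * (x + 2) + 5" by (simp add: algebra_simps power2_eq_square)
  then have "5 dvd (x - 2) \<or> 5 dvd (x + 2) \<Longrightarrow> 5 dvd x^2 + 1" by auto
  ultimately show ?thesis unfolding * by auto
qed

lemma lam_cong:
  "3 dvd lam 3 - lam 1" "3 dvd lam_odd 3 - lam_odd 1" "3 dvd appell 3 - appell 1"
  "5 dvd lam 5 - lam 1" "5 dvd lam_odd 5 - lam_odd 1" "5 dvd appell 5 - appell 1"
proof -
  have n: "2 * sg n * x^r - 2 * sg n * x^s = 2 * sg n * (x^r - x^s)" for n x r s
    by (simp add: algebra_simps)
  note dvd3 = qseries_dvd[where k=3, unfolded of_int_numeral] and dvd5 = qseries_dvd[where k=5, unfolded of_int_numeral]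
  show "3 dvd lam 3 - lam 1" unfolding lam_def
    by (rule dvd3) (simp only: case_prod_unfold three_dvd_cube)
  show "3 dvd lam_odd 3 - lam_odd 1" unfolding lam_odd_def
    by (rule dvd3) (simp only: case_prod_unfold three_dvd_cube)
  show "3 dvd appell 3 - appell 1" unfolding appell_def
    by (rule dvd3) (simp only: case_prod_unfold n three_dvd_cube dvd_mult)
  show "5 dvd lam 5 - lam 1" unfolding lam_def
    by (rule dvd5) (simp only: case_prod_unfold five_dvd_fifth)
  show "5 dvd lam_odd 5 - lam_odd 1" unfolding lam_odd_def
    by (rule dvd5) (simp only: case_prod_unfold five_dvd_fifth)
  show "5 dvd appell 5 - appell 1" unfolding appell_def
    by (rule dvd5) (simp only: case_prod_unfold n five_dvd_fifth dvd_mult)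
qed

text \<open>Theta has constant term 1, so its inverse is again an integer series, with the opposite
  logarithmic derivative.\<close>

lemma inverse_theta4:
  obtains P where "P * theta4 0 = 1" "qD P = 2 * (lam_odd 1 * P)"
proof -
  have "theta4 0 * fps_right_inverse (theta4 0) 1 = 1"
    by (rule fps_right_inverse) (simp add: theta4_0_nth_0)
  then obtain P where P: "P * theta4 0 = 1" by (metis mult.commute)
  have "qD P * theta4 0 = 2 * (lam_odd 1 * P) * theta4 0"
  proof -
    have "0 = qD (P * theta4 0)" by (simp add: P)
    also have "\<dots> = qD P * theta4 0 - 2 * (lam_odd 1 * P) * theta4 0"
      by (simp add: qD_mult qD_theta4_0 theta4_2 algebra_simps)
    finally show ?thesis by simp
  qed
  then have "qD P = 2 * (lam_odd 1 * P)" using theta4_0_nonzero by (simp only: mult_cancel_right simp_thms)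
  with P show ?thesis by (rule that)
qed

text \<open>Dividing by theta turns the relations into first-order differential equations for
  \<open>s r = appell r / theta4 0\<close>; together with \<open>m^3 \<equiv> m\<close> and \<open>m^5 \<equiv> m\<close> these decide the even part modulo 3 and 5.\<close>

lemma appell_ode:
  fixes P :: "int fps"
  assumes P: "P * theta4 0 = 1" and qP: "qD P = 2 * (lam_odd 1 * P)"
  defines "a \<equiv> lam_odd 1" and "s \<equiv> (\<lambda>r. P * appell r)"
  defines "rho \<equiv> 6 * lam 3 + 2 * a - 8 * qD a - 80 * a^2"
  shows "3 * (4 * qD (s 1) + s 3) = P * rho"
    and "15 * (4 * qD (s 3) + s 5) = P * (30 * lam 5 - 32 * qD (qD a) + 192 * (a * qD a) - 128 * a^3 + 2 * a
      + 120 * (a * (16 * a^2 - 8 * qD a - 2 * a)) + 120 * (a * rho))"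
proof -
  define f where "f = theta4 0"
  have Pf: "P * f = 1" "f * P = 1" using P by (simp_all add: f_def mult.commute)
  have sD: "P * qD (appell r) = qD (s r) - 2 * (a * s r)" for r
    by (simp add: s_def qD_mult qP a_def algebra_simps)
  have qs: "qD (s r) = P * qD (appell r) + 2 * (a * s r)" for r by (simp add: sD)
  have f2: "theta4 2 = - 2 * (f * a)" using theta4_2 by (simp add: a_def f_def)
  have c: "P * (f * x) = x" for x by (simp add: mult.assoc[symmetric] Pf)
  \<comment> \<open>\<open>appell_relation_1\<close> carries two factors \<open>f\<close>; of the
    three factors \<open>P\<close>, two cancel them by \<open>c\<close> and one remains.\<close>
  have e1: "P * (f * (P * (f * (P * (3 * (appell 3 + 4 * qD (appell 1) + 8 * (a * appell 1)))))))
    = P * (P * (P * (3 * (f * (f * (appell 3 + 4 * qD (appell 1)) - 4 * (theta4 2 * appell 1))))))"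
    unfolding f2 by (simp add: algebra_simps)
  have "3 * (4 * qD (s 1) + s 3) = P * (3 * (appell 3 + 4 * qD (appell 1) + 8 * (a * appell 1)))"
    unfolding qs unfolding s_def by (simp add: algebra_simps)
  also have "\<dots> = P * (P * (P * (3 * (f * (f * (appell 3 + 4 * qD (appell 1)) - 4 * (theta4 2 * appell 1))))))"
    using e1 unfolding c .
  also have "\<dots> = P * (P * (P * (f * (f * rho))))"
    unfolding appell_relation_1[folded f_def] unfolding theta4_4_closed[folded f_def a_def] f2 rho_def
    by (simp add: algebra_simps power2_eq_square)
  also have "\<dots> = P * rho" by (metis c mult.left_commute)
  finally show r1: "3 * (4 * qD (s 1) + s 3) = P * rho" .
  have e3: "P * (P * (P * (f * (f * (15 * (appell 5 + 4 * qD (appell 3) - 24 * (a * (appell 3 + 4 * qD (appell 1)))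
      + 8 * (a * appell 3) - 192 * (a * (a * appell 1))))))))
    = P * (P * (P * (15 * (f * (f * (appell 5 + 4 * qD (appell 3)) + 12 * (theta4 2 * (appell 3 + 4 * qD (appell 1)))) 
     - 4 * (theta4 2 * (f * appell 3 + 12 * (theta4 2 * appell 1)))))))"
    unfolding f2 by (simp add: algebra_simps)
  have "P * (appell 5 + 4 * qD (appell 3) - 24 * (a * (appell 3 + 4 * qD (appell 1)))
      + 8 * (a * appell 3) - 192 * (a * (a * appell 1)))
     = s 5 + 4 * (P * qD (appell 3)) - 24 * (a * (s 3 + 4 * (P * qD (appell 1)))) + 8 * (a * s 3) - 192 * (a * (a * s 1))"
    by (simp add: s_def algebra_simps)
  also have "\<dots> = s 5 + 4 * qD (s 3) - 24 * (a * (s 3 + 4 * qD (s 1)))"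
    unfolding sD by (simp add: algebra_simps)
  finally have e4: "P * (appell 5 + 4 * qD (appell 3) - 24 * (a * (appell 3 + 4 * qD (appell 1)))
      + 8 * (a * appell 3) - 192 * (a * (a * appell 1))) = s 5 + 4 * qD (s 3) - 24 * (a * (s 3 + 4 * qD (s 1)))" .
  define Y where "Y = 30 * lam 5 - 32 * qD (qD a) + 192 * (a * qD a) - 128 * a^3 + 2 * a
      + 120 * (a * (16 * a^2 - 8 * qD a - 2 * a))"
  \<comment> \<open>The mixed term \<open>24 * (a * (s 3 + 4 * qD (s 1)))\<close> is traded for
    \<open>rho\<close> by the first equation, as 15 * 24 = 120 * 3.\<close>
  have "15 * (4 * qD (s 3) + s 5) = 15 * (s 5 + 4 * qD (s 3) - 24 * (a * (s 3 + 4 * qD (s 1)))) + 120 * (a * (3 * (4 * qD (s 1) + s 3)))"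
    by (simp add: algebra_simps)
  also have "\<dots> = P * (15 * (appell 5 + 4 * qD (appell 3) - 24 * (a * (appell 3 + 4 * qD (appell 1)))
      + 8 * (a * appell 3) - 192 * (a * (a * appell 1)))) + 120 * (a * (P * rho))"
    unfolding r1 e4[symmetric] by (simp add: mult.left_commute)
  also have "P * (15 * (appell 5 + 4 * qD (appell 3) - 24 * (a * (appell 3 + 4 * qD (appell 1)))
      + 8 * (a * appell 3) - 192 * (a * (a * appell 1)))) = 
    P * (P * (P * (15 * (f * (f * (appell 5 + 4 * qD (appell 3)) + 12 * (theta4 2 * (appell 3 + 4 * qD (appell 1)))) 
     - 4 * (theta4 2 * (f * appell 3 + 12 * (theta4 2 * appell 1)))))))"
    unfolding e3[symmetric] by (metis c mult.left_commute)
  also have "\<dots> = P * (P * (P * (f * (f * Y))))"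
    unfolding appell_relation_3[folded f_def] unfolding theta4_4_closed[folded f_def a_def] theta4_6_closed[folded f_def a_def] f2 Y_def
    by (simp add: algebra_simps power2_eq_square power3_eq_cube)
  also have "\<dots> = P * Y" by (metis c mult.left_commute)
  finally have "15 * (4 * qD (s 3) + s 5) = P * (Y + 120 * (a * rho))" by (simp add: algebra_simps)
  then show "15 * (4 * qD (s 3) + s 5) = P * (30 * lam 5 - 32 * qD (qD a) + 192 * (a * qD a) - 128 * a^3 + 2 * a
      + 120 * (a * (16 * a^2 - 8 * qD a - 2 * a)) + 120 * (a * rho))" by (simp only: Y_def)
qed

section \<open>Congruences for the even part\<close>

text \<open>\<open>lam_odd_relation\<close> makes the right side of the first equation in
  \<open>appell_ode\<close> a multiple of 3, so 3 can be cancelled. Modulo 3 the left side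
  \<open>4 * qD s1 + s3\<close> is then \<open>qD s1 + s1\<close>, because
  \<open>s3 \<equiv> s1\<close>. The Lambert terms left in \<open>qD w + w\<close> cancel by the
  congruences for \<open>lam 3\<close> and \<open>lam_odd 3\<close>.\<close>

lemma even_part_mod_3:
  assumes w: "theta4 0 * w = lam 1 + 2 * lam_odd 1 + appell 1"
  shows "3 dvd qD w + w"
proof -
  obtain P where P: "P * theta4 0 = 1" "qD P = 2 * (lam_odd 1 * P)" by (rule inverse_theta4)
  define A a s1 s3 where "A = lam 1" and "a = lam_odd 1" and "s1 = P * appell 1" and "s3 = P * appell 3"
  have qP: "qD P = 2 * (a * P)" using P(2) by (simp add: a_def)
  have "w = P * theta4 0 * w" using P(1) by simp
  also have "\<dots> = P * (A + 2 * a) + s1"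
    unfolding mult.assoc w by (simp add: A_def a_def s1_def algebra_simps)
  finally have w': "w = P * (A + 2 * a) + s1" .
  have lr: "2 * qD a = 3 * qD A - a - 32 * a^2 + 24 * (a * A)"
    using lam_odd_relation by (simp add: A_def a_def)
  have "6 * lam 3 + 2 * a - 8 * qD a - 80 * a^2 = 6 * lam 3 + 2 * a - 4 * (2 * qD a) - 80 * a^2" by simp
  also have "\<dots> = 3 * (2 * lam 3 + 2 * a - 4 * qD A + 16 * a^2 - 32 * (a * A))"
    unfolding lr by (simp add: algebra_simps)
  finally have rho: "6 * lam 3 + 2 * a - 8 * qD a - 80 * a^2 = 3 * (2 * lam 3 + 2 * a - 4 * qD A + 16 * a^2 - 32 * (a * A))" .
  have "3 * (4 * qD s1 + s3) = P * (6 * lam 3 + 2 * a - 8 * qD a - 80 * a^2)"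
    using appell_ode(1)[OF P] by (simp only: s1_def s3_def a_def)
  then have "3 * (4 * qD s1 + s3) = 3 * (P * (2 * lam 3 + 2 * a - 4 * qD A + 16 * a^2 - 32 * (a * A)))"
    unfolding rho by (simp only: mult.left_commute)
  then have e: "4 * qD s1 + s3 = P * (2 * lam 3 + 2 * a - 4 * qD A + 16 * a^2 - 32 * (a * A))"
    by (rule int_fps_numeral_cancel)
  have o3: "qD a = lam_odd 3 - 4 * a^2" using lam_odd_3 by (simp add: a_def)
  have "qD w + w = (4 * qD s1 + s3) - 3 * qD s1 - (s3 - s1)
     + P * (2 * (a * (A + 2 * a)) + qD A + 2 * qD a + A + 2 * a)"
    unfolding w' by (simp add: qD_add qD_mult qP algebra_simps)
  also have "\<dots> = P * (2 * (lam 3 - A) + 2 * (lam_odd 3 - a)) - P * (appell 3 - appell 1)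
     + 3 * (P * (A + 2 * a - qD A + 4 * a^2 - 10 * (a * A)) - qD s1)"
    unfolding e unfolding o3 s1_def s3_def by (simp add: algebra_simps power2_eq_square)
  finally have "qD w + w = P * (2 * (lam 3 - A) + 2 * (lam_odd 3 - a)) - P * (appell 3 - appell 1)
     + 3 * (P * (A + 2 * a - qD A + 4 * a^2 - 10 * (a * A)) - qD s1)" .
  moreover have "3 dvd P * (2 * (lam 3 - A) + 2 * (lam_odd 3 - a)) - P * (appell 3 - appell 1)
     + 3 * (P * (A + 2 * a - qD A + 4 * a^2 - 10 * (a * A)) - qD s1)"
    unfolding A_def a_def
    by (rule dvd_add[OF dvd_diff[OF dvd_mult[OF dvd_add[OF dvd_mult[OF lam_cong(1)] dvd_mult[OF lam_cong(2)]]]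
        dvd_mult[OF lam_cong(3)]] dvd_triv_left])
  ultimately show ?thesis by simp
qed

text \<open>Eliminating \<open>s3\<close> from the two equations of \<open>appell_ode\<close>
  expresses \<open>48 * qD (qD s1) - 3 * s5\<close> by Lambert terms. Since
  \<open>s5 \<equiv> s1\<close> modulo 5, applying 48 (D^2 - 9) = 48 (D - 3) (D + 3) to
  \<open>s1\<close> returns \<open>s1\<close> plus such terms, which explains the first summand of
  \<open>G\<close>. The other two summands bring the Lambert terms into the image of D - 3 as
  well.\<close>

lemma even_part_mod_5:
  assumes w: "theta4 0 * w = lam 1 + 2 * lam_odd 1 + appell 1"
  obtains G where "5 dvd w - (qD G - 3 * G)"
proof -
  obtain P where P: "P * theta4 0 = 1" "qD P = 2 * (lam_odd 1 * P)" by (rule inverse_theta4)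
  define A a s1 s3 s5 where "A = lam 1" and "a = lam_odd 1" and "s1 = P * appell 1" and "s3 = P * appell 3"
    and "s5 = P * appell 5"
  define rho where "rho = 6 * lam 3 + 2 * a - 8 * qD a - 80 * a^2"
  have qP: "qD P = 2 * (a * P)" using P(2) by (simp add: a_def)
  have "w = P * theta4 0 * w" using P(1) by simp
  also have "\<dots> = P * (A + 2 * a) + s1"
    unfolding mult.assoc w by (simp add: A_def a_def s1_def algebra_simps)
  finally have w': "w = P * (A + 2 * a) + s1" .
  have delta: "2 * qD a - (3 * qD A - a - 32 * a^2 + 24 * (a * A)) = 0"
    using lam_odd_relation by (simp add: A_def a_def)
  have Ddelta: "2 * qD (qD a) - (3 * qD (qD A) - qD a - 64 * (a * qD a) + 24 * (qD a * A + a * qD A)) = 0"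
    using arg_cong[OF delta, of qD] by (simp add: qD_diff qD_add qD_mult power2_eq_square algebra_simps)
  have beta: "12 * A^2 - (5 * lam 3 + A - 6 * qD A) = 0"
    using lam_squared by (simp add: A_def)
  have Dbeta: "24 * (A * qD A) - (5 * qD (lam 3) + qD A - 6 * qD (qD A)) = 0"
    using arg_cong[OF beta, of qD] by (simp add: qD_diff qD_add qD_mult power2_eq_square algebra_simps)
  have o3: "lam_odd 3 = qD a + 4 * a^2" using lam_odd_3 by (simp add: a_def)
  have o5: "lam_odd 5 = qD (qD a) + 24 * (a * qD a) + 64 * a^3" using lam_odd_5 by (simp add: a_def)
  define Br where "Br = 6 * qD (lam 3) - 3 * (qD (lam 3) - qD (qD a) - 8 * (a * qD a)) - 2 * (qD a + 4 * a^2)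
     + 48 * (A * lam 3 - (A - a) * (lam 3 - (qD a + 4 * a^2)))"
  have Br: "5 * Br = 21 * (qD (qD a) + 24 * (a * qD a) + 64 * a^3) - a"
    using lam_odd_5_relation unfolding o5 o3 a_def[symmetric] A_def[symmetric]
    by (simp add: Br_def qD_diff qD_add qD_mult power2_eq_square algebra_simps)
  \<comment> \<open>\<open>sig\<close> is an explicit fifth of the right side in the second equation
    of \<open>appell_ode\<close>: the terms there whose coefficients are not multiples of 5 are -2
    times the right side of \<open>Br\<close>, up to 10, 1200 and 2560 times a monomial.\<close>
  define sig where "sig = 6 * lam 5 - 2 * Br + 2 * qD (qD a) + 240 * (a * qD a) + 512 * a^3
      + 24 * (a * (16 * a^2 - 8 * qD a - 2 * a)) + 24 * (a * rho)"
  have sig: "5 * sig = 30 * lam 5 - 32 * qD (qD a) + 192 * (a * qD a) - 128 * a^3 + 2 * a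
      + 120 * (a * (16 * a^2 - 8 * qD a - 2 * a)) + 120 * (a * rho)"
  proof -
    have "5 * sig = 30 * lam 5 - 2 * (5 * Br) + 10 * qD (qD a) + 1200 * (a * qD a) + 2560 * a^3
      + 120 * (a * (16 * a^2 - 8 * qD a - 2 * a)) + 120 * (a * rho)"
      by (simp add: sig_def algebra_simps)
    then show ?thesis unfolding Br by (simp add: algebra_simps)
  qed
  have e1: "3 * (4 * qD s1 + s3) = P * rho"
    using appell_ode(1)[OF P] by (simp only: s1_def s3_def a_def rho_def)
  have "15 * (4 * qD s3 + s5) = P * (5 * sig)"
    unfolding sig using appell_ode(2)[OF P] by (simp only: s3_def s5_def a_def rho_def)
  then have "5 * (3 * (4 * qD s3 + s5)) = 5 * (P * sig)" by (simp add: algebra_simps)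
  then have e2: "3 * (4 * qD s3 + s5) = P * sig" by (rule int_fps_numeral_cancel)
  have De1: "3 * (4 * qD (qD s1) + qD s3) = qD (P * rho)"
    unfolding e1[symmetric] by (simp add: qD_add qD_mult)
  \<comment> \<open>\<open>g\<close> is chosen so that \<open>qD g + 2 * (a * g) - 3 * g\<close>,
    which is (D - 3) (P g) divided by \<open>P\<close>, matches the remaining Lambert terms modulo
    5. The cofactor of 5 in that match is \<open>res\<close>.\<close>
  define g where "g = 2 * A + a * A + 3 * A^2 + 4 * lam 3"
  define G where "G = 48 * (qD s1 + 3 * s1) - 4 * (P * rho) + P * g"
  define res where "res = 3 * A - 15 * (A * qD A) - 15 * (A * qD a) + 10 * (A * a) - 74 * (A * a^2) - 3 * A^2
     - 6 * (A^2 * a) - 10 * lam 3 + 12 * (lam 3 * a) - qD A + qD A * a + qD (lam 3) - 3 * qD (qD A)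
     - 2 * qD (qD a) + 19 * qD a - 52 * (qD a * a) - 4 * a + 182 * a^2 - 192 * a^3"
  have Dg: "qD g = 2 * qD A + qD a * A + a * qD A + 6 * (A * qD A) + 4 * qD (lam 3)"
    unfolding g_def by (simp add: qD_add qD_mult power2_eq_square)
  \<comment> \<open>An exact polynomial identity whose last group is a combination of the vanishing
    expressions in \<open>Ddelta\<close>, \<open>Dbeta\<close>, \<open>delta\<close> and
    \<open>beta\<close>, in this order. The differences involving \<open>lam 5\<close> and
    \<open>lam_odd 5\<close> are multiples of 5 by Fermat.\<close>
  have "A + 2 * a + sig - 12 * rho = 6 * (lam 5 - A) + (qD g + 2 * (a * g) - 3 * g)
     + 4 * (lam_odd 5 - a) + 5 * res
     + ((2 * qD (qD a) - (3 * qD (qD A) - qD a - 64 * (a * qD a) + 24 * (qD a * A + a * qD A)))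
      + 3 * (24 * (A * qD A) - (5 * qD (lam 3) + qD A - 6 * qD (qD A)))
      + (2 + A + 2 * a) * (2 * qD a - (3 * qD A - a - 32 * a^2 + 24 * (a * A)))
      + (2 + 4 * a) * (12 * A^2 - (5 * lam 3 + A - 6 * qD A)))"
    unfolding Dg unfolding o5 sig_def Br_def rho_def g_def res_def
    by (simp add: algebra_simps power2_eq_square power3_eq_cube)
  then have Q: "A + 2 * a + sig - 12 * rho = 6 * (lam 5 - A) + (qD g + 2 * (a * g) - 3 * g)
     + 4 * (lam_odd 5 - a) + 5 * res"
    unfolding delta Ddelta beta Dbeta by simp
  have qPg: "qD (P * g) = P * (qD g + 2 * (a * g))" by (simp add: qD_mult qP algebra_simps)
  have qG: "qD G = 48 * (qD (qD s1) + 3 * qD s1) - 4 * qD (P * rho) + qD (P * g)"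
    by (simp add: G_def qD_add qD_diff qD_mult)
  have "w - (qD G - 3 * G) = 430 * s1 - 3 * (s5 - s1) + P * (A + 2 * a + sig - 12 * rho - (qD g + 2 * (a * g) - 3 * g))
     + (4 * (3 * (4 * qD (qD s1) + qD s3)) - 48 * qD (qD s1) - 12 * qD s3) 
     + (3 * (4 * qD s3 + s5) - P * sig) + 4 * (qD (P * rho) - 3 * (4 * qD (qD s1) + qD s3)) + 0"
    unfolding w' qG unfolding qPg G_def by (simp add: algebra_simps)
  also have "\<dots> = 5 * (86 * s1) - 3 * (P * (appell 5 - appell 1)) + P * (6 * (lam 5 - A) + 4 * (lam_odd 5 - a) + 5 * res)"
    unfolding Q e2 De1 by (simp add: s1_def s5_def algebra_simps flip: De1)
  finally have "w - (qD G - 3 * G) = 5 * (86 * s1) - 3 * (P * (appell 5 - appell 1)) + P * (6 * (lam 5 - A) + 4 * (lam_odd 5 - a) + 5 * res)" .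
  moreover have "5 dvd 5 * (86 * s1) - 3 * (P * (appell 5 - appell 1)) + P * (6 * (lam 5 - A) + 4 * (lam_odd 5 - a) + 5 * res)"
    unfolding A_def a_def
    by (rule dvd_add[OF dvd_diff[OF dvd_triv_left dvd_mult[OF dvd_mult[OF lam_cong(6)]]]
        dvd_mult[OF dvd_add[OF dvd_add[OF dvd_mult[OF lam_cong(4)] dvd_mult[OF lam_cong(5)]] dvd_triv_left]]])
  ultimately have "5 dvd w - (qD G - 3 * G)" by simp
  then show ?thesis by (rule that)
qed

section \<open>A Bailey pair\<close>

context
  fixes q :: "'a :: field"
  assumes nz: "\<And>k. 0 < k \<Longrightarrow> q ^ k \<noteq> 1" and q0: "q \<noteq> 0"
begin

text \<open>In standard notation \<open>qp n\<close> is (q;q)_n and \<open>op n\<close> is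
  (-q;q^2)_n; \<open>dd\<close> follows the convention 1 / (q;q)_n = 0 for n < 0.\<close>

definition qp :: "nat \<Rightarrow> 'a" where "qp n = (\<Prod>k=1..n. 1 - q^k)"
definition op :: "nat \<Rightarrow> 'a" where "op n = (\<Prod>k=1..n. 1 + q^(2*k-1))"
definition dd :: "int \<Rightarrow> int \<Rightarrow> 'a" where
  "dd a b = (if a < 0 \<or> b < 0 then 0 else 1 / (qp (nat a) * qp (nat b)))"

lemma qp_0: "qp 0 = 1" and qp_Suc: "qp (Suc n) = qp n * (1 - q ^ Suc n)"
  and op_0: "op 0 = 1" and op_Suc: "op (Suc n) = op n * (1 + q ^ (2*n+1))"
  by (simp_all add: qp_def op_def)

lemma factor_nonzero: "1 - q ^ Suc n \<noteq> 0"
  using nz[of "Suc n"] by simp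

lemma qp_nonzero: "qp n \<noteq> 0"
  by (induction n) (use factor_nonzero in \<open>simp_all add: qp_0 qp_Suc del: power_Suc\<close>)

lemma dd_of_nat: "dd (int a) (int b) = 1 / (qp a * qp b)"
  by (simp add: dd_def)

lemma dd_three_term:
  assumes "-1 \<le> a" "-1 \<le> b" "0 \<le> a + b"
  shows "(1 - q powi (a+b+2)) * (1 - q powi (a+b+1)) * dd (a+1) (b+1)
    = q powi (a+1) * dd (a+1) (b-1) + (1 + q powi (a+b+1)) * dd a b + q powi (b+1) * dd (a-1) (b+1)"
proof -
  have edge: "(1 - q powi (int n + 1)) * (1 - q powi (int n)) * (1 / qp (Suc n)) = 1 / qp (n - 1)" if pos: "0 < n" for n
  proof -
    obtain m where m: "n = Suc m" using pos gr0_conv_Suc by blast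
    have i: "int n + 1 = int (Suc (Suc m))" "int n = int (Suc m)" by (simp_all add: m)
    have "q powi (int n + 1) = q ^ Suc (Suc m)" by (simp only: i(1) power_int_of_nat)
    moreover have "q powi (int n) = q ^ Suc m" by (simp only: i(2) power_int_of_nat)
    ultimately show ?thesis using factor_nonzero[of m] factor_nonzero[of "Suc m"] qp_nonzero[of m]
      by (simp add: m qp_Suc del: power_Suc)
  qed
  consider "a = -1" | "b = -1" | "0 \<le> a" "0 \<le> b" using assms by linarith
  then show ?thesis
  proof cases
    case 1
    define n where "n = nat b"
    have n: "b = int n" "0 < n" using 1 assms by (simp_all add: n_def)
    have "nat (int n + 1) = Suc n" "nat (int n - 1) = n - 1" by simp_all
    then show ?thesis using edge[OF n(2)] n by (simp add: dd_def qp_0 1 add.commute)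
  next
    case 2
    define n where "n = nat a"
    have n: "a = int n" "0 < n" using 2 assms by (simp_all add: n_def)
    have "nat (int n + 1) = Suc n" "nat (int n - 1) = n - 1" by simp_all
    then show ?thesis using edge[OF n(2)] n by (simp add: dd_def qp_0 2 add.commute)
  next
    case 3
    then obtain m n where mn: "a = int m" "b = int n" by (metis nonneg_int_cases)
    define x y where "x = q ^ m" and "y = q ^ n"
    have p: "q powi (a+b+2) = x * y * q * q" "q powi (a+b+1) = x * y * q"
      "q powi (a+1) = x * q" "q powi (b+1) = y * q"
      by (simp_all add: mn x_def y_def power_int_add q0 power2_eq_square)
    have x1: "1 - x * q \<noteq> 0" and y1: "1 - y * q \<noteq> 0"
      using factor_nonzero[of m] factor_nonzero[of n] by (simp_all add: x_def y_def mult.commute)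
    have S: "qp (Suc m) = qp m * (1 - x * q)" "qp (Suc n) = qp n * (1 - y * q)"
      by (simp_all add: qp_Suc x_def y_def mult.commute)
    have d1: "dd (a+1) (b+1) = 1 / (qp m * (1 - x * q) * (qp n * (1 - y * q)))"
      using dd_of_nat[of "Suc m" "Suc n"] by (simp add: mn S add.commute)
    have d2: "dd (a+1) (b-1) = (1 - y) / (qp m * (1 - x * q) * qp n)"
    proof (cases n)
      case 0 then show ?thesis by (simp add: dd_def mn y_def)
    next
      case (Suc k)
      have "qp n = qp k * (1 - y)" by (simp add: Suc qp_Suc y_def)
      moreover have "1 - y \<noteq> 0" using factor_nonzero[of k] by (simp add: Suc y_def)
      ultimately show ?thesis using dd_of_nat[of "Suc m" k] by (simp add: mn S Suc add.commute)
    qed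
    have d3: "dd (a-1) (b+1) = (1 - x) / (qp m * (qp n * (1 - y * q)))"
    proof (cases m)
      case 0 then show ?thesis by (simp add: dd_def mn x_def)
    next
      case (Suc k)
      have "qp m = qp k * (1 - x)" by (simp add: Suc qp_Suc x_def)
      moreover have "1 - x \<noteq> 0" using factor_nonzero[of k] by (simp add: Suc x_def)
      ultimately show ?thesis using dd_of_nat[of k "Suc n"] by (simp add: mn S Suc add.commute)
    qed
    have d4: "dd a b = 1 / (qp m * qp n)" by (simp add: mn dd_of_nat)
    show ?thesis unfolding p d1 d2 d3 d4
      using x1 y1 qp_nonzero[of m] qp_nonzero[of n] by (simp add: divide_simps) (simp add: algebra_simps)
  qed
qed

lemma powi_mult: "x + y = z \<Longrightarrow> q powi x * q powi y = q powi z"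
  using power_int_add[of q x y] q0 by auto

text \<open>The reciprocal q-factorials \<open>dd\<close> vanish at negative arguments, so the range \<open>{-M..M}\<close> stands for all
  integers. The summand satisfies the recurrence of the right-hand side up to the telescoping term \<open>t m - t (m + 1)\<close>.\<close>

lemma bailey_pair:
  assumes "int n \<le> M"
  shows "(\<Sum>m\<in>{-M..M}. of_int (sg m) * q powi (2*m^2) * dd (int n - 2*m) (int n + 2*m)) = op n / qp (2*n)"
  using assms
proof (induction n)
  case 0
  have "(\<Sum>m\<in>{-M..M}. of_int (sg m) * q powi (2*m^2) * dd (int 0 - 2*m) (int 0 + 2*m))
     = (\<Sum>m\<in>{0}. of_int (sg m) * q powi (2*m^2) * dd (int 0 - 2*m) (int 0 + 2*m))"
    by (rule sum.mono_neutral_right) (use 0 in \<open>auto simp: dd_def\<close>)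
  then show ?case by (simp add: dd_def qp_0 op_0)
next
  case (Suc n)
  define c where "c m = of_int (sg m) * q powi (2*m^2)" for m
  \<comment> \<open>The outer terms of \<open>dd_three_term\<close> have arguments shifted by
    \<open>2m - 1\<close> and \<open>2m + 1\<close>. The second of them at \<open>m\<close> is
    therefore the first at \<open>m + 1\<close>, up to the sign change of \<open>sg\<close>.\<close>
  define t where "t m = of_int (sg m) * q powi (2*m^2 - 2*m + int n + 1) * dd (int n - (2*m - 1)) (int n + (2*m - 1))" for m
  have tt: "(1 - q powi (2 * int n + 2)) * (1 - q powi (2 * int n + 1)) * (c m * dd (int (Suc n) - 2*m) (int (Suc n) + 2*m))
      = (1 + q powi (2 * int n + 1)) * (c m * dd (int n - 2*m) (int n + 2*m)) + t m - t (m + 1)" for m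
  proof (cases "-1 \<le> int n - 2*m \<and> -1 \<le> int n + 2*m")
    case True
    have sg1: "sg (m + 1) = - sg m" by (simp add: sg_def)
    define D1 where "D1 = dd (int n - 2*m + 1) (int n + 2*m + 1)"
    have s1: "int (Suc n) - 2*m = int n - 2*m + 1" "int (Suc n) + 2*m = int n + 2*m + 1" by simp_all
    have s2: "int n - 2*m + (int n + 2*m) = 2 * int n" by simp
    have "(1 - q powi (2 * int n + 2)) * (1 - q powi (2 * int n + 1)) * dd (int n - 2*m + 1) (int n + 2*m + 1)
      = q powi (int n - 2*m + 1) * dd (int n - 2*m + 1) (int n + 2*m - 1)
        + (1 + q powi (2 * int n + 1)) * dd (int n - 2*m) (int n + 2*m)
        + q powi (int n + 2*m + 1) * dd (int n - 2*m - 1) (int n + 2*m + 1)"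
      using dd_three_term[of "int n - 2*m" "int n + 2*m"] True unfolding s2 by simp
    moreover have "c m * (q powi (int n - 2*m + 1) * dd (int n - 2*m + 1) (int n + 2*m - 1)) = t m"
    proof -
      have p: "q powi (2*m^2) * q powi (int n - 2*m + 1) = q powi (2*m^2 - 2*m + int n + 1)"
        by (rule powi_mult) simp
      have a: "int n - (2*m - 1) = int n - 2*m + 1" "int n + (2*m - 1) = int n + 2*m - 1" by simp_all
      show ?thesis unfolding c_def t_def a p[symmetric] by (simp only: mult.assoc)
    qed
    moreover have "c m * (q powi (int n + 2*m + 1) * dd (int n - 2*m - 1) (int n + 2*m + 1)) = - t (m + 1)"
    proof -
      have p: "q powi (2*m^2) * q powi (int n + 2*m + 1) = q powi (2*(m+1)^2 - 2*(m+1) + int n + 1)"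
        by (rule powi_mult) (simp add: power2_eq_square algebra_simps)
      have a: "int n - (2*(m+1) - 1) = int n - 2*m - 1" "int n + (2*(m+1) - 1) = int n + 2*m + 1" by simp_all
      show ?thesis unfolding c_def t_def a p[symmetric] sg1 of_int_minus by (simp only: mult.assoc mult_minus_left minus_minus)
    qed
    ultimately have h: "((1 - q powi (2 * int n + 2)) * (1 - q powi (2 * int n + 1))) * D1 = q powi (int n - 2*m + 1) * dd (int n - 2*m + 1) (int n + 2*m - 1) + (1 + q powi (2 * int n + 1)) * dd (int n - 2*m) (int n + 2*m) + q powi (int n + 2*m + 1) * dd (int n - 2*m - 1) (int n + 2*m + 1)" "c m * (q powi (int n - 2*m + 1) * dd (int n - 2*m + 1) (int n + 2*m - 1)) = t m" "c m * (q powi (int n + 2*m + 1) * dd (int n - 2*m - 1) (int n + 2*m + 1)) = - t (m + 1)"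
      unfolding D1_def by (simp_all only:)
    have "((1 - q powi (2 * int n + 2)) * (1 - q powi (2 * int n + 1))) * (c m * D1) = c m * (((1 - q powi (2 * int n + 2)) * (1 - q powi (2 * int n + 1))) * D1)" by (rule mult.left_commute)
    also have "\<dots> = c m * (q powi (int n - 2*m + 1) * dd (int n - 2*m + 1) (int n + 2*m - 1)) + (1 + q powi (2 * int n + 1)) * (c m * dd (int n - 2*m) (int n + 2*m)) + c m * (q powi (int n + 2*m + 1) * dd (int n - 2*m - 1) (int n + 2*m + 1))"
      unfolding h(1) by (simp only: distrib_left mult.left_commute)
    also have "\<dots> = (1 + q powi (2 * int n + 1)) * (c m * dd (int n - 2*m) (int n + 2*m)) + t m - t (m + 1)" unfolding h(2,3) by simp
    finally show ?thesis unfolding D1_def by (simp only: s1)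
  next
    case False
    then have "int n - 2*m + 1 < 0 \<or> int n + 2*m + 1 < 0" by linarith
    then show ?thesis by (auto simp: dd_def t_def)
  qed
  have t0: "t (-M) = 0" "t (M + 1) = 0" using Suc.prems by (auto simp: t_def dd_def)
  have tele: "(\<Sum>m\<in>{-M..M}. t m) = (\<Sum>m\<in>{-M..M}. t (m + 1))"
  proof -
    have "(\<Sum>m\<in>{-M..M}. t (m + 1)) = (\<Sum>m\<in>{-M+1..M+1}. t m)"
      by (rule sum.reindex_bij_witness[where i="\<lambda>m. m - 1" and j="\<lambda>m. m + 1"]) auto
    also have "\<dots> = (\<Sum>m\<in>{-M..M+1}. t m)"
    proof (rule sum.mono_neutral_left)
      show "\<forall>i\<in>{-M..M+1} - {-M+1..M+1}. t i = 0"
      proof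
        fix i assume "i \<in> {-M..M+1} - {-M+1..M+1}"
        then have "i = -M" by auto
        then show "t i = 0" using t0 by simp
      qed
    qed auto
    also have "\<dots> = (\<Sum>m\<in>{-M..M}. t m)"
    proof (rule sum.mono_neutral_right)
      show "\<forall>i\<in>{-M..M+1} - {-M..M}. t i = 0"
      proof
        fix i assume "i \<in> {-M..M+1} - {-M..M}"
        then have "i = M + 1" by auto
        then show "t i = 0" using t0 by simp
      qed
    qed auto
    finally show ?thesis by simp
  qed
  have IH: "(\<Sum>m\<in>{-M..M}. c m * dd (int n - 2*m) (int n + 2*m)) = op n / qp (2*n)"
    using Suc unfolding c_def by simp
  have "(1 - q powi (2 * int n + 2)) * (1 - q powi (2 * int n + 1)) * (\<Sum>m\<in>{-M..M}. c m * dd (int (Suc n) - 2*m) (int (Suc n) + 2*m))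
    = (\<Sum>m\<in>{-M..M}. (1 + q powi (2 * int n + 1)) * (c m * dd (int n - 2*m) (int n + 2*m)) + t m - t (m + 1))"
    unfolding sum_distrib_left tt ..
  also have "\<dots> = (1 + q powi (2 * int n + 1)) * (op n / qp (2*n))"
    by (simp add: sum.distrib sum_subtractf tele IH flip: sum_distrib_left)
  finally have e: "(1 - q powi (2 * int n + 2)) * (1 - q powi (2 * int n + 1)) * (\<Sum>m\<in>{-M..M}. c m * dd (int (Suc n) - 2*m) (int (Suc n) + 2*m))
     = (1 + q powi (2 * int n + 1)) * (op n / qp (2*n))" .
  have p: "q powi (2 * int n + 2) = q ^ Suc (Suc (2*n))" "q powi (2 * int n + 1) = q ^ Suc (2*n)"
  proof -
    have "2 * int n + 2 = int (Suc (Suc (2*n)))" "2 * int n + 1 = int (Suc (2*n))" by simp_all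
    then show "q powi (2 * int n + 2) = q ^ Suc (Suc (2*n))" "q powi (2 * int n + 1) = q ^ Suc (2*n)"
      by (simp_all only: power_int_of_nat)
  qed
  have "qp (2 * Suc n) = qp (2*n) * (1 - q ^ Suc (2*n)) * (1 - q ^ Suc (Suc (2*n)))"
    by (simp add: qp_Suc del: power_Suc)
  moreover have "op (Suc n) = op n * (1 + q ^ Suc (2*n))" by (simp add: op_Suc)
  ultimately show ?case
    using e factor_nonzero[of "2*n"] factor_nonzero[of "Suc (2*n)"] qp_nonzero[of "2*n"]
    unfolding p c_def[symmetric] by (simp add: divide_simps del: power_Suc) (simp only: ac_simps)
qed

text \<open>With x = q^(n+1-r) and y = q^r the difference comes down to (1 - x y)^2 - (1 - x) (1 - x
  y^2) = x (1 - y)^2. The square cancels the denominator, and x y = q^(n+1).\<close>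

lemma telescoping_summand:
  assumes "0 < r"
  shows "q ^ r / (1 - q ^ r)^2 * ((qp (Suc n))^2 * dd (int (Suc n) - int r) (int (Suc n) + int r)
       - (qp n)^2 * dd (int n - int r) (int n + int r))
    = q ^ Suc n * (qp n)^2 * dd (int (Suc n) - int r) (int (Suc n) + int r)"
proof -
  have r1: "1 - q ^ r \<noteq> 0" using nz[OF assms] by simp
  consider "Suc n < r" | "Suc n = r" | d where "n = d + r"
  proof -
    assume *: "Suc n < r \<Longrightarrow> thesis" "Suc n = r \<Longrightarrow> thesis" "\<And>d. n = d + r \<Longrightarrow> thesis"
    have "n = (n - r) + r" if "r \<le> n" using that by simp
    then show thesis using * by (cases "r \<le> n") (blast, fastforce)
  qed
  then show ?thesis
  proof cases
    case 1 then show ?thesis by (simp add: dd_def)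
  next
    case 2
    have "qp (Suc n) = qp n * (1 - q ^ r)" by (simp add: qp_Suc flip: 2)
    moreover have "dd (int n - int r) (int n + int r) = 0" using 2 by (simp add: dd_def)
    ultimately show ?thesis using r1 2 by (simp add: power_mult_distrib)
  next
    case 3
    define x y where "x = q ^ Suc d" and "y = q ^ r"
    have S1: "qp (Suc n) = qp n * (1 - x * y)" and S2: "qp (Suc d) = qp d * (1 - x)"
      and S3: "qp (Suc n + r) = qp (n + r) * (1 - x * y * y)"
      by (simp_all add: qp_Suc 3 x_def y_def power_add ac_simps)
    have x1: "1 - x \<noteq> 0" using factor_nonzero[of d] by (simp add: x_def)
    have x3: "1 - x * y * y \<noteq> 0"
      using factor_nonzero[of "n + r"] by (simp add: 3 x_def y_def power_add ac_simps)
    have d1: "dd (int (Suc n) - int r) (int (Suc n) + int r) = 1 / (qp d * (1 - x) * (qp (n + r) * (1 - x * y * y)))"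
      using dd_of_nat[of "Suc d" "Suc n + r"] unfolding S2 S3 by (simp add: 3 add.commute add.left_commute)
    have d2: "dd (int n - int r) (int n + int r) = 1 / (qp d * qp (n + r))"
      using dd_of_nat[of d "n + r"] by (simp add: 3)
    have "q ^ Suc n = x * y" by (simp add: 3 x_def y_def power_add)
    then show ?thesis unfolding S1 d1 d2 y_def[symmetric]
      using x1 x3 r1[folded y_def] qp_nonzero[of d] qp_nonzero[of "n + r"]
      by (simp add: divide_simps) (simp add: algebra_simps power2_eq_square)
  qed
qed

lemma symmetric_sum:
  fixes g :: "int \<Rightarrow> 'a"
  assumes "\<And>m. g (- m) = g m"
  shows "(\<Sum>m\<in>{- int M..int M}. g m) = g 0 + 2 * (\<Sum>r=1..M. g (int r))"
proof (induction M)
  case (Suc M)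
  have "{- int (Suc M)..int (Suc M)} = insert (int (Suc M)) (insert (- int (Suc M)) {- int M..int M})" by auto
  then have "(\<Sum>m\<in>{- int (Suc M)..int (Suc M)}. g m) = g (int (Suc M)) + (g (- int (Suc M)) + (\<Sum>m\<in>{- int M..int M}. g m))"
    by simp
  also have "\<dots> = g 0 + 2 * (\<Sum>r=1..Suc M. g (int r))"
    unfolding Suc assms by (simp add: algebra_simps)
  finally show ?case .
qed simp

text \<open>Insert \<open>bailey_pair\<close> into each summand: the index 0 gives the Lambert part,
  and the indices r and -r together telescope in n by \<open>telescoping_summand\<close> at
  \<open>2*r\<close>. The bound \<open>M\<close> is kept apart from \<open>N\<close> so that the
  range of \<open>r\<close> stays fixed during the induction.\<close>

lemma spt_finite_identity:
  assumes "N \<le> M"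
  shows "(\<Sum>n=1..N. q^n * (qp (n-1))^2 * (op n / qp (2*n)))
    = (\<Sum>n=1..N. q^n / (1 - q^n)^2)
      + 2 * (\<Sum>r=1..M. (-1)^r * q^(2*r^2) * (q^(2*r) / (1 - q^(2*r))^2 * ((qp N)^2 * dd (int N - int (2*r)) (int N + int (2*r)))))"
  using assms
proof (induction N)
  case 0
  have "dd (int 0 - int (2*r)) (int 0 + int (2*r)) = 0" if "r \<in> {1..M}" for r
    using that by (simp add: dd_def)
  then show ?case by simp
next
  case (Suc N)
  define e where "e r = (-1)^r * q^(2*r^2)" for r
  define d where "d n r = dd (int n - int (2*r)) (int n + int (2*r))" for n r
  define k where "k r = q^(2*r) / (1 - q^(2*r))^2" for r
  define g where "g m = of_int (sg m) * q powi (2*m^2) * dd (int (Suc N) - 2*m) (int (Suc N) + 2*m)" for m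
  have IH: "(\<Sum>n=1..N. q^n * (qp (n-1))^2 * (op n / qp (2*n)))
    = (\<Sum>n=1..N. q^n / (1 - q^n)^2) + 2 * (\<Sum>r=1..M. e r * (k r * ((qp N)^2 * d N r)))"
    unfolding e_def d_def k_def using Suc by simp
  have gm: "g (- m) = g m" for m
    unfolding g_def by (simp add: dd_def ac_simps)
  have "op (Suc N) / qp (2 * Suc N) = (\<Sum>m\<in>{- int M..int M}. g m)"
    unfolding g_def using bailey_pair[of "Suc N" "int M"] Suc.prems by simp
  also have "\<dots> = g 0 + 2 * (\<Sum>r=1..M. g (int r))" by (rule symmetric_sum) (rule gm)
  also have "g 0 = 1 / (qp (Suc N))^2"
    using dd_of_nat[of "Suc N" "Suc N"] by (simp add: g_def power2_eq_square)
  also have "(\<Sum>r=1..M. g (int r)) = (\<Sum>r=1..M. e r * d (Suc N) r)"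
  proof (rule sum.cong)
    fix r
    have "of_int (sg (int r)) = ((-1)^r :: 'a)" by (auto simp: sg_def)
    moreover have "q powi (2 * (int r)^2) = q^(2*r^2)"
    proof -
      have "2 * (int r)^2 = int (2*r^2)" by simp
      then show ?thesis by (simp only: power_int_of_nat)
    qed
    ultimately show "g (int r) = e r * d (Suc N) r" by (simp add: g_def e_def d_def)
  qed simp
  finally have op: "op (Suc N) / qp (2 * Suc N) = 1 / (qp (Suc N))^2 + 2 * (\<Sum>r=1..M. e r * d (Suc N) r)" .
  have tel: "k r * ((qp (Suc N))^2 * d (Suc N) r) = k r * ((qp N)^2 * d N r) + q^Suc N * (qp N)^2 * d (Suc N) r"
    if "r \<in> {1..M}" for r
    using telescoping_summand[of "2*r" N] that unfolding k_def d_def right_diff_distrib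
    by (simp only: diff_eq_eq add.commute) simp
  have "(\<Sum>r=1..M. e r * (k r * ((qp (Suc N))^2 * d (Suc N) r)))
     = (\<Sum>r=1..M. e r * (k r * ((qp N)^2 * d N r)) + q^Suc N * (qp N)^2 * (e r * d (Suc N) r))"
  proof (rule sum.cong)
    fix r assume "r \<in> {1..M}"
    show "e r * (k r * ((qp (Suc N))^2 * d (Suc N) r)) = e r * (k r * ((qp N)^2 * d N r)) + q^Suc N * (qp N)^2 * (e r * d (Suc N) r)"
      unfolding tel[OF \<open>r \<in> {1..M}\<close>] by (simp only: distrib_left ac_simps)
  qed simp
  also have "\<dots> = (\<Sum>r=1..M. e r * (k r * ((qp N)^2 * d N r))) + q^Suc N * (qp N)^2 * (\<Sum>r=1..M. e r * d (Suc N) r)"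
    by (simp only: sum.distrib sum_distrib_left)
  finally have R: "(\<Sum>r=1..M. e r * (k r * ((qp (Suc N))^2 * d (Suc N) r)))
    = (\<Sum>r=1..M. e r * (k r * ((qp N)^2 * d N r))) + q^Suc N * (qp N)^2 * (\<Sum>r=1..M. e r * d (Suc N) r)" .
  have q1: "q^Suc N * (qp N)^2 * (1 / (qp (Suc N))^2) = q^Suc N / (1 - q^Suc N)^2"
    using qp_nonzero[of N] factor_nonzero[of N] by (simp add: qp_Suc power_mult_distrib del: power_Suc)
  have "(\<Sum>n=1..Suc N. q^n * (qp (n-1))^2 * (op n / qp (2*n)))
     = (\<Sum>n=1..N. q^n * (qp (n-1))^2 * (op n / qp (2*n))) + q^Suc N * (qp N)^2 * (op (Suc N) / qp (2 * Suc N))"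
    by simp
  also have "\<dots> = (\<Sum>n=1..N. q^n / (1 - q^n)^2) + q^Suc N * (qp N)^2 * (1 / (qp (Suc N))^2)
      + 2 * ((\<Sum>r=1..M. e r * (k r * ((qp N)^2 * d N r))) + q^Suc N * (qp N)^2 * (\<Sum>r=1..M. e r * d (Suc N) r))"
    unfolding IH op by (simp only: distrib_left ac_simps)
  also have "\<dots> = (\<Sum>n=1..Suc N. q^n / (1 - q^n)^2) + 2 * (\<Sum>r=1..M. e r * (k r * ((qp (Suc N))^2 * d (Suc N) r)))"
    unfolding q1 R by simp
  finally show ?case unfolding e_def d_def k_def by (simp only: mult.assoc)
qed

text \<open>Rests on (-q;q)_(2n) = (-q;q^2)_n (-q^2;q^2)_n and (q;q)_n (-q;q)_n = (q^2;q^2)_n; the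
  product over all even parts up to 2N then splits off independently of \<open>n\<close>.\<close>

lemma product_form:
  assumes "0 < n" "n \<le> N"
  shows "q^n / (1 - q^n)^2 * ((\<Prod>k=n+1..2*n. (1 + q^k) / (1 - q^k)) * (\<Prod>k=n+1..N. (1 + q^(2*k)) / (1 - q^(2*k))))
    = (\<Prod>k=1..N. (1 + q^(2*k)) / (1 - q^(2*k))) * (q^n * (qp (n-1))^2 * (op n / qp (2*n)))"
proof -
  define mp ev ed where "mp n = (\<Prod>k=1..n. 1 + q^k)" and "ev n = (\<Prod>k=1..n. 1 + q^(2*k))"
    and "ed n = (\<Prod>k=1..n. 1 - q^(2*k))" for n
  have mp2: "mp (2*n) = op n * ev n" for n
    by (induction n) (simp_all add: mp_def ev_def op_0 op_Suc ac_simps)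
  have qm: "qp n * mp n = ed n" for n
    unfolding qp_def mp_def ed_def prod.distrib[symmetric]
    by (rule prod.cong) (simp_all add: algebra_simps flip: power_add mult_2)
  have ed0: "ed n \<noteq> 0" for n
    unfolding ed_def using nz by (auto simp: prod_zero_iff)
  have mp0: "mp n \<noteq> 0" for n using qm[of n] ed0[of n] by auto
  have sp: "(\<Prod>k=1..m. f k) = (\<Prod>k=1..n. f k) * (\<Prod>k=n+1..m. f k)" if "n \<le> m" for f :: "nat \<Rightarrow> 'a" and m
  proof -
    have "{1..m} = {1..n} \<union> {n+1..m}" using that by auto
    then show ?thesis by (simp add: prod.union_disjoint)
  qed
  have "mp (2*n) = mp n * (\<Prod>k=n+1..2*n. 1 + q^k)" unfolding mp_def by (rule sp) simp
  moreover have "qp (2*n) = qp n * (\<Prod>k=n+1..2*n. 1 - q^k)" unfolding qp_def by (rule sp) simp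
  ultimately have e1: "(\<Prod>k=n+1..2*n. (1 + q^k) / (1 - q^k)) = (mp (2*n) / mp n) / (qp (2*n) / qp n)"
    using mp0 qp_nonzero by (simp add: prod_dividef)
  have e2: "(\<Prod>k=1..N. (1 + q^(2*k)) / (1 - q^(2*k))) = ev n / ed n * (\<Prod>k=n+1..N. (1 + q^(2*k)) / (1 - q^(2*k)))"
    unfolding sp[OF assms(2)] by (simp add: ev_def ed_def prod_dividef)
  have "qp n = qp (n-1) * (1 - q^n)" using assms(1) by (cases n) (simp_all add: qp_Suc)
  moreover have "1 - q^n \<noteq> 0" using nz[OF assms(1)] by simp
  ultimately have e3: "qp (n-1) = qp n / (1 - q^n)" by simp
  show ?thesis unfolding e1 e2 e3 mp2 qm[symmetric]
    using mp0[of n] qp_nonzero[of n] qp_nonzero[of "2*n"] \<open>1 - q^n \<noteq> 0\<close>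
    by (simp add: divide_simps power2_eq_square)
qed

text \<open>In this form every factor is 1 up to terms of order at least N - d + 1, so the quotient
  visibly tends to 1 as N grows.\<close>

lemma qp_quotient:
  assumes "d \<le> N"
  shows "(qp N)^2 * dd (int N - int d) (int N + int d) = (\<Prod>k=N-d+1..N. 1 - q^k) * (\<Prod>k=N+1..N+d. 1 / (1 - q^k))"
proof -
  have sp: "qp m = qp n * (\<Prod>k=n+1..m. 1 - q^k)" if "n \<le> m" for n m
  proof -
    have "{1..m} = {1..n} \<union> {n+1..m}" using that by auto
    then show ?thesis by (simp add: qp_def prod.union_disjoint)
  qed
  have "dd (int N - int d) (int N + int d) = 1 / (qp (N - d) * qp (N + d))"
    using dd_of_nat[of "N - d" "N + d"] assms by (simp add: of_nat_diff)
  moreover have "qp N = qp (N - d) * (\<Prod>k=N-d+1..N. 1 - q^k)" by (rule sp) simp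
  moreover have "qp (N + d) = qp N * (\<Prod>k=N+1..N+d. 1 - q^k)" by (rule sp) simp
  ultimately show ?thesis using qp_nonzero[of N] qp_nonzero[of "N - d"] qp_nonzero[of "N + d"]
    by (simp add: prod_dividef power2_eq_square)
qed

end

section \<open>Truncated products\<close>

text \<open>Division is only available in a field; the identities for fractions are transported along this embedding.\<close>

definition emb :: "int fps \<Rightarrow> rat fls" where
  "emb f = fps_to_fls (Abs_fps (\<lambda>n. of_int (fps_nth f n)))"

lemma emb_inj: "emb f = emb g \<longleftrightarrow> f = g"
  by (auto simp: emb_def fps_eq_iff)

lemma emb_1: "emb 1 = 1"
proof -
  have "Abs_fps (\<lambda>n. rat_of_int (fps_nth 1 n)) = 1" by (rule fps_ext) simp
  then show ?thesis by (simp add: emb_def)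
qed

lemma emb_add: "emb (f + g) = emb f + emb g" and emb_diff: "emb (f - g) = emb f - emb g"
  unfolding emb_def fps_to_fls_plus[symmetric] fps_to_fls_minus[symmetric] fps_to_fls_eq_iff
  by (rule fps_ext; simp)+

lemma emb_mult: "emb (f * g) = emb f * emb g"
  unfolding emb_def fls_times_fps_to_fls[symmetric] fps_to_fls_eq_iff
  by (rule fps_ext) (simp add: fps_mult_nth)

lemma emb_X: "emb fps_X = fls_X"
proof -
  have "Abs_fps (\<lambda>n. rat_of_int (fps_nth fps_X n)) = fps_X" by (rule fps_ext) simp
  then show ?thesis by (simp add: emb_def)
qed

lemma emb_power: "emb (f ^ n) = emb f ^ n"
  by (induction n) (simp_all add: emb_1 emb_mult)

lemma emb_0: "emb 0 = 0" using emb_diff[of 0 0] by simp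
lemma emb_uminus: "emb (- f) = - emb f" using emb_diff[of 0 f] by (simp add: emb_0)

lemma emb_sum: "emb (\<Sum>k\<in>K. f k) = (\<Sum>k\<in>K. emb (f k))"
  by (induction K rule: infinite_finite_induct) (simp_all add: emb_0 emb_add)

lemma emb_prod: "emb (\<Prod>k\<in>K. f k) = (\<Prod>k\<in>K. emb (f k))"
  by (induction K rule: infinite_finite_induct) (simp_all add: emb_1 emb_mult)

lemma fls_X_power_neq_1: "0 < k \<Longrightarrow> (fls_X :: rat fls) ^ k \<noteq> 1"
proof
  assume k: "0 < k" "(fls_X :: rat fls) ^ k = 1"
  then have "fls_nth ((fls_X :: rat fls) ^ k) 0 = fls_nth (1 :: rat fls) 0" by simp
  then show False using k(1) by simp
qed

text \<open>Coefficient forms, for k > 0, of 1 / (1 - q^k), (1 + q^k) / (1 - q^k), q^k / (1 - q^k)^2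
  and q^k / (1 - q^(2k)), in this order.\<close>

definition geo :: "nat \<Rightarrow> int fps" where "geo k = Abs_fps (\<lambda>i. if k dvd i then 1 else 0)"
definition ov :: "nat \<Rightarrow> int fps" where "ov k = Abs_fps (\<lambda>i. if k dvd i then (if i = 0 then 1 else 2) else 0)"
definition lagt :: "nat \<Rightarrow> int fps" where "lagt k = Abs_fps (\<lambda>i. if k dvd i then int (i div k) else 0)"
definition godd :: "nat \<Rightarrow> int fps" where "godd k = Abs_fps (\<lambda>i. if k dvd i \<and> odd (i div k) then 1 else 0)"

lemma geo_eq: "0 < k \<Longrightarrow> (1 - fps_X^k) * geo k = 1"
proof (rule fps_ext)
  fix i assume k: "0 < k"
  show "fps_nth ((1 - fps_X^k) * geo k) i = fps_nth 1 i"
  proof (cases "i < k")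
    case True
    then show ?thesis
      by (auto simp: geo_def algebra_simps fps_X_power_mult_nth dest: dvd_imp_le)
  next
    case False
    then obtain j where j: "i = j + k" by (metis add.commute le_Suc_ex not_less)
    show ?thesis using k
      by (simp add: geo_def algebra_simps fps_X_power_mult_nth j)
  qed
qed

lemma ov_eq: "0 < k \<Longrightarrow> (1 - fps_X^k) * ov k = 1 + fps_X^k"
proof -
  assume "0 < k"
  have "ov k = 2 * geo k - 1"
    by (rule fps_ext) (auto simp: ov_def geo_def fps_numeral_fps_const)
  then have "(1 - fps_X^k) * ov k = (1 - fps_X^k) * (2 * geo k - 1)" by simp
  also have "\<dots> = 2 * ((1 - fps_X^k) * geo k) - (1 - fps_X^k)"
    by (simp only: right_diff_distrib mult.left_commute mult_1_right)
  finally show ?thesis using geo_eq[OF \<open>0 < k\<close>] by simp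
qed

lemma lagt_eq1: "0 < k \<Longrightarrow> (1 - fps_X^k) * lagt k = geo k - 1"
proof (rule fps_ext)
  fix i assume k: "0 < k"
  show "fps_nth ((1 - fps_X^k) * lagt k) i = fps_nth (geo k - 1) i"
  proof (cases "i < k")
    case True
    then show ?thesis
      by (auto simp: lagt_def geo_def algebra_simps fps_X_power_mult_nth dest: dvd_imp_le)
  next
    case False
    then obtain j where j: "i = j + k" by (metis add.commute le_Suc_ex not_less)
    show ?thesis using k
      by (simp add: lagt_def geo_def algebra_simps fps_X_power_mult_nth j)
  qed
qed

lemma lagt_eq: "0 < k \<Longrightarrow> (1 - fps_X^k)^2 * lagt k = fps_X^k"
proof -
  assume k: "0 < k"
  have "(1 - fps_X^k)^2 * lagt k = (1 - fps_X^k) * ((1 - fps_X^k) * lagt k)"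
    by (simp only: power2_eq_square mult.assoc)
  also have "\<dots> = (1 - fps_X^k) * geo k - (1 - fps_X^k)"
    unfolding lagt_eq1[OF k] by (simp only: right_diff_distrib mult_1_right)
  also have "\<dots> = fps_X^k" unfolding geo_eq[OF k] by simp
  finally show ?thesis .
qed

lemma godd_eq: "0 < k \<Longrightarrow> (1 - fps_X^(2*k)) * godd k = fps_X^k"
proof (rule fps_ext)
  fix i assume k: "0 < k"
  show "fps_nth ((1 - fps_X^(2*k)) * godd k) i = fps_nth (fps_X^k :: int fps) i"
  proof (cases "i < 2*k")
    case True
    have "k dvd i \<and> odd (i div k) \<longleftrightarrow> i = k"
    proof
      assume *: "k dvd i \<and> odd (i div k)"
      then obtain c where c: "i = k * c" by blast
      with True k * have "c < 2" "odd c" by auto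
      then have "c = 1" by (cases c) auto
      then show "i = k" using c by simp
    qed (use k in simp)
    then show ?thesis using True
      by (simp add: godd_def algebra_simps fps_X_power_mult_nth)
  next
    case False
    then obtain j where j: "i = j + 2*k" by (metis add.commute le_Suc_ex not_less)
    have "(j + 2*k) div k = j div k + 2" "k dvd j + 2*k \<longleftrightarrow> k dvd j" using k by (simp_all add: dvd_add_left_iff)
    then show ?thesis using k
      by (simp add: godd_def algebra_simps fps_X_power_mult_nth j)
  qed
qed

lemma emb_frac: "0 < k \<Longrightarrow> emb (geo k) = 1 / (1 - fls_X^k)" "0 < k \<Longrightarrow> emb (ov k) = (1 + fls_X^k) / (1 - fls_X^k)"
  "0 < k \<Longrightarrow> emb (lagt k) = fls_X^k / (1 - fls_X^k)^2"
proof -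
  assume k: "0 < k"
  have n: "1 - (fls_X :: rat fls)^k \<noteq> 0" using fls_X_power_neq_1[OF k] by simp
  have "(1 - fls_X^k) * emb (geo k) = 1"
    using arg_cong[OF geo_eq[OF k], of emb] by (simp add: emb_mult emb_diff emb_1 emb_power emb_X)
  then show "emb (geo k) = 1 / (1 - fls_X^k)" using n by (simp add: nonzero_eq_divide_eq mult.commute)
  have "(1 - fls_X^k) * emb (ov k) = 1 + fls_X^k"
    using arg_cong[OF ov_eq[OF k], of emb] by (simp add: emb_mult emb_diff emb_add emb_1 emb_power emb_X)
  then show "emb (ov k) = (1 + fls_X^k) / (1 - fls_X^k)" using n by (simp add: nonzero_eq_divide_eq mult.commute)
  have "(1 - fls_X^k)^2 * emb (lagt k) = fls_X^k"
    using arg_cong[OF lagt_eq[OF k], of emb] by (simp add: emb_mult emb_diff emb_1 emb_power emb_X)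
  then show "emb (lagt k) = fls_X^k / (1 - fls_X^k)^2" using n by (simp add: nonzero_eq_divide_eq mult.commute)
qed

text \<open>The \<open>n\<close>-th summand of the generating function with the infinite product cut off at \<open>2N\<close>.\<close>

definition spt_term :: "nat \<Rightarrow> nat \<Rightarrow> int fps" where
  "spt_term N n = lagt n * ((\<Prod>k=n+1..2*n. ov k) * (\<Prod>k=n+1..N. ov (2*k)))"
definition cprod :: "nat \<Rightarrow> int fps" where "cprod N = (\<Prod>k=1..N. ov (2*k))"
text \<open>The quotient of \<open>qp_quotient\<close> with \<open>d = 2*r\<close>. The case
  distinction reproduces the vanishing of \<open>dd\<close>, which truncated subtraction would
  miss.\<close>

definition rfac :: "nat \<Rightarrow> nat \<Rightarrow> int fps" where
  "rfac N r = (if 2*r \<le> N then (\<Prod>k=N-2*r+1..N. 1 - fps_X^k) * (\<Prod>k=N+1..N+2*r. geo k) else 0)"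

lemma spt_term_identity:
  "(\<Sum>n=1..N. spt_term N n)
    = cprod N * ((\<Sum>n=1..N. lagt n) + 2 * (\<Sum>r=1..N. (-1)^r * fps_X^(2*r^2) * (lagt (2*r) * rfac N r)))"
proof -
  let ?q = "fls_X :: rat fls"
  have nz: "\<And>k. 0 < k \<Longrightarrow> ?q ^ k \<noteq> 1" by (rule fls_X_power_neq_1)
  have q0: "?q \<noteq> 0" by simp
  note fid = spt_finite_identity[of ?q N N, OF nz q0 order_refl]
  have T: "emb (spt_term N n) = emb (cprod N) * (?q^n * (qp ?q (n-1))^2 * (op ?q n / qp ?q (2*n)))"
    if "n \<in> {1..N}" for n
  proof -
    have n: "0 < n" "n \<le> N" using that by auto
    have a: "(\<Prod>k=n+1..2*n. emb (ov k)) = (\<Prod>k=n+1..2*n. (1 + ?q^k) / (1 - ?q^k))"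
      by (rule prod.cong) (auto simp: emb_frac)
    have b: "(\<Prod>k=n+1..N. emb (ov (2*k))) = (\<Prod>k=n+1..N. (1 + ?q^(2*k)) / (1 - ?q^(2*k)))"
      by (rule prod.cong) (auto simp: emb_frac)
    have c: "emb (cprod N) = (\<Prod>k=1..N. (1 + ?q^(2*k)) / (1 - ?q^(2*k)))"
      unfolding cprod_def emb_prod by (rule prod.cong) (auto simp: emb_frac)
    show ?thesis unfolding spt_term_def emb_mult emb_prod a b c emb_frac(3)[OF n(1)]
      by (rule product_form[OF nz q0 n])
  qed
  have R: "emb (rfac N r) = (qp ?q N)^2 * dd ?q (int N - int (2*r)) (int N + int (2*r))" for r
  proof (cases "2*r \<le> N")
    case True
    have "(\<Prod>k=N+1..N+2*r. emb (geo k)) = (\<Prod>k=N+1..N+2*r. 1 / (1 - ?q^k))"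
      by (rule prod.cong) (auto simp: emb_frac)
    then have "emb (rfac N r) = (\<Prod>k=N-2*r+1..N. 1 - ?q^k) * (\<Prod>k=N+1..N+2*r. 1 / (1 - ?q^k))"
      using True by (simp add: rfac_def emb_mult emb_prod emb_diff emb_1 emb_power emb_X)
    also have "\<dots> = (qp ?q N)^2 * dd ?q (int N - int (2*r)) (int N + int (2*r))"
      by (rule qp_quotient[OF nz q0 True, symmetric])
    finally show ?thesis .
  next
    case False
    then show ?thesis by (simp add: rfac_def emb_0 dd_def[OF nz q0])
  qed
  define A where "A = (\<Sum>n=1..N. ?q^n * (qp ?q (n-1))^2 * (op ?q n / qp ?q (2*n)))"
  define B where "B = (\<Sum>n=1..N. ?q^n / (1 - ?q^n)^2)"
  define C where "C = (\<Sum>r=1..N. (-1)^r * ?q^(2*r^2) * (?q^(2*r) / (1 - ?q^(2*r))^2 * ((qp ?q N)^2 * dd ?q (int N - int (2*r)) (int N + int (2*r)))))"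
  have A: "emb (\<Sum>n=1..N. spt_term N n) = emb (cprod N) * A"
    unfolding emb_sum A_def sum_distrib_left by (rule sum.cong) (simp_all only: T)
  have B: "emb (\<Sum>n=1..N. lagt n) = B"
    unfolding emb_sum B_def by (rule sum.cong) (auto simp: emb_frac)
  have C: "emb (\<Sum>r=1..N. (-1)^r * fps_X^(2*r^2) * (lagt (2*r) * rfac N r)) = C"
    unfolding emb_sum C_def
  proof (rule sum.cong)
    fix r assume "r \<in> {1..N}"
    then have r: "0 < 2*r" by simp
    have e: "emb (-1) = -1" by (simp only: emb_uminus emb_1)
    show "emb ((-1)^r * fps_X^(2*r^2) * (lagt (2*r) * rfac N r)) = (-1)^r * ?q^(2*r^2) * (?q^(2*r) / (1 - ?q^(2*r))^2 * ((qp ?q N)^2 * dd ?q (int N - int (2*r)) (int N + int (2*r))))"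
      by (simp only: emb_mult emb_power e emb_X R emb_frac(3)[OF r])
  qed simp
  have two: "emb 2 = 2" using emb_add[of 1 1] by (simp add: emb_1)
  have "A = B + 2 * C" unfolding A_def B_def C_def by (rule fid)
  then have "emb (\<Sum>n=1..N. spt_term N n) = emb (cprod N * ((\<Sum>n=1..N. lagt n) + 2 * (\<Sum>r=1..N. (-1)^r * fps_X^(2*r^2) * (lagt (2*r) * rfac N r))))"
    by (simp only: A B C emb_mult emb_add two)
  then show ?thesis by (simp only: emb_inj)
qed

text \<open>Agreement up to a given order is treated as divisibility by a power of
  \<open>fps_X\<close>, so that limits of sums and products reduce to congruence arithmetic.\<close>

lemma X_power_dvd_iff: "fps_X^m dvd (f :: int fps) \<longleftrightarrow> (\<forall>i<m. fps_nth f i = 0)"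
proof
  assume "fps_X^m dvd f"
  then obtain g where "f = fps_X^m * g" by blast
  then show "\<forall>i<m. fps_nth f i = 0" by (simp add: fps_X_power_mult_nth)
next
  assume *: "\<forall>i<m. fps_nth f i = 0"
  have "f = fps_X^m * Abs_fps (\<lambda>i. fps_nth f (i + m))"
    by (rule fps_ext) (use * in \<open>simp add: fps_X_power_mult_nth\<close>)
  then show "fps_X^m dvd f" by (rule dvdI)
qed

lemma X_power_dvd_prod:
  assumes "\<And>k. k \<in> K \<Longrightarrow> fps_X^m dvd f k - (1 :: int fps)"
  shows "fps_X^m dvd (\<Prod>k\<in>K. f k) - 1"
  using assms
proof (induction K rule: infinite_finite_induct)
  case (insert k K)
  have "(\<Prod>k\<in>insert k K. f k) - 1 = f k * ((\<Prod>k\<in>K. f k) - 1) + (f k - 1)"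
    using insert by (simp add: algebra_simps)
  moreover have "fps_X^m dvd (\<Prod>k\<in>K. f k) - 1" "fps_X^m dvd f k - 1" using insert by auto
  ultimately show ?case by (simp only: dvd_add dvd_mult)
qed simp_all

text \<open>Order count: \<open>lagt (2*r)\<close> starts in degree 2r and
  \<open>rfac N r - 1\<close> in degree at least N - 2r + 1. For 2r > N the factor
  \<open>lagt (2*r)\<close> already has order N + 1.\<close>

lemma rfac_cong:
  assumes "0 < r"
  shows "fps_X^(N+1) dvd fps_X^(2*r^2) * (lagt (2*r) * (rfac N r - 1))"
proof -
  have l: "fps_X^(2*r) dvd lagt (2*r)"
    unfolding X_power_dvd_iff using assms by (auto simp: lagt_def dest: dvd_imp_le)
  have le: "fps_X^a dvd (fps_X^b :: int fps)" if "a \<le> b" for a b using that by (rule le_imp_power_dvd)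
  have rr: "r \<le> r^2" by (simp add: power2_eq_square)
  show ?thesis
  proof (cases "2*r \<le> N")
    case True
    let ?m = "N - 2*r + 1"
    have 1: "fps_X^?m dvd (\<Prod>k=N-2*r+1..N. 1 - fps_X^k :: int fps) - 1"
    proof (rule X_power_dvd_prod)
      fix k assume "k \<in> {N-2*r+1..N}"
      then have "fps_X^?m dvd - (fps_X^k :: int fps)" by (simp only: dvd_minus_iff) (rule le, simp)
      moreover have "1 - fps_X^k - 1 = - (fps_X^k :: int fps)" by simp
      ultimately show "fps_X^?m dvd 1 - fps_X^k - (1 :: int fps)" by (simp only:)
    qed
    have 2: "fps_X^?m dvd (\<Prod>k=N+1..N+2*r. geo k) - 1"
    proof (rule X_power_dvd_prod)
      fix k assume k: "k \<in> {N+1..N+2*r}"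
      have g: "geo k - 1 = fps_X^k * geo k" using geo_eq[of k] k by (simp add: algebra_simps)
      have "N + 1 \<le> k" using k by simp
      then have "?m \<le> k" by arith
      then have "fps_X^?m dvd (fps_X^k :: int fps)" by (rule le)
      then show "fps_X^?m dvd geo k - 1" unfolding g by (rule dvd_mult2)
    qed
    have e: "rfac N r - 1 = (\<Prod>k=N-2*r+1..N. 1 - fps_X^k) * ((\<Prod>k=N+1..N+2*r. geo k) - 1) + ((\<Prod>k=N-2*r+1..N. 1 - fps_X^k) - 1)"
      using True by (simp add: rfac_def algebra_simps)
    have "fps_X^?m dvd rfac N r - 1" unfolding e by (rule dvd_add[OF dvd_mult[OF 2] 1])
    then have "fps_X^(2*r^2) * (fps_X^(2*r) * fps_X^?m) dvd fps_X^(2*r^2) * (lagt (2*r) * (rfac N r - 1))"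
      by (intro mult_dvd_mono dvd_refl l)
    moreover have "fps_X^(N+1) dvd (fps_X^(2*r^2) * (fps_X^(2*r) * fps_X^?m) :: int fps)"
      unfolding power_add[symmetric] using True by (intro le) simp
    ultimately show ?thesis by (rule dvd_trans[rotated])
  next
    case False
    have "fps_X^(2*r^2) * fps_X^(2*r) dvd fps_X^(2*r^2) * (lagt (2*r) * (rfac N r - 1))"
      by (intro mult_dvd_mono dvd_refl dvd_mult2 l)
    moreover have "fps_X^(N+1) dvd (fps_X^(2*r^2) * fps_X^(2*r) :: int fps)"
      unfolding power_add[symmetric] using False rr by (intro le) simp
    ultimately show ?thesis by (rule dvd_trans[rotated])
  qed
qed

section \<open>The generating function up to a given order\<close>

lemma sum_lagt_nth:
  assumes "i \<le> N"
  shows "fps_nth (\<Sum>n=1..N. lagt n) i = fps_nth (lam 1) i"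
proof (cases "i = 0")
  case True
  have "fps_nth (lam 1) 0 = 0"
    unfolding lam_def qseries_nth by (rule sum.neutral) (auto simp: pos2_def)
  then show ?thesis using True by (simp add: fps_sum_nth lagt_def)
next
  case False
  have "fps_nth (\<Sum>n=1..N. lagt n) i = (\<Sum>n\<in>{1..N}. if n dvd i then int (i div n) else 0)"
    by (simp add: fps_sum_nth lagt_def)
  also have "\<dots> = (\<Sum>n | n \<in> {1..N} \<and> n dvd i. int (i div n))"
    by (rule sum.inter_filter[symmetric]) simp
  also have "\<dots> = (\<Sum>x | x \<in> pos2 \<and> (case x of (a,k) \<Rightarrow> a * k) = int i. case x of (a,k) \<Rightarrow> a^1)"
  proof (rule sum.reindex_bij_witness[where j="\<lambda>n. (int (i div n), int n)" and i="\<lambda>(a,k). nat k"])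
    fix n assume n: "n \<in> {n \<in> {1..N}. n dvd i}"
    then have e: "i div n * n = i" by simp
    then have "i div n \<noteq> 0" using False by (metis mult_0)
    moreover have "int (i div n) * int n = int i" using e by (metis of_nat_mult)
    ultimately show "(int (i div n), int n) \<in> {x. x \<in> pos2 \<and> (case x of (a,k) \<Rightarrow> a * k) = int i}"
      using n by (simp add: pos2_def)
  next
    fix x assume x: "x \<in> {x. x \<in> pos2 \<and> (case x of (a,k) \<Rightarrow> a * k) = int i}"
    then obtain a k where ak: "x = (a,k)" "1 \<le> a" "1 \<le> k" "a * k = int i" by (auto simp: pos2_def)
    define a' k' where "a' = nat a" and "k' = nat k"
    have z: "a = int a'" "k = int k'" using ak by (simp_all add: a'_def k'_def)
    with ak have nat: "a' * k' = i" "1 \<le> a'" "1 \<le> k'" by (simp_all flip: of_nat_mult)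
    then have "k' \<le> i" by auto
    then show "(case x of (a,k) \<Rightarrow> nat k) \<in> {n \<in> {1..N}. n dvd i}"
      "(int (i div (case x of (a,k) \<Rightarrow> nat k)), int (case x of (a,k) \<Rightarrow> nat k)) = x"
      using nat assms by (auto simp: ak(1) z)
  qed auto
  finally show ?thesis by (simp add: lam_def qseries_nth)
qed

lemma dilate_lam_odd_nth:
  assumes "i \<le> N"
  shows "fps_nth (\<Sum>k=1..N. of_nat k * godd (2*k)) i = fps_nth (dilate (lam_odd 1)) i"
proof -
  have "fps_nth (\<Sum>k=1..N. of_nat k * godd (2*k)) i = (\<Sum>k\<in>{1..N}. if 2*k dvd i \<and> odd (i div (2*k)) then int k else 0)"
    by (simp add: fps_sum_nth godd_def fps_of_nat[symmetric] if_distrib cong: if_cong)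
  also have "\<dots> = (\<Sum>k | k \<in> {1..N} \<and> (2*k dvd i \<and> odd (i div (2*k))). int k)"
    by (rule sum.inter_filter[symmetric]) simp
  also have "\<dots> = (\<Sum>x | x \<in> podd \<and> 2 * (case x of (a,k) \<Rightarrow> a * k) = int i. case x of (a,k) \<Rightarrow> a^1)"
  proof (rule sum.reindex_bij_witness[where j="\<lambda>k. (int k, int (i div (2*k)))" and i="\<lambda>(a,k). nat a"])
    fix n assume n: "n \<in> {k \<in> {1..N}. 2*k dvd i \<and> odd (i div (2*k))}"
    then have e: "2 * (n * (i div (2*n))) = i" by (simp add: mult.assoc[symmetric])
    have "2 * (int n * int (i div (2*n))) = int i" by (subst e[symmetric]) (simp only: of_nat_mult of_nat_numeral)
    moreover have "0 < i div (2*n)" using n by (auto intro: odd_pos)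
    ultimately show "(int n, int (i div (2*n))) \<in> {x. x \<in> podd \<and> 2 * (case x of (a,k) \<Rightarrow> a * k) = int i}"
      using n by (simp add: podd_def)
  next
    fix x assume x: "x \<in> {x. x \<in> podd \<and> 2 * (case x of (a,k) \<Rightarrow> a * k) = int i}"
    then obtain a k where ak: "x = (a,k)" "1 \<le> a" "1 \<le> k" "odd k" "2 * (a * k) = int i" by (auto simp: podd_def)
    define a' k' where "a' = nat a" and "k' = nat k"
    have z: "a = int a'" "k = int k'" using ak by (simp_all add: a'_def k'_def)
    have "int (2 * (a' * k')) = int i" using ak(5) by (simp add: z)
    then have "2 * (a' * k') = i" by (simp only: of_nat_eq_iff)
    then have nat: "i = 2 * a' * k'" "1 \<le> a'" "1 \<le> k'" "odd k'" using ak z by simp_all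
    then have "a' \<le> i" by auto
    then have "a' \<le> N" using assms by simp
    then show "(case x of (a,k) \<Rightarrow> nat a) \<in> {k \<in> {1..N}. 2*k dvd i \<and> odd (i div (2*k))}"
      "(int (case x of (a,k) \<Rightarrow> nat a), int (i div (2 * (case x of (a,k) \<Rightarrow> nat a)))) = x"
      using nat assms by (auto simp: ak(1) z)
  qed auto
  finally show ?thesis by (simp add: lam_odd_def dilate_qseries qseries_nth)
qed

lemma dilate_appell_nth:
  assumes "i \<le> N"
  shows "fps_nth (2 * (\<Sum>r=1..N. (-1)^r * fps_X^(2*r^2) * lagt (2*r))) i = fps_nth (dilate (appell 1)) i"
proof -
  have s: "(-1)^r * f = of_int (sg (int r)) * (f :: int fps)" for r f
    by (simp add: sg_def)
  have c: "fps_nth (2 * f) i = 2 * fps_nth f i" for f :: "int fps"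
    by (simp only: fps_numeral_fps_const fps_mult_left_const_nth)
  \<comment> \<open>The inequality is strict because \<open>lagt\<close> has constant term 0; it
    corresponds to m \<ge> 1 in \<open>pos2\<close>.\<close>
  let ?P = "\<lambda>r. 2*r^2 < i \<and> 2*r dvd i - 2*r^2"
  let ?m = "\<lambda>r. int ((i - 2*r^2) div (2*r))"
  have t: "fps_nth ((-1)^r * fps_X^(2*r^2) * lagt (2*r)) i = (if ?P r then sg (int r) * ?m r else 0)" for r
    unfolding mult.assoc s fps_of_int[symmetric] fps_mult_left_const_nth fps_X_power_mult_nth
    by (auto simp: lagt_def)
  have "fps_nth (2 * (\<Sum>r=1..N. (-1)^r * fps_X^(2*r^2) * lagt (2*r))) i
     = (\<Sum>r\<in>{1..N}. if ?P r then 2 * sg (int r) * ?m r else 0)"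
    unfolding c fps_sum_nth t sum_distrib_left by (rule sum.cong) auto
  also have "\<dots> = (\<Sum>r | r \<in> {1..N} \<and> ?P r. 2 * sg (int r) * ?m r)"
    by (rule sum.inter_filter[symmetric]) simp
  also have "\<dots> = (\<Sum>x | x \<in> pos2 \<and> 2 * (case x of (m,n) \<Rightarrow> n^2 + m * n) = int i. case x of (m,n) \<Rightarrow> 2 * sg n * m^1)"
  proof (rule sum.reindex_bij_witness[where j="\<lambda>r. (?m r, int r)" and i="\<lambda>(m,n). nat n"])
    fix r assume r: "r \<in> {r \<in> {1..N}. ?P r}"
    then obtain m where m: "i - 2*r^2 = 2*r*m" by blast
    moreover have "2*r^2 < i" using r by simp
    ultimately have "i = 2*r^2 + 2*r*m" by linarith
    then have i: "i = 2 * (r^2 + m * r)" by (simp add: ac_simps)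
    have "0 < m" using m r by (cases m) auto
    moreover have "?m r = int m" using m r by simp
    ultimately show "(?m r, int r) \<in> {x. x \<in> pos2 \<and> 2 * (case x of (m,n) \<Rightarrow> n^2 + m * n) = int i}"
      using r i by (simp add: pos2_def)
  next
    fix x assume x: "x \<in> {x. x \<in> pos2 \<and> 2 * (case x of (m,n) \<Rightarrow> n^2 + m * n) = int i}"
    then obtain m n where mn: "x = (m,n)" "1 \<le> m" "1 \<le> n" "2 * (n^2 + m * n) = int i" by (auto simp: pos2_def)
    define m' n' where "m' = nat m" and "n' = nat n"
    have z: "m = int m'" "n = int n'" using mn by (simp_all add: m'_def n'_def)
    have "int (2 * (n'^2 + m' * n')) = int i" using mn(4) by (simp add: z)
    then have "i = 2 * (n'^2 + m' * n')" by (simp only: of_nat_eq_iff)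
    then have nat: "i = 2*n'^2 + 2*n'*m'" "0 < m'" "0 < n'" using mn z by simp_all
    then have "n' \<le> n' * m'" by simp
    with nat have le: "n' \<le> i" by linarith
    have d: "i - 2*n'^2 = 2*n'*m'" using nat(1) by simp
    have "n' \<in> {1..N}" "?P n'" using nat le assms by simp_all
    moreover have "?m n' = int m'" unfolding d using nat(3) by simp
    ultimately show "(case x of (m,n) \<Rightarrow> nat n) \<in> {r \<in> {1..N}. ?P r}"
      "(?m (case x of (m,n) \<Rightarrow> nat n), int (case x of (m,n) \<Rightarrow> nat n)) = x"
      by (simp_all add: mn(1) z)
  qed auto
  finally show ?thesis by (simp add: appell_def dilate_qseries qseries_nth)
qed

lemma spt_term_cong:
  "fps_X^(N+1) dvd (\<Sum>n=1..N. spt_term N n) - cprod N * (lam 1 + dilate (appell 1))"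
proof -
  let ?X = "fps_X^(N+1) :: int fps"
  define S T where "S = (\<Sum>r=1..N. (-1)^r * fps_X^(2*r^2) * (lagt (2*r) * rfac N r))"
    and "T = (\<Sum>r=1..N. (-1)^r * fps_X^(2*r^2) * lagt (2*r))"
  have "?X dvd (-1)^r * (fps_X^(2*r^2) * (lagt (2*r) * (rfac N r - 1)))" if "r \<in> {1..N}" for r
    by (rule dvd_mult, rule rfac_cong) (use that in simp)
  then have "?X dvd (\<Sum>r=1..N. (-1)^r * (fps_X^(2*r^2) * (lagt (2*r) * (rfac N r - 1))))"
    by (rule dvd_sum)
  also have "(\<Sum>r=1..N. (-1)^r * (fps_X^(2*r^2) * (lagt (2*r) * (rfac N r - 1)))) = S - T"
    unfolding S_def T_def sum_subtractf[symmetric]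
    by (rule sum.cong) (simp_all only: right_diff_distrib mult.assoc mult_1_right)
  finally have ST: "?X dvd 2 * (S - T)" by (rule dvd_mult)
  have T: "?X dvd 2 * T - dilate (appell 1)" unfolding X_power_dvd_iff
    using dilate_appell_nth[of _ N, folded T_def] by (simp only: fps_sub_nth less_Suc_eq_le Suc_eq_plus1[symmetric]) simp
  have L: "?X dvd (\<Sum>n=1..N. lagt n) - lam 1" unfolding X_power_dvd_iff
    using sum_lagt_nth[of _ N] by (simp only: fps_sub_nth less_Suc_eq_le Suc_eq_plus1[symmetric]) simp
  have "(\<Sum>n=1..N. spt_term N n) - cprod N * (lam 1 + dilate (appell 1))
    = cprod N * ((((\<Sum>n=1..N. lagt n) - lam 1) + 2 * (S - T)) + (2 * T - dilate (appell 1)))"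
    unfolding spt_term_identity S_def[symmetric] by (simp add: algebra_simps)
  then show ?thesis using L ST T by (simp only: dvd_mult dvd_add)
qed

lemma qD_X_power: "qD (fps_X^j) = of_nat j * fps_X^j"
  by (rule fps_ext) (simp add: qD_nth fps_of_nat[symmetric])

text \<open>With x = q^j the logarithmic derivative of (1 + x) / (1 - x) is 2 j x / (1 - x^2); the
  proof clears the denominator (1 - x)^2.\<close>

lemma qD_ov:
  assumes "0 < j"
  shows "qD (ov j) = ov j * (2 * of_nat j * godd j)"
proof -
  let ?x = "fps_X^j :: int fps" and ?j = "of_nat j :: int fps"
  have "(1 - x) * (1 + x) = 1 - x * x" for x :: "int fps" by (simp add: algebra_simps)
  then have X2: "(1 - ?x) * (1 + ?x) = 1 - fps_X^(2*j)" by (simp only: mult_2 power_add)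
  have "fps_nth (1 - ?x) 0 = 1" using assms by simp
  then have nz: "1 - ?x \<noteq> 0" by force
  have "(1 - ?x) * qD (ov j) = qD ((1 - ?x) * ov j) + ?j * ?x * ov j"
    by (simp add: qD_mult qD_diff qD_X_power algebra_simps)
  also have "qD ((1 - ?x) * ov j) = ?j * ?x"
    unfolding ov_eq[OF assms] by (simp add: qD_add qD_X_power)
  finally have 1: "(1 - ?x) * qD (ov j) = ?j * ?x + ?j * ?x * ov j" .
  have "(1 - ?x) * ((1 - ?x) * qD (ov j)) = ?j * ?x * (1 - ?x) + ?j * ?x * ((1 - ?x) * ov j)"
    unfolding 1 by (simp only: distrib_left ac_simps)
  also have "\<dots> = 2 * ?j * ?x" unfolding ov_eq[OF assms] by (simp add: algebra_simps)
  also have "\<dots> = 2 * ?j * (((1 - ?x) * (1 + ?x)) * godd j)" unfolding X2 godd_eq[OF assms] ..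
  also have "\<dots> = (1 - ?x) * (((1 - ?x) * ov j) * (2 * ?j * godd j))"
    unfolding ov_eq[OF assms] by (simp only: ac_simps)
  also have "\<dots> = (1 - ?x) * ((1 - ?x) * (ov j * (2 * ?j * godd j)))" by (simp only: mult.assoc)
  finally show ?thesis using nz by (simp only: mult_cancel_left simp_thms)
qed

lemma qD_cprod: "qD (cprod N) = cprod N * (4 * (\<Sum>k=1..N. of_nat k * godd (2*k)))"
proof (induction N)
  case (Suc N)
  have c: "cprod (Suc N) = cprod N * ov (2 * Suc N)" by (simp add: cprod_def)
  have d: "2 * of_nat (2 * Suc N) * godd (2 * Suc N) = 4 * (of_nat (Suc N) * godd (2 * Suc N))"
    unfolding of_nat_mult by (simp only: mult.assoc of_nat_numeral) simp
  have s: "(\<Sum>k=1..Suc N. of_nat k * godd (2*k)) = (\<Sum>k=1..N. of_nat k * godd (2*k)) + of_nat (Suc N) * godd (2 * Suc N)"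
    by (rule sum.cl_ivl_Suc[THEN trans]) simp
  have o: "qD (ov (2 * Suc N)) = ov (2 * Suc N) * (4 * (of_nat (Suc N) * godd (2 * Suc N)))"
    unfolding d[symmetric] by (rule qD_ov) simp
  show ?case unfolding s unfolding c qD_mult Suc o by (simp only: distrib_left ac_simps)
qed (simp add: cprod_def)

text \<open>The logarithmic derivatives of the two factors cancel up to order N, so
  \<open>qD\<close> of the product vanishes there, which forces its coefficients in degrees 1 to N
  to be 0. In the limit this is Gauss's product for theta at q^2.\<close>

lemma cprod_theta: "fps_X^(N+1) dvd cprod N * dilate (theta4 0) - 1"
proof -
  let ?Y = "cprod N * dilate (theta4 0)" and ?G = "\<Sum>k=1..N. of_nat k * godd (2*k)"
  have "qD (dilate (theta4 0)) = dilate (2 * theta4 2)" by (simp add: qD_dilate qD_theta4_0 dilate_mult dilate_numeral)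
  also have "2 * theta4 2 = - (4 * (theta4 0 * lam_odd 1))" unfolding theta4_2 by simp
  also have "dilate \<dots> = - (4 * (dilate (theta4 0) * dilate (lam_odd 1)))"
    using dilate_diff[of 0] by (simp add: dilate_mult dilate_numeral) (simp add: dilate_def)
  finally have "qD ?Y = ?Y * (4 * (?G - dilate (lam_odd 1)))"
    by (simp add: qD_mult qD_cprod algebra_simps)
  moreover have "fps_X^(N+1) dvd ?G - dilate (lam_odd 1)" unfolding X_power_dvd_iff
    using dilate_lam_odd_nth[of _ N] by (simp only: fps_sub_nth less_Suc_eq_le Suc_eq_plus1[symmetric]) simp
  ultimately have "fps_X^(N+1) dvd qD ?Y" by (simp only: dvd_mult)
  then have z: "fps_nth ?Y i = 0" if "0 < i" "i < N + 1" for i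
    using that unfolding X_power_dvd_iff qD_nth by force
  have "fps_nth (cprod N) 0 = 1"
    by (induction N) (simp_all add: cprod_def ov_def)
  then have "fps_nth ?Y 0 = 1" by (simp add: dilate_nth theta4_0_nth_0)
  then show ?thesis unfolding X_power_dvd_iff using z by (simp add: fps_one_nth)
qed

lemma theta_times_series:
  assumes F: "\<And>N i. i \<le> N \<Longrightarrow> fps_nth F i = fps_nth (\<Sum>n=1..N. spt_term N n) i"
  shows "dilate (theta4 0) * F = lam 1 + dilate (appell 1)"
proof (rule fps_ext)
  fix N
  define R S where "R = lam 1 + dilate (appell 1)" and "S = (\<Sum>n=1..N. spt_term N n)"
  have "fps_X^(N+1) dvd F - S" unfolding X_power_dvd_iff S_def using F[of _ N] by simp
  moreover have "fps_X^(N+1) dvd S - cprod N * R" unfolding S_def R_def by (rule spt_term_cong)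
  moreover have "dilate (theta4 0) * F - R
      = dilate (theta4 0) * (F - S) + (dilate (theta4 0) * (S - cprod N * R) + (cprod N * dilate (theta4 0) - 1) * R)"
    by (simp add: algebra_simps)
  ultimately have "fps_X^(N+1) dvd dilate (theta4 0) * F - R"
    using cprod_theta[of N] by (simp only: dvd_add dvd_mult dvd_mult2)
  then have "fps_nth (dilate (theta4 0) * F - R) N = 0" unfolding X_power_dvd_iff by simp
  then show "fps_nth (dilate (theta4 0) * F) N = fps_nth (lam 1 + dilate (appell 1)) N" by (simp add: R_def)
qed

section \<open>Multisets and the generating function\<close>

definition bounded_msets :: "nat set \<Rightarrow> nat \<Rightarrow> nat multiset set" where
  "bounded_msets K i = {M. set_mset M \<subseteq> K \<and> sum_mset M = i}"

lemma size_le_sum_mset: "0 \<notin># M \<Longrightarrow> size M \<le> sum_mset (M :: nat multiset)"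
  by (induction M) auto

lemma member_le_sum_mset: "k \<in># M \<Longrightarrow> k \<le> sum_mset (M :: nat multiset)"
  by (auto dest!: multi_member_split)

lemma finite_bounded_msets:
  assumes "finite K" "0 \<notin> K"
  shows "finite (bounded_msets K i)"
proof (rule finite_subset)
  show "bounded_msets K i \<subseteq> mset ` {xs. set xs \<subseteq> K \<and> length xs \<le> i}"
  proof
    fix M assume M: "M \<in> bounded_msets K i"
    obtain xs where xs: "M = mset xs" by (metis ex_mset)
    have "size M \<le> i" using size_le_sum_mset[of M] M assms(2) by (auto simp: bounded_msets_def)
    then have "xs \<in> {xs. set xs \<subseteq> K \<and> length xs \<le> i}" using M xs by (auto simp: bounded_msets_def)
    then show "M \<in> mset ` {xs. set xs \<subseteq> K \<and> length xs \<le> i}" using xs by blast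
  qed
  show "finite (mset ` {xs. set xs \<subseteq> K \<and> length xs \<le> i})"
    using finite_lists_length_le[OF assms(1)] by simp
qed

definition part_series :: "nat \<Rightarrow> (nat \<Rightarrow> int) \<Rightarrow> int fps" where
  "part_series k w = Abs_fps (\<lambda>i. if k dvd i then w (i div k) else 0)"

text \<open>Expanding the product chooses a multiplicity for each part size; the induction separates
  the copies of one part from the rest of the multiset.\<close>

lemma prod_part_series_nth:
  assumes "finite K" "0 \<notin> K"
  shows "fps_nth (\<Prod>k\<in>K. part_series k (w k)) i = (\<Sum>M\<in>bounded_msets K i. \<Prod>k\<in>K. w k (count M k))"
  using assms
proof (induction K arbitrary: i rule: finite_induct)
  case empty
  have "bounded_msets {} i = (if i = 0 then {{#}} else {})" by (auto simp: bounded_msets_def)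
  then show ?case by simp
next
  case (insert k K)
  have k: "0 < k" "0 \<notin> K" using insert.prems by auto
  have fin: "finite (bounded_msets K j)" for j using finite_bounded_msets insert.hyps(1) k(2) .
  let ?s = "\<lambda>M. \<Prod>x\<in>K. w x (count M x)"
  have "fps_nth (\<Prod>x\<in>insert k K. part_series x (w x)) i
      = fps_nth (part_series k (w k) * (\<Prod>x\<in>K. part_series x (w x))) i"
    using insert.hyps by simp
  also have "\<dots> = (\<Sum>j\<in>{0..i}. (if k dvd j then w k (j div k) else 0) * (\<Sum>M\<in>bounded_msets K (i - j). ?s M))"
    unfolding fps_mult_nth insert.IH[OF k(2)] by (simp add: part_series_def)
  also have "\<dots> = (\<Sum>j\<in>{0..i}. if k dvd j then (\<Sum>M\<in>bounded_msets K (i - j). w k (j div k) * ?s M) else 0)"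
    by (rule sum.cong) (auto simp: sum_distrib_left)
  also have "\<dots> = (\<Sum>j | j \<in> {0..i} \<and> k dvd j. \<Sum>M\<in>bounded_msets K (i - j). w k (j div k) * ?s M)"
    by (rule sum.inter_filter[symmetric]) simp
  also have "\<dots> = (\<Sum>(j,M)\<in>(SIGMA j:{j \<in> {0..i}. k dvd j}. bounded_msets K (i - j)). w k (j div k) * ?s M)"
    by (rule sum.Sigma) (use fin in auto)
  also have "\<dots> = (\<Sum>M\<in>bounded_msets (insert k K) i. \<Prod>x\<in>insert k K. w x (count M x))"
  proof (rule sum.reindex_bij_witness[where j="\<lambda>(j,M). M + replicate_mset (j div k) k"
        and i="\<lambda>M. (k * count M k, filter_mset (\<lambda>x. x \<noteq> k) M)"])
    fix x assume "x \<in> (SIGMA j:{j \<in> {0..i}. k dvd j}. bounded_msets K (i - j))"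
    then obtain j M where x: "x = (j,M)" "j \<le> i" "k dvd j" "set_mset M \<subseteq> K" "sum_mset M = i - j"
      by (auto simp: bounded_msets_def)
    have kM: "k \<notin># M" using x(4) insert.hyps(2) by auto
    then have c: "count M k = 0" by (simp add: not_in_iff)
    have f: "filter_mset (\<lambda>x. x \<noteq> k) M = M" using kM by (auto simp: filter_mset_eq_conv)
    have f2: "filter_mset (\<lambda>x. x \<noteq> k) (replicate_mset n k) = {#}" for n by (induction n) auto
    show "(\<lambda>M. (k * count M k, filter_mset (\<lambda>x. x \<noteq> k) M)) ((\<lambda>(j,M). M + replicate_mset (j div k) k) x) = x"
      using x(3) by (simp add: x(1) c f f2)
    show "(\<lambda>(j,M). M + replicate_mset (j div k) k) x \<in> bounded_msets (insert k K) i"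
      using x by (auto simp: bounded_msets_def)
    have "\<And>y. y \<in> K \<Longrightarrow> y \<noteq> k" using insert.hyps(2) by auto
    then have "(\<Prod>y\<in>K. w y (count (M + replicate_mset (j div k) k) y)) = ?s M"
      by (intro prod.cong) auto
    then show "(\<Prod>y\<in>insert k K. w y (count ((\<lambda>(j,M). M + replicate_mset (j div k) k) x) y))
      = (case x of (j,M) \<Rightarrow> w k (j div k) * ?s M)"
      using insert.hyps c by (simp add: x(1))
  next
    fix M assume M: "M \<in> bounded_msets (insert k K) i"
    have d: "M = filter_mset (\<lambda>x. x \<noteq> k) M + replicate_mset (count M k) k"
      by (rule multiset_eqI) auto
    then show "(\<lambda>(j,M). M + replicate_mset (j div k) k) (k * count M k, filter_mset (\<lambda>x. x \<noteq> k) M) = M"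
      using k(1) by simp
    have "sum_mset M = sum_mset (filter_mset (\<lambda>x. x \<noteq> k) M) + k * count M k"
      by (subst d) (simp only: sum_mset.union sum_mset_replicate_mset of_nat_id mult.commute)
    moreover have "sum_mset M = i" using M by (simp add: bounded_msets_def)
    ultimately have "k * count M k \<le> i" "sum_mset (filter_mset (\<lambda>x. x \<noteq> k) M) = i - k * count M k" by linarith+
    then show "(k * count M k, filter_mset (\<lambda>x. x \<noteq> k) M) \<in> (SIGMA j:{j \<in> {0..i}. k dvd j}. bounded_msets K (i - j))"
      using M by (auto simp: bounded_msets_def)
  qed
  finally show ?case .
qed

text \<open>The part sizes allowed above a smallest part \<open>n\<close>: up to 2n every size,
  beyond 2n only even ones, which encodes that odd parts stay below 2n. The truncation
  \<open>N\<close> bounds half of the even size.\<close>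

definition spt_parts :: "nat \<Rightarrow> nat \<Rightarrow> nat set" where
  "spt_parts N n = {n+1..2*n} \<union> (\<lambda>k. 2*k) ` {n+1..N}"

lemma spt_parts_greater: "k \<in> spt_parts N n \<Longrightarrow> n < k" and finite_spt_parts: "finite (spt_parts N n)"
  by (auto simp: spt_parts_def)

text \<open>A larger part size that occurs may be overlined or not, giving the coefficient 2 in
  \<open>ov\<close>. The smallest part is always overlined and counted by multiplicity, which is the
  weight in \<open>lagt\<close>; multisets without \<open>n\<close> receive weight 0.\<close>

lemma spt_term_nth:
  assumes "0 < n"
  shows "fps_nth (spt_term N n) i = (\<Sum>M\<in>bounded_msets (insert n (spt_parts N n)) i.
    int (count M n) * 2 ^ card {k \<in> spt_parts N n. k \<in># M})"
proof -
  let ?K = "spt_parts N n"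
  define w :: "nat \<Rightarrow> nat \<Rightarrow> int" where "w k c = (if k = n then int c else if c = 0 then 1 else 2)" for k c
  have nK: "n \<notin> ?K" "0 \<notin> insert n ?K" using spt_parts_greater assms by force+
  have l: "part_series n (w n) = lagt n"
    by (rule fps_ext) (simp add: part_series_def w_def lagt_def)
  have o: "part_series k (w k) = ov k" if "k \<in> ?K" for k
  proof -
    have "k \<noteq> n" "0 < k" using spt_parts_greater[OF that] by auto
    then show ?thesis by (intro fps_ext) (auto simp: part_series_def w_def ov_def dest: dvd_imp_le)
  qed
  have "spt_term N n = lagt n * (\<Prod>k\<in>?K. ov k)"
  proof -
    have "(\<Prod>k\<in>?K. ov k) = (\<Prod>k\<in>{n+1..2*n}. ov k) * (\<Prod>k\<in>(\<lambda>k. 2*k) ` {n+1..N}. ov k)"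
      unfolding spt_parts_def by (rule prod.union_disjoint) auto
    also have "(\<Prod>k\<in>(\<lambda>k. 2*k) ` {n+1..N}. ov k) = (\<Prod>k\<in>{n+1..N}. ov (2*k))"
      by (subst prod.reindex) (auto simp: inj_on_def)
    finally show ?thesis by (simp add: spt_term_def)
  qed
  also have "\<dots> = (\<Prod>k\<in>insert n ?K. part_series k (w k))"
    using nK finite_spt_parts by (simp add: l o)
  finally have "spt_term N n = (\<Prod>k\<in>insert n ?K. part_series k (w k))" .
  then have "fps_nth (spt_term N n) i = fps_nth (\<Prod>k\<in>insert n ?K. part_series k (w k)) i" by (simp only:)
  also have "\<dots> = (\<Sum>M\<in>bounded_msets (insert n ?K) i. \<Prod>k\<in>insert n ?K. w k (count M k))"
    using prod_part_series_nth[OF _ nK(2), of w i] finite_spt_parts by blast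
  also have "\<dots> = (\<Sum>M\<in>bounded_msets (insert n ?K) i. int (count M n) * 2 ^ card {k \<in> ?K. k \<in># M})"
  proof (rule sum.cong)
    fix M
    have "(\<Prod>k\<in>?K. w k (count M k)) = (\<Prod>k\<in>?K. if k \<in># M then 2 else 1)"
      using nK(1) by (intro prod.cong) (auto simp: w_def count_eq_zero_iff)
    also have "\<dots> = (\<Prod>k | k \<in> ?K \<and> k \<in># M. 2)"
      by (rule prod.inter_filter[symmetric]) (rule finite_spt_parts)
    finally show "(\<Prod>k\<in>insert n ?K. w k (count M k)) = int (count M n) * 2 ^ card {k \<in> ?K. k \<in># M}"
      using nK finite_spt_parts by (simp add: w_def)
  qed simp
  finally show ?thesis .
qed

lemma card_subsets_containing:
  assumes "finite A" "x \<in> A"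
  shows "card {B. B \<subseteq> A \<and> x \<in> B} = 2 ^ card (A - {x})"
proof -
  have "{B. B \<subseteq> A \<and> x \<in> B} = insert x ` Pow (A - {x})"
  proof (intro set_eqI iffI)
    fix B assume "B \<in> {B. B \<subseteq> A \<and> x \<in> B}"
    then have "B = insert x (B - {x})" "B - {x} \<in> Pow (A - {x})" by auto
    then show "B \<in> insert x ` Pow (A - {x})" by blast
  qed (use assms in auto)
  moreover have "inj_on (insert x) (Pow (A - {x}))" by (auto simp: inj_on_def)
  ultimately show ?thesis using assms by (simp add: card_image card_Pow)
qed

lemma spt_omega_bar_eq:
  assumes "i \<le> N"
  shows "int (spt_omega_bar i) = fps_nth (\<Sum>n=1..N. spt_term N n) i"
proof -
  let ?m = "\<lambda>M :: nat multiset. Min (set_mset M)"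
  define A where "A = {M. (\<forall>k\<in>#M. 0 < k) \<and> sum_mset M = i \<and> M \<noteq> {#} \<and> (\<forall>k\<in>#M. odd k \<longrightarrow> k < 2 * ?m M)}"
  \<comment> \<open>The smallest part is overlined, every other distinct part freely, hence the
    power of 2.\<close>
  define g where "g M = count M (?m M) * 2 ^ card (set_mset M - {?m M})" for M
  have mM: "?m M \<in># M" if "M \<in> A" for M using that by (auto simp: A_def)
  have le: "k \<le> i" if "M \<in> A" "k \<in># M" for M k using that member_le_sum_mset[of k M] by (simp add: A_def)
  have "A \<subseteq> bounded_msets {1..i} i"
    using le by (force simp: A_def bounded_msets_def Suc_le_eq)
  then have finA: "finite A" by (rule finite_subset) (rule finite_bounded_msets; simp)
  have O: "spt_omega_overpartitions i = (SIGMA M:A. {Ov. Ov \<subseteq> set_mset M \<and> ?m M \<in> Ov})"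
    by (auto simp: spt_omega_overpartitions_def overpartitions_def A_def)
  have finO: "finite {Ov. Ov \<subseteq> set_mset M \<and> ?m M \<in> Ov}" for M
    by (rule finite_subset[of _ "Pow (set_mset M)"]) auto
  have "spt_omega_bar i = (\<Sum>M\<in>A. \<Sum>Ov | Ov \<subseteq> set_mset M \<and> ?m M \<in> Ov. count M (?m M))"
    unfolding spt_omega_bar_def O by (rule sum.Sigma[symmetric]) (use finA finO in auto)
  also have "\<dots> = (\<Sum>M\<in>A. g M)"
  proof (rule sum.cong)
    fix M assume "M \<in> A"
    then show "(\<Sum>Ov | Ov \<subseteq> set_mset M \<and> ?m M \<in> Ov. count M (?m M)) = g M"
      using card_subsets_containing[OF finite_set_mset mM] by (simp add: g_def)
  qed simp
  also have "\<dots> = (\<Sum>n\<in>{1..N}. \<Sum>M | M \<in> A \<and> ?m M = n. g M)"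
  proof (rule sum.group[symmetric])
    have "1 \<le> ?m M \<and> ?m M \<le> N" if "M \<in> A" for M
      using mM[OF that] le[OF that mM[OF that]] that assms by (auto simp: A_def Suc_le_eq)
    then show "?m ` A \<subseteq> {1..N}" by auto
  qed (use finA in auto)
  also have "int \<dots> = (\<Sum>n\<in>{1..N}. fps_nth (spt_term N n) i)"
    unfolding of_nat_sum
  proof (rule sum.cong)
    fix n assume "n \<in> {1..N}"
    then have n: "0 < n" by simp
    let ?K = "spt_parts N n"
    let ?B = "{M \<in> A. ?m M = n}" and ?C = "bounded_msets (insert n ?K) i"
    let ?f = "\<lambda>M. int (count M n) * 2 ^ card {k \<in> ?K. k \<in># M}"
    have sub: "set_mset M \<subseteq> insert n ?K" if "M \<in> ?B" for M
    proof
      fix k assume k: "k \<in># M"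
      then have nk: "n \<le> k" "odd k \<longrightarrow> k < 2*n" "k \<le> N" using that le[of M k] assms by (auto simp: A_def)
      show "k \<in> insert n ?K"
      proof (cases "k = n \<or> k \<le> 2*n")
        case False
        then obtain j where "k = 2*j" using nk(2) by (auto elim: evenE)
        then have "j \<in> {n+1..N}" "k = 2*j" using False nk(3) by auto
        then show ?thesis by (auto simp: spt_parts_def)
      qed (use nk(1) in \<open>auto simp: spt_parts_def\<close>)
    qed
    have "(\<Sum>M\<in>?C. ?f M) = (\<Sum>M\<in>?B. ?f M)"
    proof (rule sum.mono_neutral_right)
      show "finite ?C" using finite_spt_parts spt_parts_greater[of 0 N n] n
        by (intro finite_bounded_msets) auto
      show "?B \<subseteq> ?C" using sub by (auto simp: bounded_msets_def A_def)
      \<comment> \<open>A multiset over the allowed parts that contains \<open>n\<close> has minimum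
        \<open>n\<close> and satisfies the parity condition, so it lies in \<open>B\<close>. The
        others have \<open>count M n = 0\<close>.\<close>
      show "\<forall>M\<in>?C - ?B. ?f M = 0"
      proof
        fix M assume M: "M \<in> ?C - ?B"
        have "n \<notin># M"
        proof
          assume nM: "n \<in># M"
          have ge: "n \<le> k" if "k \<in># M" for k
            using that M spt_parts_greater[of k N n] by (auto simp: bounded_msets_def)
          then have min: "?m M = n" using nM by (intro Min_eqI) auto
          have "k < 2*n" if "k \<in># M" "odd k" for k
          proof -
            have "k \<in> insert n ?K" using that(1) M by (auto simp: bounded_msets_def)
            moreover have "k \<noteq> 2*n" using that(2) by auto
            ultimately show ?thesis using that(2) n by (auto simp: spt_parts_def)
          qed
          moreover have "\<forall>k\<in>#M. 0 < k" using ge n by force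
          ultimately have "M \<in> A" using M nM min by (auto simp: A_def bounded_msets_def)
          then show False using M min by auto
        qed
        then show "?f M = 0" by (simp add: not_in_iff)
      qed
    qed
    also have "\<dots> = (\<Sum>M\<in>?B. int (g M))"
    proof (rule sum.cong)
      fix M assume M: "M \<in> ?B"
      have "{k \<in> ?K. k \<in># M} = set_mset M - {n}"
        using sub[OF M] spt_parts_greater[of _ N n] by fastforce
      then show "?f M = int (g M)" using M by (simp add: g_def)
    qed simp
    finally show "(\<Sum>M\<in>?B. int (g M)) = fps_nth (spt_term N n) i"
      by (simp add: spt_term_nth[OF n])
  qed simp
  finally show ?thesis by (simp add: fps_sum_nth)
qed

definition spt_gf :: "int fps" where "spt_gf = Abs_fps (\<lambda>n. int (spt_omega_bar n))"

lemma spt_gf_eq: "dilate (theta4 0) * spt_gf = lam 1 + dilate (appell 1)"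
  by (rule theta_times_series) (simp add: spt_gf_def spt_omega_bar_eq)

section \<open>The congruences\<close>

definition even_part :: "int fps \<Rightarrow> int fps" where "even_part f = Abs_fps (\<lambda>n. fps_nth f (2 * n))"

lemma even_part_add: "even_part (f + g) = even_part f + even_part g"
  and even_part_dilate: "even_part (dilate f) = f"
  by (rule fps_ext; simp add: even_part_def dilate_nth)+

lemma even_part_dilate_mult: "even_part (dilate f * g) = f * even_part g"
proof (rule fps_ext)
  fix n
  have "fps_nth (even_part (dilate f * g)) n = (\<Sum>j\<in>{0..2*n}. fps_nth (dilate f) j * fps_nth g (2*n - j))"
    by (simp add: even_part_def fps_mult_nth)
  also have "\<dots> = (\<Sum>j\<in>(\<lambda>j. 2*j) ` {0..n}. fps_nth (dilate f) j * fps_nth g (2*n - j))"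
    by (rule sum.mono_neutral_right) (auto simp: dilate_nth elim!: evenE)
  also have "\<dots> = (\<Sum>j\<in>{0..n}. fps_nth f j * fps_nth g (2 * (n - j)))"
    by (subst sum.reindex) (auto simp: inj_on_def dilate_nth diff_mult_distrib2)
  finally show "fps_nth (even_part (dilate f * g)) n = fps_nth (f * even_part g) n"
    by (simp add: even_part_def fps_mult_nth)
qed

text \<open>An even product with odd cofactor has an even first factor, and halving that factor is a
  bijection.\<close>

lemma even_part_lam_odd: "even_part (lam_odd 1) = 2 * lam_odd 1"
proof (rule fps_ext)
  fix n
  have "fps_nth (even_part (lam_odd 1)) n = (\<Sum>x | x \<in> podd \<and> (case x of (a,k) \<Rightarrow> a * k) = int (2*n). case x of (a,k) \<Rightarrow> a^1)"
    by (simp only: even_part_def lam_odd_def qseries_nth fps_nth_Abs_fps)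
  also have "\<dots> = (\<Sum>x | x \<in> podd \<and> (case x of (a,k) \<Rightarrow> a * k) = int n. case x of (a,k) \<Rightarrow> 2 * a^1)"
  proof (rule sum.reindex_bij_witness[where i="\<lambda>(a,k). (2*a,k)" and j="\<lambda>(a,k). (a div 2,k)"])
    fix x assume "x \<in> {x. x \<in> podd \<and> (case x of (a,k) \<Rightarrow> a * k) = int (2*n)}"
    then obtain a k where x: "x = (a,k)" "1 \<le> a" "1 \<le> k" "odd k" "a * k = 2 * int n" by (auto simp: podd_def)
    then have "even (a * k)" by simp
    then have "even a" using x(4) by simp
    then obtain b where "a = 2*b" by blast
    with x show "(\<lambda>(a,k). (2*a,k)) ((\<lambda>(a,k). (a div 2,k)) x) = x"
      "(\<lambda>(a,k). (a div 2,k)) x \<in> {x. x \<in> podd \<and> (case x of (a,k) \<Rightarrow> a * k) = int n}"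
      "(case (\<lambda>(a,k). (a div 2,k)) x of (a,k) \<Rightarrow> 2 * a^1) = (case x of (a,k) \<Rightarrow> a^1)"
      by (simp_all add: podd_def)
  qed (auto simp: podd_def)
  also have "\<dots> = fps_nth (2 * lam_odd 1) n"
    by (simp add: lam_odd_def qseries_numeral_mult qseries_nth case_prod_unfold)
  finally show "fps_nth (even_part (lam_odd 1)) n = fps_nth (2 * lam_odd 1) n" .
qed

lemma even_part_spt_gf: "theta4 0 * even_part spt_gf = lam 1 + 2 * lam_odd 1 + appell 1"
proof -
  have "lam 1 = lam_odd 1 + dilate (lam 1)" using lam_odd_dilate[of 1] by simp
  then have "even_part (lam 1) = even_part (lam_odd 1 + dilate (lam 1))" by (rule arg_cong)
  then have "even_part (lam 1) = 2 * lam_odd 1 + lam 1"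
    by (simp only: even_part_add even_part_lam_odd even_part_dilate)
  moreover have "theta4 0 * even_part spt_gf = even_part (lam 1) + appell 1"
    by (simp only: even_part_dilate_mult[symmetric] spt_gf_eq even_part_add even_part_dilate)
  ultimately show ?thesis by simp
qed

lemma spt_even_mod_3: "3 dvd (m + 1) * spt_omega_bar (2 * m)"
proof -
  have "of_int 3 dvd qD (even_part spt_gf) + even_part spt_gf"
    using even_part_mod_3[OF even_part_spt_gf] by simp
  from dvd_int_fpsD[OF this, of m]
  have "int 3 dvd int ((m + 1) * spt_omega_bar (2 * m))"
    by (simp add: qD_nth even_part_def spt_gf_def algebra_simps)
  then show ?thesis by (simp only: of_nat_dvd_iff)
qed

text \<open>In degree 5m + 3 the operator D - 3 multiplies by 5m, whatever \<open>G\<close>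
  is.\<close>

lemma spt_even_mod_5: "5 dvd spt_omega_bar (2 * (5 * m + 3))"
proof -
  obtain G where G: "5 dvd even_part spt_gf - (qD G - 3 * G)"
    by (rule even_part_mod_5[OF even_part_spt_gf])
  then have "of_int 5 dvd even_part spt_gf - (qD G - 3 * G)" by simp
  from dvd_int_fpsD[OF this, of "5 * m + 3"]
  have "5 dvd int (spt_omega_bar (2 * (5 * m + 3))) - 5 * (int m * fps_nth G (5 * m + 3))"
    by (simp add: qD_nth even_part_def spt_gf_def fps_numeral_fps_const algebra_simps)
  then have "int 5 dvd int (spt_omega_bar (2 * (5 * m + 3)))"
    using dvd_add_left_iff[of 5 "- 5 * (int m * fps_nth G (5 * m + 3))"] by (simp add: dvd_diff_left_iff)
  then show ?thesis by (simp only: of_nat_dvd_iff)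
qed

text \<open>In odd degrees \<open>spt_gf\<close> equals \<open>Q * a\<close>, where \<open>Q\<close>
  is the inverse of theta at q^2, since everything else is a series in q^2. From
  \<open>qD Q = 4 * (b * Q)\<close> and qD a \<equiv> a - 4 a^2 modulo 3, (D - 1) (Q a) is 4 Q (b a
  - a^2) modulo 3; a parity argument disposes of this term.\<close>

lemma spt_odd_mod_3:
  assumes N: "odd N"
  shows "3 dvd (N - 1) * spt_omega_bar N"
proof -
  obtain P where P: "P * theta4 0 = 1" and qP: "qD P = 2 * (lam_odd 1 * P)" by (rule inverse_theta4)
  define Q a b where "Q = dilate P" and "a = lam_odd 1" and "b = dilate (lam_odd 1)"
  have z: "fps_nth (dilate f) N = 0" for f using N by (simp add: dilate_nth)
  have "dilate 1 = 1" using dilate_of_int[of 1] by simp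
  then have QP: "Q * dilate (theta4 0) = 1" using arg_cong[OF P, of dilate] by (simp add: Q_def dilate_mult)
  have "spt_gf = Q * dilate (theta4 0) * spt_gf" by (simp add: QP)
  also have "\<dots> = Q * (lam 1 + dilate (appell 1))" by (simp only: spt_gf_eq mult.assoc)
  also have "lam 1 = a + dilate (lam 1)" using lam_odd_dilate[of 1] by (simp add: a_def)
  also have "Q * (a + dilate (lam 1) + dilate (appell 1)) = Q * a + dilate (P * (lam 1 + appell 1))"
    by (simp only: Q_def dilate_mult dilate_add distrib_left add.assoc)
  finally have e: "spt_gf = Q * a + dilate (P * (lam 1 + appell 1))" .
  have F: "fps_nth spt_gf N = fps_nth (Q * a) N"
    unfolding e by (simp only: fps_add_nth z add_0_right)
  have qQ: "qD Q = 4 * (b * Q)" by (simp add: Q_def b_def qD_dilate qP dilate_mult dilate_numeral)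
  obtain c where "lam_odd 3 - lam_odd 1 = 3 * c" using lam_cong(2) by blast
  then have c: "qD a = a - 4 * a^2 + 3 * c" unfolding lam_odd_3 a_def[symmetric] by (simp add: algebra_simps)
  define u where "u = Abs_fps (\<lambda>n. fps_nth a (2*n+1))"
  have dX: "dilate fps_X = fps_X^2" by (simp add: dilate_def)
  have a2: "fps_nth a (2*n) = 2 * fps_nth (lam_odd 1) n" for n
    using arg_cong[OF even_part_lam_odd, of "\<lambda>f. fps_nth f n"]
    by (simp only: even_part_def fps_nth_Abs_fps a_def fps_numeral_fps_const fps_mult_left_const_nth)
  have a: "a = fps_X * dilate u + 2 * b"
  proof (rule fps_ext)
    fix n
    show "fps_nth a n = fps_nth (fps_X * dilate u + 2 * b) n"
    proof (cases "even n")
      case True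
      then obtain m where m: "n = 2*m" by blast
      show ?thesis unfolding m a2 by (cases m) (simp_all add: b_def dilate_nth fps_numeral_fps_const)
    next
      case False
      then obtain m where m: "n = 2*m+1" by (auto elim: oddE)
      show ?thesis unfolding m by (simp add: b_def dilate_nth fps_numeral_fps_const u_def)
    qed
  qed
  let ?y = "fps_X * dilate u"
  have "qD (Q * a) - Q * a = 4 * (Q * (b * a - a^2)) + 3 * (Q * c)"
    by (simp add: qD_mult qQ c algebra_simps)
  \<comment> \<open>With \<open>y\<close> the odd-degree half of \<open>a\<close> and
    \<open>2 * b\<close> the even one, b a - a^2 = - (y^2 + 3 y b + 2 b^2). The cross term carries
    the factor 3, while y^2, b^2 and \<open>Q\<close> are series in q^2 and contribute nothing in
    the odd degree \<open>N\<close>.\<close>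
  also have "Q * (b * a - a^2) = Q * - (fps_X^2 * dilate u * dilate u + 3 * (?y * b) + 2 * (b * b))"
  proof (rule arg_cong[where f="\<lambda>x. Q * x"])
    have "b * x - x^2 = - (y * y + 3 * (y * b) + 2 * (b * b))" if "x = y + 2 * b" for x y :: "int fps"
      unfolding that by (simp add: algebra_simps power2_eq_square)
    from this[OF a] show "b * a - a^2 = - (fps_X^2 * dilate u * dilate u + 3 * (?y * b) + 2 * (b * b))"
      by (simp only: power2_eq_square ac_simps)
  qed
  also have "4 * (Q * - (fps_X^2 * dilate u * dilate u + 3 * (?y * b) + 2 * (b * b))) + 3 * (Q * c)
     = 3 * (Q * c - 4 * (Q * (?y * b))) - 4 * (Q * (fps_X^2 * dilate u * dilate u + 2 * (b * b)))"
    by (simp add: algebra_simps)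
  also have "4 * (Q * (fps_X^2 * dilate u * dilate u + 2 * (b * b))) = dilate (4 * (P * (fps_X * u * u + 2 * (lam_odd 1 * lam_odd 1))))"
    by (simp only: Q_def b_def dilate_mult dilate_add dilate_numeral dX)
  finally have d3: "fps_nth (qD (Q * a) - Q * a) N = 3 * fps_nth (Q * c - 4 * (Q * (?y * b))) N"
    by (simp only: fps_sub_nth z fps_numeral_fps_const fps_mult_left_const_nth diff_zero)
  have "fps_nth (qD (Q * a) - Q * a) N = (int N - 1) * fps_nth (Q * a) N"
    by (simp only: fps_sub_nth qD_nth left_diff_distrib mult_1_left)
  then have "3 dvd (int N - 1) * fps_nth spt_gf N"
    unfolding F d3 by (rule dvdI[OF sym])
  moreover have N1: "int N - 1 = int (N - 1)" using odd_pos[OF N] by simp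
  have "(int N - 1) * fps_nth spt_gf N = int ((N - 1) * spt_omega_bar N)"
    unfolding N1 spt_gf_def by (simp only: fps_nth_Abs_fps of_nat_mult)
  ultimately have "int 3 dvd int ((N - 1) * spt_omega_bar N)" by (simp only: of_nat_numeral)
  then show ?thesis by (simp only: of_nat_dvd_iff)
qed

text \<open>For even N = 2m the factor m + 1, for odd N the factor N - 1, is divisible by 3 only if
  N \<equiv> 1 modulo 3.\<close>

lemma spt_mod_3:
  assumes "N mod 3 = 0 \<or> N mod 3 = 2"
  shows "3 dvd spt_omega_bar N"
proof -
  have p: "prime (3 :: nat)" by simp
  show ?thesis
  proof (cases "even N")
    case True
    then obtain m where m: "N = 2 * m" by blast
    then have "\<not> 3 dvd m + 1" using assms by presburger
    then show ?thesis using spt_even_mod_3[of m] unfolding prime_dvd_mult_iff[OF p] m by simp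
  next
    case False
    then have "\<not> 3 dvd N - 1" using assms by presburger
    then show ?thesis using spt_odd_mod_3[OF False] unfolding prime_dvd_mult_iff[OF p] by simp
  qed
qed

text \<open>N \<equiv> 2 modulo 3 is not a square, so the divisors fall into pairs of distinct
  complementary ones; both are odd because N is, and each pair has even sum.\<close>

lemma lam_even:
  assumes "N mod 6 = 5"
  shows "even (fps_nth (lam 1) N)"
proof -
  let ?S = "{x. x \<in> pos2 \<and> (case x of (a,k) \<Rightarrow> a * k) = int N}"
  let ?L = "{(a,k). (a,k) \<in> ?S \<and> a < k}" and ?G = "{(a,k). (a,k) \<in> ?S \<and> k < a}"
  have fin: "finite ?S" by (rule qok_finite[OF qok_prod])
  have N: "int N mod 2 = 1" "int N mod 3 = 2" using assms by presburger+
  have "a \<noteq> k" if "a * k = int N" for a k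
  proof
    assume "a = k"
    then have "(a mod 3) * (a mod 3) mod 3 = 2" using that N(2) by (simp add: mod_mult_eq)
    moreover have "a mod 3 = 0 \<or> a mod 3 = 1 \<or> a mod 3 = 2" by presburger
    ultimately show False by auto
  qed
  then have S: "?S = ?L \<union> ?G" by (auto simp: neq_iff)
  have "(\<Sum>x\<in>?G. case x of (a,k) \<Rightarrow> a) = (\<Sum>x\<in>?L. case x of (a,k) \<Rightarrow> k)"
    by (rule sum.reindex_bij_witness[where i="\<lambda>(a,k). (k,a)" and j="\<lambda>(a,k). (k,a)"])
       (auto simp: pos2_def mult.commute)
  moreover have "(\<Sum>x\<in>?S. case x of (a,k) \<Rightarrow> a) = (\<Sum>x\<in>?L \<union> ?G. case x of (a,k) \<Rightarrow> a)"
    by (rule sum.cong[OF S refl])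
  moreover have "(\<Sum>x\<in>?L \<union> ?G. case x of (a,k) \<Rightarrow> a) = (\<Sum>x\<in>?L. case x of (a,k) \<Rightarrow> a) + (\<Sum>x\<in>?G. case x of (a,k) \<Rightarrow> a)"
    by (rule sum.union_disjoint) (auto intro: finite_subset[OF _ fin])
  ultimately have "(\<Sum>x\<in>?S. case x of (a,k) \<Rightarrow> a) = (\<Sum>x\<in>?L. (case x of (a,k) \<Rightarrow> a + k))"
    by (simp add: sum.distrib case_prod_unfold)
  also have "even \<dots>"
  proof (rule dvd_sum)
    fix x assume "x \<in> ?L"
    then obtain a k where x: "x = (a,k)" "a * k = int N" by auto
    have "odd (a * k)" unfolding x(2) using N(1) by presburger
    then show "even (case x of (a,k) \<Rightarrow> a + k)" by (simp add: x(1))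
  qed
  finally show ?thesis by (simp add: lam_def qseries_nth)
qed

text \<open>Theta is 1 modulo 2, and the Appell series, dilated to q^2, has no odd degrees; the
  parity is that of the divisor sum.\<close>

lemma spt_mod_2:
  assumes "N mod 6 = 5"
  shows "2 dvd spt_omega_bar N"
proof -
  have c: "fps_nth (2 * f) N = 2 * fps_nth f N" for f :: "int fps"
    by (simp only: fps_numeral_fps_const fps_mult_left_const_nth)
  have "odd N" using assms by presburger
  then have "fps_nth (dilate (appell 1)) N = 0" by (simp add: dilate_nth)
  moreover have "dilate (theta4 0) = 1 + 2 * dilate (theta4_pos 0)"
    using dilate_of_int[of 1] by (simp add: theta4_theta4_pos(1) dilate_add dilate_mult dilate_numeral)
  then have "spt_gf = lam 1 + dilate (appell 1) - 2 * (dilate (theta4_pos 0) * spt_gf)"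
    using spt_gf_eq by (simp add: algebra_simps)
  then have "fps_nth spt_gf N = fps_nth (lam 1 + dilate (appell 1) - 2 * (dilate (theta4_pos 0) * spt_gf)) N"
    by (rule arg_cong[where f="\<lambda>f. fps_nth f N"])
  ultimately have "fps_nth spt_gf N = fps_nth (lam 1) N - 2 * fps_nth (dilate (theta4_pos 0) * spt_gf) N"
    by (simp only: c fps_add_nth fps_sub_nth add_0_right)
  then have "even (fps_nth spt_gf N)" using lam_even[OF assms] by simp
  then show ?thesis by (simp add: spt_gf_def)
qed

theorem theorem1p5:
  fixes n :: nat
  shows "(n \<ge> 1 \<longrightarrow> spt_omega_bar (3 * n) mod 3 = 0)
    \<and> spt_omega_bar (3 * n + 2) mod 3 = 0
    \<and> spt_omega_bar (10 * n + 6) mod 5 = 0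
    \<and> spt_omega_bar (6 * n + 5) mod 6 = 0"
proof -
  have "3 dvd spt_omega_bar (3 * n)" "3 dvd spt_omega_bar (3 * n + 2)"
    by (rule spt_mod_3, presburger)+
  moreover have "10 * n + 6 = 2 * (5 * n + 3)" by simp
  then have "5 dvd spt_omega_bar (10 * n + 6)" by (simp only: spt_even_mod_5)
  moreover have "(6 * n + 5) mod 6 = 5" "(6 * n + 5) mod 3 = 2" by presburger+
  then have "2 dvd spt_omega_bar (6 * n + 5)" "3 dvd spt_omega_bar (6 * n + 5)"
    by (simp_all only: spt_mod_2 spt_mod_3 simp_thms)
  then have "spt_omega_bar (6 * n + 5) mod 6 = 0" by presburger
  ultimately show ?thesis by (simp add: dvd_eq_mod_eq_0)
qed

end
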